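(* Let $q$ be a fixed prime power and, for $n\ge 1$, let $G_n$ be the number of ordered pairs of commuting $n\times n$ matrices (not necessarily invertible) over $\mathbb{F}_q$. Then \[ \lim_{n \rightarrow \infty} \frac{G_n}{q^{n^2+n}} = \prod_{j \geq 1} (1-1/q^j)^{-j} .\] *)

theory Defs
  imports
    "Jordan_Normal_Form.Matrix"
    "HOL-Analysis.Infinite_Products"
    "HOL-Number_Theory.Prime_Powers"
begin

definition commuting_pairs :: "nat \<Rightarrow> ('a :: semiring_0 mat \<times> 'a mat) set" where
  "commuting_pairs n =
     {(A, B). A \<in> carrier_mat n n \<and> B \<in> carrier_mat n n \<and> A * B = B * A}"

text \<open>The finite field is a type \<open>'a\<close>, passed as a type token because \<open>'a\<close> does not occur in
  the result type.\<close>

definition num_commuting_pairs :: "'a :: {field, finite} itself \<Rightarrow> nat \<Rightarrow> nat" where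
  "num_commuting_pairs _ n = card (commuting_pairs n :: ('a mat \<times> 'a mat) set)"

end

theory Submission
  imports Defs "Jordan_Normal_Form.Determinant" "Jordan_Normal_Form.Matrix_Kernel"
    "HOL-Computational_Algebra.Polynomial" "HOL-Library.Function_Algebras" "HOL-Analysis.Uniform_Limit"
begin

unbundle no vec_syntax
hide_const (open) Finite_Cartesian_Product.vec Finite_Cartesian_Product.mat
hide_type (open) Finite_Cartesian_Product.vec

text \<open>Write \<open>t = 1/q\<close> and \<open>qp n = (1 - t) \<dots> (1 - t\<^sup>n)\<close>, so that \<open>|GL\<^sub>n| = q\<^bsup>n\<^sup>2\<^esup> qp n\<close>. The number
  of commuting pairs is the sum over all \<open>A\<close> of the orders of the centralizers \<open>C(A)\<close>; let
  \<open>R(n, m)\<close> be the part of this sum over \<open>A\<close> of nullity \<open>m\<close>. A rank factorization \<open>A = PQ\<close>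
  through dimension \<open>k = n - m\<close> satisfies \<open>|C(PQ)| = q\<^bsup>m\<^sup>2\<^esup> |C(QP)|\<close>, which expresses
  \<open>R(n, m)\<close> through \<open>R(k, j)\<close>, \<open>j \<le> m\<close>. The initial values are given by orbit counting:
  \<open>R(n, 0) / |GL\<^sub>n|\<close> is the number of similarity classes, that is, by the rational canonical form,
  of chains of monic polynomials \<open>f\<^sub>n dvd \<dots> dvd f\<^sub>1\<close> of total degree \<open>n\<close>, and this number
  is asymptotic to \<open>q\<^sup>n / qp \<infinity>\<close>.

  Normalized and in the limit \<open>n \<rightarrow> \<infinity>\<close>, the recursion determines numbers \<open>\<sigma>\<^sub>m\<close>, and by
  dominated convergence the density of commuting pairs tends to \<open>\<Phi>(1)\<close>, where
  \<open>\<Phi>(z) = \<Sum>\<^sub>m \<sigma>\<^sub>m z\<^sup>m\<close>. It satisfies \<open>\<Phi>(z) = E(tz) \<Phi>(tz)\<close> with Euler's series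
  \<open>E(z) = \<Sum>\<^sub>k z\<^sup>k / qp k\<close>, and \<open>E(t\<^sup>i) = qp (i - 1) / qp \<infinity>\<close>; iterating gives the product.\<close>

section \<open>Injective and surjective matrices\<close>

text \<open>Orbit counting needs a group, so it evaluates only the sum over invertible
  \<open>A\<close>; the obstacle is the nilpotent part of \<open>A\<close>. Rank factorizations
  remove it in layers: \<open>QP\<close> is the matrix of \<open>A = PQ\<close> on its own image,
  and passing from \<open>PQ\<close> to \<open>QP\<close> shortens each nilpotent Jordan block by
  one. So \<open>m\<close> is the number of these blocks, and \<open>j\<close>, the number of blocks
  of size at least two, cannot exceed it.

  In the density normalized by \<open>q^n |GL_n|\<close> all group orders cancel from the recursion
  except for \<open>1 / qp (m - j)\<close>, and a mismatch of \<open>m\<close> in the exponents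
  leaves the factor \<open>t^m\<close>. Together they form a rescaled Cauchy product, whence the
  functional equation of \<open>\<Phi>\<close>. The term \<open>j = m\<close> recurs on the right
  with the factor \<open>t^m < 1\<close>, so for fixed \<open>m > 0\<close> the recursion in
  \<open>n\<close> is a contraction and has a limit.

  The exponents in the answer arise because \<open>E(t^i)\<close> is the product of
  \<open>1 / (1 - t^l)\<close> over \<open>l >= i\<close>: the factor for a given \<open>l\<close>
  occurs once for each \<open>i\<close> from 1 to \<open>l\<close>.\<close>

lemma bij_betw_vec_PiE: "bij_betw (vec n) (PiE {..<n} (\<lambda>_. UNIV)) (carrier_vec n)"
proof (rule bij_betw_byWitness[where f' = "\<lambda>v. restrict (($) v) {..<n}"])
  show "\<forall>f\<in>PiE {..<n} (\<lambda>_. UNIV). restrict (($) (vec n f)) {..<n} = f"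
  proof safe
    fix f assume f: "f \<in> PiE {..<n} (\<lambda>_. UNIV)"
    show "restrict (($) (vec n f)) {..<n} = f"
      by (rule ext) (use f in \<open>auto simp: PiE_def extensional_def restrict_def\<close>)
  qed
  show "\<forall>v\<in>carrier_vec n. vec n (restrict (($) v) {..<n}) = v"
    by (rule ballI, rule eq_vecI) simp_all
  show "vec n ` (PiE {..<n} (\<lambda>_. UNIV)) \<subseteq> carrier_vec n" by (rule image_subsetI) simp
  show "(\<lambda>v. restrict (($) v) {..<n}) ` carrier_vec n \<subseteq> PiE {..<n} (\<lambda>_. UNIV)"
    by (rule image_subsetI) (simp add: PiE_def)
qed

lemma bij_betw_mat_PiE:
  "bij_betw (mat n k) (PiE ({..<n} \<times> {..<k}) (\<lambda>_. UNIV)) (carrier_mat n k)"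
proof (rule bij_betw_byWitness[where f' = "\<lambda>A. restrict (($$) A) ({..<n} \<times> {..<k})"])
  show "\<forall>f\<in>PiE ({..<n} \<times> {..<k}) (\<lambda>_. UNIV). restrict (($$) (mat n k f)) ({..<n} \<times> {..<k}) = f"
  proof safe
    fix f assume f: "f \<in> PiE ({..<n} \<times> {..<k}) (\<lambda>_. UNIV)"
    show "restrict (($$) (mat n k f)) ({..<n} \<times> {..<k}) = f"
      by (rule ext) (use f in \<open>fastforce simp: PiE_def extensional_def restrict_def\<close>)
  qed
  show "\<forall>A\<in>carrier_mat n k. mat n k (restrict (($$) A) ({..<n} \<times> {..<k})) = A"
    by (rule ballI, rule eq_matI) auto
  show "mat n k ` (PiE ({..<n} \<times> {..<k}) (\<lambda>_. UNIV)) \<subseteq> carrier_mat n k" by (rule image_subsetI) simp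
  show "(\<lambda>A. restrict (($$) A) ({..<n} \<times> {..<k})) ` carrier_mat n k
          \<subseteq> PiE ({..<n} \<times> {..<k}) (\<lambda>_. UNIV)" by (rule image_subsetI) (simp add: PiE_def)
qed

lemma card_carrier_vec: "card (carrier_vec n :: 'a::finite vec set) = CARD('a) ^ n"
  using bij_betw_same_card[OF bij_betw_vec_PiE[of n, where ?'a = 'a]] by (simp add: card_PiE)

lemma card_carrier_mat: "card (carrier_mat n k :: 'a::finite mat set) = CARD('a) ^ (n * k)"
  using bij_betw_same_card[OF bij_betw_mat_PiE[of n k, where ?'a = 'a]] by (simp add: card_PiE)

lemma finite_carrier_vec [simp]: "finite (carrier_vec n :: 'a::finite vec set)"
  using bij_betw_finite[OF bij_betw_vec_PiE[of n, where ?'a = 'a]] by (simp add: finite_PiE)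

lemma finite_carrier_mat [simp]: "finite (carrier_mat n k :: 'a::finite mat set)"
  using bij_betw_finite[OF bij_betw_mat_PiE[of n k, where ?'a = 'a]] by (simp add: finite_PiE)

section \<open>Matrices with trivial kernel\<close>

definition inj_mats :: "nat \<Rightarrow> nat \<Rightarrow> 'a::field mat set" where
  "inj_mats n k = {P \<in> carrier_mat n k. \<forall>v\<in>carrier_vec k. P *\<^sub>v v = 0\<^sub>v n \<longrightarrow> v = 0\<^sub>v k}"

lemma inj_matsD: "P \<in> inj_mats n k \<Longrightarrow> P \<in> carrier_mat n k"
  by (simp add: inj_mats_def)

lemma finite_inj_mats [simp]: "finite (inj_mats n k :: 'a::{field,finite} mat set)"
  by (rule finite_subset[of _ "carrier_mat n k"]) (auto simp: inj_mats_def)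

lemma inj_mats_inj_on:
  assumes "P \<in> inj_mats n k"
  shows "inj_on ((*\<^sub>v) P) (carrier_vec k)"
proof (rule inj_onI)
  fix v w assume v: "v \<in> carrier_vec k" and w: "w \<in> carrier_vec k" and eq: "P *\<^sub>v v = P *\<^sub>v w"
  have P: "P \<in> carrier_mat n k" using assms by (rule inj_matsD)
  have "P *\<^sub>v (v - w) = 0\<^sub>v n"
    using mult_minus_distrib_mat_vec[OF P v w] eq P v w by auto
  hence "v - w = 0\<^sub>v k" using assms v w by (auto simp: inj_mats_def)
  hence "(v - w) $ i = 0" if "i < k" for i using that by simp
  thus "v = w" using v w by (intro eq_vecI) auto
qed

lemma mult_mat_vec_mat:
  assumes "A \<in> carrier_mat n k" "v \<in> carrier_vec k" "i < n"
  shows "(A *\<^sub>v v) $ i = (\<Sum>j<k. A $$ (i, j) * v $ j)"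
  using assms by (auto simp: scalar_prod_def lessThan_atLeast0 intro!: sum.cong)

lemma mult_mat_index:
  assumes "A \<in> carrier_mat n k" "B \<in> carrier_mat k m" "i < n" "j < m"
  shows "(A * B) $$ (i, j) = (\<Sum>l<k. A $$ (i, l) * B $$ (l, j))"
  using assms by (auto simp: scalar_prod_def lessThan_atLeast0 intro!: sum.cong)

text \<open>For square matrices a trivial kernel means a nonzero determinant, so
  \<open>inj_mats n n\<close> is the general linear group.\<close>

lemma inj_mats_inverse:
  assumes "g \<in> inj_mats n n"
  obtains h where "h \<in> inj_mats n n" "g * h = 1\<^sub>m n" "h * g = 1\<^sub>m n"
proof -
  have g: "g \<in> carrier_mat n n" using assms by (rule inj_matsD)
  have "det g \<noteq> 0"
    using assms det_0_iff_vec_prod_zero_field[OF g] by (auto simp: inj_mats_def)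
  from det_non_zero_imp_unit[OF g this, of "()"] obtain h
    where h: "h \<in> carrier_mat n n" "g * h = 1\<^sub>m n" "h * g = 1\<^sub>m n"
    unfolding Units_def ring_mat_def by auto
  have "v = 0\<^sub>v n" if "v \<in> carrier_vec n" "h *\<^sub>v v = 0\<^sub>v n" for v
    using assoc_mult_mat_vec[OF g h(1) that(1)] that h g by auto
  with h have "h \<in> inj_mats n n" by (auto simp: inj_mats_def)
  with h that show ?thesis by blast
qed

lemma left_inverse_inj_mats:
  assumes "P \<in> carrier_mat n k" "L \<in> carrier_mat k n" "L * P = 1\<^sub>m k"
  shows "P \<in> inj_mats n k"
proof -
  have "v = 0\<^sub>v k" if "v \<in> carrier_vec k" "P *\<^sub>v v = 0\<^sub>v n" for v
    using assoc_mult_mat_vec[OF assms(2,1) that(1)] that assms by auto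
  with assms show ?thesis by (auto simp: inj_mats_def)
qed

lemma inj_mats_mult:
  assumes "P \<in> inj_mats n m" "Q \<in> inj_mats m k"
  shows "P * Q \<in> inj_mats n k"
proof -
  have c: "P \<in> carrier_mat n m" "Q \<in> carrier_mat m k" using assms by (auto dest: inj_matsD)
  have "v = 0\<^sub>v k" if v: "v \<in> carrier_vec k" "P * Q *\<^sub>v v = 0\<^sub>v n" for v
  proof -
    have "P *\<^sub>v (Q *\<^sub>v v) = 0\<^sub>v n" using assoc_mult_mat_vec[OF c v(1)] v by simp
    moreover have "Q *\<^sub>v v \<in> carrier_vec m" using c v by simp
    ultimately have "Q *\<^sub>v v = 0\<^sub>v m" using assms(1) by (auto simp: inj_mats_def)
    thus ?thesis using assms(2) v(1) by (auto simp: inj_mats_def)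
  qed
  with c show ?thesis by (auto simp: inj_mats_def)
qed

section \<open>Building injective matrices column by column\<close>

definition take_cols :: "nat \<Rightarrow> 'a mat \<Rightarrow> 'a mat" where
  "take_cols k A = mat (dim_row A) k (($$) A)"

definition add_col :: "'a mat \<Rightarrow> 'a vec \<Rightarrow> 'a mat" where
  "add_col P v = mat (dim_row P) (Suc (dim_col P)) (\<lambda>(i, j). if j < dim_col P then P $$ (i, j) else v $ i)"

lemma take_cols_carrier [simp]: "A \<in> carrier_mat n m \<Longrightarrow> take_cols k A \<in> carrier_mat n k"
  by (simp add: take_cols_def)

lemma add_col_carrier [simp]: "P \<in> carrier_mat n k \<Longrightarrow> add_col P v \<in> carrier_mat n (Suc k)"
  by (auto simp: add_col_def)

lemma add_col_mult_vec:
  fixes P :: "'a::field mat"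
  assumes P: "P \<in> carrier_mat n k" and v: "v \<in> carrier_vec n" and w: "w \<in> carrier_vec (Suc k)"
  shows "add_col P v *\<^sub>v w = P *\<^sub>v vec k (($) w) + w $ k \<cdot>\<^sub>v v"
proof (rule eq_vecI)
  fix i assume "i < dim_vec (P *\<^sub>v vec k (($) w) + w $ k \<cdot>\<^sub>v v)"
  hence i: "i < n" using v by simp
  have "(add_col P v *\<^sub>v w) $ i = (\<Sum>j<Suc k. add_col P v $$ (i, j) * w $ j)"
    using mult_mat_vec_mat[OF add_col_carrier[OF P] w i] .
  also have "\<dots> = (\<Sum>j<k. P $$ (i, j) * w $ j) + v $ i * w $ k"
    using P i by (simp add: add_col_def)
  also have "(\<Sum>j<k. P $$ (i, j) * w $ j) = (P *\<^sub>v vec k (($) w)) $ i"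
    by (subst mult_mat_vec_mat[OF P _ i]) auto
  finally show "(add_col P v *\<^sub>v w) $ i = (P *\<^sub>v vec k (($) w) + w $ k \<cdot>\<^sub>v v) $ i"
    using i v P by (simp add: mult.commute)
qed (use P v in \<open>auto simp: add_col_def\<close>)

lemma card_mult_image:
  assumes "P \<in> (inj_mats n k :: 'a::{field,finite} mat set)"
  shows "card ((*\<^sub>v) P ` carrier_vec k) = CARD('a) ^ k"
  using card_image[OF inj_mats_inj_on[OF assms]] by (simp add: card_carrier_vec)

lemma mult_image_subset:
  "P \<in> inj_mats n k \<Longrightarrow> (*\<^sub>v) P ` carrier_vec k \<subseteq> carrier_vec n"
  by (auto dest: inj_matsD)

text \<open>A kernel vector of the enlarged matrix either has last entry 0 and comes from the kernel
  of \<open>P\<close>, or it can be solved for \<open>v\<close> as an element of the image of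
  \<open>P\<close>.\<close>

lemma add_col_inj_mats_iff:
  fixes P :: "'a::field mat"
  assumes P: "P \<in> carrier_mat n k" and v: "v \<in> carrier_vec n"
  shows "add_col P v \<in> inj_mats n (Suc k) \<longleftrightarrow> P \<in> inj_mats n k \<and> v \<notin> (*\<^sub>v) P ` carrier_vec k"
proof safe
  assume *: "add_col P v \<in> inj_mats n (Suc k)"
  have "u = 0\<^sub>v k" if u: "u \<in> carrier_vec k" "P *\<^sub>v u = 0\<^sub>v n" for u
  proof -
    define w where "w = vec (Suc k) (\<lambda>i. if i < k then u $ i else 0)"
    have w: "w \<in> carrier_vec (Suc k)" "vec k (($) w) = u" "w $ k = 0"
      using u by (auto simp: w_def)
    have "add_col P v *\<^sub>v w = 0\<^sub>v n"
      using add_col_mult_vec[OF P v w(1)] w u v by (auto)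
    hence "w = 0\<^sub>v (Suc k)" using * w(1) by (auto simp: inj_mats_def)
    thus ?thesis using w(2) by (auto)
  qed
  with P show "P \<in> inj_mats n k" by (auto simp: inj_mats_def)
next
  fix u :: "'a vec" assume *: "add_col P (P *\<^sub>v u) \<in> inj_mats n (Suc k)" and u: "u \<in> carrier_vec k" "v = P *\<^sub>v u"
  \<comment> \<open>The last entry -1 cancels \<open>P u\<close> against the new column
    \<open>v = P u\<close>.\<close>
  define w where "w = vec (Suc k) (\<lambda>i. if i < k then u $ i else -1)"
  have w: "w \<in> carrier_vec (Suc k)" "vec k (($) w) = u" "w $ k = -1"
    using u by (auto simp: w_def)
  have "add_col P v *\<^sub>v w = 0\<^sub>v n"
    using add_col_mult_vec[OF P v w(1)] w u v P by (auto)
  hence "w = 0\<^sub>v (Suc k)" using * w(1) u(2) by (auto simp: inj_mats_def)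
  thus False using w(3) by simp
next
  assume P': "P \<in> inj_mats n k" and nv: "v \<notin> (*\<^sub>v) P ` carrier_vec k"
  have "w = 0\<^sub>v (Suc k)" if w: "w \<in> carrier_vec (Suc k)" "add_col P v *\<^sub>v w = 0\<^sub>v n" for w
  proof -
    have eq: "P *\<^sub>v vec k (($) w) + w $ k \<cdot>\<^sub>v v = 0\<^sub>v n"
      using add_col_mult_vec[OF P v w(1)] w by simp
    have wk: "w $ k = 0"
    proof (rule ccontr)
      assume nz: "w $ k \<noteq> 0"
      have "v = P *\<^sub>v ((- inverse (w $ k)) \<cdot>\<^sub>v vec k (($) w))"
      proof (rule eq_vecI)
        fix i assume "i < dim_vec (P *\<^sub>v ((- inverse (w $ k)) \<cdot>\<^sub>v vec k (($) w)))"
        hence i: "i < n" using P by simp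
        have "(P *\<^sub>v vec k (($) w)) $ i + w $ k * v $ i = 0"
          using arg_cong[OF eq, of "\<lambda>x. x $ i"] i v P by simp
        thus "v $ i = (P *\<^sub>v ((- inverse (w $ k)) \<cdot>\<^sub>v vec k (($) w))) $ i"
          using nz i P by (subst mult_mat_vec[of _ n k]) (auto simp: field_simps add_eq_0_iff2)
      qed (use P v in auto)
      with nv show False by auto
    qed
    moreover have "0 \<cdot>\<^sub>v v = 0\<^sub>v n" using v by auto
    ultimately have "P *\<^sub>v vec k (($) w) = 0\<^sub>v n" using eq P by auto
    hence "vec k (($) w) = 0\<^sub>v k" using P' by (auto simp: inj_mats_def)
    hence "vec k (($) w) $ i = 0" if "i < k" for i using that by simp
    hence "w $ i = 0" if "i < Suc k" for i
      using that wk by (cases "i = k") auto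
    thus ?thesis using w(1) by (auto)
  qed
  with P v show "add_col P v \<in> inj_mats n (Suc k)" by (auto simp: inj_mats_def)
qed

lemma inj_mats_le:
  assumes "P \<in> (inj_mats n k :: 'a::{field,finite} mat set)"
  shows "k \<le> n"
proof -
  have "CARD('a) ^ k \<le> CARD('a) ^ n"
    using card_mono[OF _ mult_image_subset[OF assms]] by (simp add: card_mult_image[OF assms] card_carrier_vec)
  moreover have "CARD('a) > 1" using card_mono[of UNIV "{0,1::'a}"] by simp
  ultimately show ?thesis by simp
qed

text \<open>Completion to a basis by counting: for \<open>k < n\<close> the image has only
  \<open>q^k < q^n\<close> elements, so a vector outside it can serve as the next column. The
  induction descends from \<open>k = n\<close>.\<close>

lemma inj_mats_extend:
  assumes "P \<in> (inj_mats n k :: 'a::{field,finite} mat set)"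
  obtains g where "g \<in> inj_mats n n" "take_cols k g = P"
proof -
  have "\<exists>g\<in>inj_mats n n. take_cols k g = P"
    using inj_mats_le[OF assms] assms
  proof (induction k arbitrary: P rule: inc_induct)
    case base
    thus ?case by (intro bexI[of _ P]) (auto simp: take_cols_def inj_mats_def intro: eq_matI)
  next
    case (step k)
    have q: "CARD('a) > 1" using card_mono[of UNIV "{0,1::'a}"] by simp
    have "(*\<^sub>v) P ` carrier_vec k \<noteq> carrier_vec n"
    proof
      assume "(*\<^sub>v) P ` carrier_vec k = carrier_vec n"
      hence "CARD('a) ^ k = CARD('a) ^ n"
        using card_mult_image[OF step.prems] by (simp add: card_carrier_vec)
      thus False using q step.hyps by simp
    qed
    then obtain v where v: "v \<in> carrier_vec n" "v \<notin> (*\<^sub>v) P ` carrier_vec k"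
      using mult_image_subset[OF step.prems] by blast
    have P: "P \<in> carrier_mat n k" using step.prems by (rule inj_matsD)
    have "add_col P v \<in> inj_mats n (Suc k)"
      using add_col_inj_mats_iff[OF P v(1)] v step.prems by blast
    from step.IH[OF this] obtain g where g: "g \<in> inj_mats n n" "take_cols (Suc k) g = add_col P v"
      by blast
    have "take_cols k g = take_cols k (take_cols (Suc k) g)"
      by (auto simp: take_cols_def intro: eq_matI)
    also have "\<dots> = P" unfolding g using P by (auto simp: take_cols_def add_col_def intro: eq_matI)
    finally show ?case using g by blast
  qed
  thus ?thesis using that by blast
qed

text \<open>Among the injective matrices with image inside \<open>W\<close> take one with the most
  columns, a number bounded by \<open>n\<close>. If its image missed a vector of \<open>W\<close>,
  that vector could be added as a column.\<close>

lemma subspace_basis: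
  fixes W :: "'a::{field,finite} vec set"
  assumes W: "W \<subseteq> carrier_vec n" "0\<^sub>v n \<in> W"
    "\<And>v w. v \<in> W \<Longrightarrow> w \<in> W \<Longrightarrow> v + w \<in> W" "\<And>c v. v \<in> W \<Longrightarrow> c \<cdot>\<^sub>v v \<in> W"
  obtains k P where "P \<in> inj_mats n k" "(*\<^sub>v) P ` carrier_vec k = W"
proof -
  define S where "S = {k. \<exists>P\<in>inj_mats n k. (*\<^sub>v) P ` carrier_vec k \<subseteq> W}"
  have "S \<subseteq> {..n}" using inj_mats_le by (auto simp: S_def)
  hence fin: "finite S" using finite_subset by blast
  have z: "u = 0\<^sub>v 0" if "u \<in> carrier_vec 0" for u :: "'a vec" using that by auto
  have "0 \<in> S" unfolding S_def
  proof (intro CollectI bexI[of _ "0\<^sub>m n 0"])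
    have "0\<^sub>m n 0 *\<^sub>v u = 0\<^sub>v n" if "u \<in> carrier_vec 0" for u :: "'a vec"
      using that by (intro eq_vecI) (auto simp: scalar_prod_def)
    thus "(*\<^sub>v) (0\<^sub>m n 0) ` carrier_vec 0 \<subseteq> W" using W(2) by auto
  qed (auto simp: inj_mats_def dest!: z)
  define k where "k = Max S"
  have "k \<in> S" using fin \<open>0 \<in> S\<close> by (auto simp: k_def intro!: Max_in)
  then obtain P where P: "P \<in> inj_mats n k" "(*\<^sub>v) P ` carrier_vec k \<subseteq> W" by (auto simp: S_def)
  have Pc: "P \<in> carrier_mat n k" using P(1) by (rule inj_matsD)
  have "v \<in> (*\<^sub>v) P ` carrier_vec k" if v: "v \<in> W" for v
  proof (rule ccontr)
    assume nv: "v \<notin> (*\<^sub>v) P ` carrier_vec k"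
    have vc: "v \<in> carrier_vec n" using v W by blast
    have 1: "add_col P v \<in> inj_mats n (Suc k)"
      using add_col_inj_mats_iff[OF Pc vc] P nv by blast
    have "add_col P v *\<^sub>v w \<in> W" if "w \<in> carrier_vec (Suc k)" for w
      unfolding add_col_mult_vec[OF Pc vc that] using v P(2) by (intro W(3,4)) auto
    hence "Suc k \<in> S" using 1 by (auto simp: S_def)
    thus False using Max_ge[OF fin, of "Suc k"] by (simp add: k_def)
  qed
  with P that show ?thesis by blast
qed

text \<open>Conditions on dimensions instead of carrier sets let the simplifier reassociate long
  products without guessing intermediate sizes.\<close>

lemma mult_assoc_dim:
  fixes A B C :: "'a::semiring_0 mat"
  assumes "dim_col A = dim_row B" "dim_col B = dim_row C"
  shows "A * B * C = A * (B * C)"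
proof (rule assoc_mult_mat)
  show "A \<in> carrier_mat (dim_row A) (dim_row B)" using assms(1) by (intro carrier_matI) simp_all
  show "B \<in> carrier_mat (dim_row B) (dim_row C)" using assms(2) by (intro carrier_matI) simp_all
  show "C \<in> carrier_mat (dim_row C) (dim_col C)" by (intro carrier_matI) simp_all
qed

lemma mult_cancel_dim:
  fixes L P X :: "'a::semiring_1 mat"
  assumes "L * P = 1\<^sub>m k" "dim_col L = dim_row P" "dim_row X = k"
  shows "L * (P * X) = X"
proof -
  have "dim_col P = k" using arg_cong[OF assms(1), of dim_col] by simp
  thus ?thesis using assms mult_assoc_dim[of L P X] by (simp add: left_mult_one_mat')
qed

lemma CARD_field_gt_1: "CARD('a::{field,finite}) > 1"
  using card_mono[of UNIV "{0,1::'a}"] by simp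

lemma add_col_eqD:
  assumes "add_col P v = add_col Q w" "P \<in> carrier_mat n k" "Q \<in> carrier_mat n k"
    "v \<in> carrier_vec n" "w \<in> carrier_vec n"
  shows "P = Q \<and> v = w"
proof
  have *: "add_col P v $$ (i, j) = add_col Q w $$ (i, j)" for i j using assms(1) by simp
  show "P = Q"
  proof (rule eq_matI)
    fix i j assume "i < dim_row Q" "j < dim_col Q"
    thus "P $$ (i, j) = Q $$ (i, j)" using *[of i j] assms(2-) by (simp add: add_col_def)
  qed (use assms(2-) in simp_all)
  show "v = w"
  proof (rule eq_vecI)
    fix i assume "i < dim_vec w"
    thus "v $ i = w $ i" using *[of i k] assms(2-) by (simp add: add_col_def)
  qed (use assms(2-) in simp_all)
qed

lemma add_col_take_cols:
  assumes "Q \<in> carrier_mat n (Suc k)"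
  shows "add_col (take_cols k Q) (col Q k) = Q"
proof (rule eq_matI)
  fix i j assume "i < dim_row Q" "j < dim_col Q"
  thus "add_col (take_cols k Q) (col Q k) $$ (i, j) = Q $$ (i, j)"
    using assms by (cases "j = k") (simp_all add: add_col_def take_cols_def)
qed (use assms in \<open>simp_all add: add_col_def take_cols_def\<close>)

text \<open>An injective matrix with \<open>k\<close> columns extends by exactly the
  \<open>q^n - q^k\<close> vectors outside its image.\<close>

lemma card_inj_mats:
  "card (inj_mats n k :: 'a::{field,finite} mat set) = (\<Prod>i<k. CARD('a) ^ n - CARD('a) ^ i)"
proof (induction k)
  case 0
  have "v = 0\<^sub>v 0" if "v \<in> carrier_vec 0" for v :: "'a vec"
    by (rule eq_vecI) (use that in simp_all)
  hence "inj_mats n 0 = (carrier_mat n 0 :: 'a mat set)" unfolding inj_mats_def by blast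
  thus ?case by (simp add: card_carrier_mat)
next
  case (Suc k)
  let ?S = "Sigma (inj_mats n k :: 'a mat set) (\<lambda>P. carrier_vec n - (*\<^sub>v) P ` carrier_vec k)"
  have "bij_betw (\<lambda>(P, v). add_col P v) ?S (inj_mats n (Suc k))"
    unfolding bij_betw_def
  proof (intro conjI inj_onI equalityI subsetI)
    fix x y assume "x \<in> ?S" "y \<in> ?S" "(\<lambda>(P, v). add_col P v) x = (\<lambda>(P, v). add_col P v) y"
    moreover obtain P v Q w where "x = (P, v)" "y = (Q, w)" by (cases x, cases y)
    ultimately show "x = y" using add_col_eqD[of P v Q w n k] inj_matsD[of P n k] inj_matsD[of Q n k]
      by simp
  next
    fix Q assume "Q \<in> (\<lambda>(P, v). add_col P v) ` ?S"
    then obtain P v where "P \<in> inj_mats n k" "v \<in> carrier_vec n - (*\<^sub>v) P ` carrier_vec k" "Q = add_col P v"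
      unfolding image_iff by (elim bexE SigmaE) simp
    thus "Q \<in> inj_mats n (Suc k)" using add_col_inj_mats_iff[of P n k v] inj_matsD[of P n k] by simp
  next
    fix Q :: "'a mat" assume Q: "Q \<in> inj_mats n (Suc k)"
    have Qc: "Q \<in> carrier_mat n (Suc k)" using Q by (rule inj_matsD)
    have c: "col Q k \<in> carrier_vec n" using Qc by (intro carrier_vecI) simp
    have "(take_cols k Q, col Q k) \<in> ?S"
      using Q add_col_inj_mats_iff[OF take_cols_carrier[OF Qc, of k] c] c
      unfolding add_col_take_cols[OF Qc] by simp
    thus "Q \<in> (\<lambda>(P, v). add_col P v) ` ?S"
      using add_col_take_cols[OF Qc] by (intro image_eqI[of _ _ "(take_cols k Q, col Q k)"]) simp_all
  qed
  hence "card (inj_mats n (Suc k) :: 'a mat set) = card ?S" by (simp add: bij_betw_same_card)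
  also have "\<dots> = (\<Sum>P\<in>(inj_mats n k :: 'a mat set). card (carrier_vec n - (*\<^sub>v) P ` carrier_vec k))"
    by (intro card_SigmaI ballI) simp_all
  also have "\<dots> = (\<Sum>P\<in>(inj_mats n k :: 'a mat set). CARD('a) ^ n - CARD('a) ^ k)"
  proof (rule sum.cong)
    fix P :: "'a mat" assume P: "P \<in> inj_mats n k"
    show "card (carrier_vec n - (*\<^sub>v) P ` carrier_vec k) = CARD('a) ^ n - CARD('a) ^ k"
      using card_Diff_subset[OF _ mult_image_subset[OF P]] by (simp add: card_carrier_vec card_mult_image[OF P])
  qed simp
  finally show ?case by (simp add: Suc)
qed

section \<open>Truncated identity matrices as normal forms\<close>

definition pid :: "nat \<Rightarrow> nat \<Rightarrow> 'a::semiring_1 mat" where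
  "pid n k = mat n k (\<lambda>(i, j). if i = j then 1 else 0)"

lemma pid_dim [simp]: "dim_row (pid n k) = n" "dim_col (pid n k) = k" "pid n k \<in> carrier_mat n k"
  by (simp_all add: pid_def)

lemma index_mult_pid:
  fixes A :: "'a::semiring_1 mat"
  assumes "A \<in> carrier_mat m n" "k \<le> n" "i < m" "j < k"
  shows "(A * pid n k) $$ (i, j) = A $$ (i, j)"
proof -
  have "(A * pid n k) $$ (i, j) = (\<Sum>l<n. if l = j then A $$ (i, j) else 0)"
  proof (subst mult_mat_index[of _ m n _ k])
    show "(\<Sum>l<n. A $$ (i, l) * pid n k $$ (l, j)) = (\<Sum>l<n. if l = j then A $$ (i, j) else 0)"
      by (rule sum.cong) (use assms in \<open>auto simp: pid_def\<close>)
  qed (use assms in simp_all)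
  thus ?thesis using assms by simp
qed

lemma index_pid_mult:
  fixes A :: "'a::semiring_1 mat"
  assumes "A \<in> carrier_mat n m" "k \<le> n" "i < k" "j < m"
  shows "(pid k n * A) $$ (i, j) = A $$ (i, j)"
proof -
  have "(pid k n * A) $$ (i, j) = (\<Sum>l<n. if l = i then A $$ (i, j) else 0)"
  proof (subst mult_mat_index[of _ k n _ m])
    show "(\<Sum>l<n. pid k n $$ (i, l) * A $$ (l, j)) = (\<Sum>l<n. if l = i then A $$ (i, j) else 0)"
      by (rule sum.cong) (use assms in \<open>auto simp: pid_def\<close>)
  qed (use assms in simp_all)
  thus ?thesis using assms by simp
qed

lemma take_cols_pid:
  fixes A :: "'a::semiring_1 mat"
  assumes "A \<in> carrier_mat m n" "k \<le> n"
  shows "take_cols k A = A * pid n k"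
proof (rule eq_matI)
  fix i j assume "i < dim_row (A * pid n k)" "j < dim_col (A * pid n k)"
  thus "take_cols k A $$ (i, j) = (A * pid n k) $$ (i, j)"
    using assms index_mult_pid[OF assms, of i j] by (simp add: take_cols_def)
qed (use assms in \<open>simp_all add: take_cols_def\<close>)

lemma pid_mult_pid:
  assumes "k \<le> n"
  shows "pid k n * pid n k = (1\<^sub>m k :: 'a::semiring_1 mat)"
proof (rule eq_matI)
  fix i j assume "i < dim_row (1\<^sub>m k :: 'a mat)" "j < dim_col (1\<^sub>m k :: 'a mat)"
  thus "(pid k n * pid n k) $$ (i, j) = (1\<^sub>m k :: 'a mat) $$ (i, j)"
    using index_pid_mult[of "pid n k" n k k i j] assms by (simp add: pid_def)
qed simp_all

lemma transpose_pid: "transpose_mat (pid n k) = pid k n"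
  by (rule eq_matI) (simp_all add: pid_def)

text \<open>The invertible matrices act transitively on the injective ones by left multiplication,
  so that counting problems about \<open>P\<close> can be reduced to \<open>pid n k\<close>.\<close>

lemma inj_mats_factor:
  fixes P :: "'a::{field,finite} mat"
  assumes "P \<in> inj_mats n k"
  obtains g where "g \<in> inj_mats n n" "P = g * pid n k" "k \<le> n"
proof -
  obtain g where "g \<in> inj_mats n n" "take_cols k g = P" using inj_mats_extend[OF assms] .
  with inj_mats_le[OF assms] take_cols_pid[OF inj_matsD, of g n n k] show ?thesis by (intro that[of g]) simp_all
qed

lemma inj_mats_left_inverse:
  fixes P :: "'a::{field,finite} mat"
  assumes "P \<in> inj_mats n k"
  obtains L where "L \<in> carrier_mat k n" "L * P = 1\<^sub>m k"
proof -
  obtain g where g: "g \<in> inj_mats n n" "P = g * pid n k" "k \<le> n"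
    using inj_mats_factor[OF assms] .
  obtain h where h: "h \<in> inj_mats n n" "g * h = 1\<^sub>m n" "h * g = 1\<^sub>m n"
    using inj_mats_inverse[OF g(1)] .
  have c: "g \<in> carrier_mat n n" "h \<in> carrier_mat n n" using g h by (auto dest: inj_matsD)
  have "(pid k n * h) * P = pid k n * (h * (g * pid n k))"
    using c unfolding g by (simp add: mult_assoc_dim)
  also have "\<dots> = 1\<^sub>m k" using c g(3) by (simp add: mult_cancel_dim[OF h(3)] pid_mult_pid)
  finally show ?thesis using mult_carrier_mat[OF pid_dim(3) c(2)] by (intro that[of "pid k n * h"])
qed

section \<open>Surjective matrices as transposes of injective ones\<close>

definition sur_mats :: "nat \<Rightarrow> nat \<Rightarrow> 'a::field mat set" where
  "sur_mats k n = {Q \<in> carrier_mat k n. transpose_mat Q \<in> inj_mats n k}"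

lemma sur_matsD: "Q \<in> sur_mats k n \<Longrightarrow> Q \<in> carrier_mat k n"
  by (simp add: sur_mats_def)

lemma finite_sur_mats [simp]: "finite (sur_mats k n :: 'a::{field,finite} mat set)"
  by (rule finite_subset[of _ "carrier_mat k n"]) (auto simp: sur_mats_def)

lemma card_sur_mats: "card (sur_mats k n :: 'a::{field,finite} mat set) = card (inj_mats n k :: 'a mat set)"
proof (rule bij_betw_same_card[of transpose_mat])
  show "bij_betw transpose_mat (sur_mats k n) (inj_mats n k :: 'a mat set)"
    by (rule bij_betw_byWitness[where f' = transpose_mat])
       (use inj_matsD in \<open>simp_all add: sur_mats_def image_subset_iff, blast\<close>)
qed

lemma right_inverse_sur_mats:
  assumes "Q \<in> carrier_mat k n" "R \<in> carrier_mat n k" "Q * R = 1\<^sub>m k"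
  shows "Q \<in> sur_mats k n"
  using left_inverse_inj_mats[of "transpose_mat Q" n k "transpose_mat R"] transpose_mult[OF assms(1,2)] assms
  by (simp add: sur_mats_def)

lemma inj_mats_sq_iff_sur_mats: "h \<in> inj_mats n n \<longleftrightarrow> h \<in> sur_mats n n"
proof
  assume h: "h \<in> inj_mats n n"
  obtain g where "g \<in> inj_mats n n" "h * g = 1\<^sub>m n" using inj_mats_inverse[OF h] .
  thus "h \<in> sur_mats n n" using h by (intro right_inverse_sur_mats) (auto dest: inj_matsD)
next
  assume h: "h \<in> sur_mats n n"
  hence hc: "h \<in> carrier_mat n n" "transpose_mat h \<in> inj_mats n n" by (auto simp: sur_mats_def)
  obtain g where g: "g \<in> inj_mats n n" "transpose_mat h * g = 1\<^sub>m n"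
    using inj_mats_inverse[OF hc(2)] .
  hence "transpose_mat g * h = 1\<^sub>m n"
    using transpose_mult[of "transpose_mat h" n n g n] hc by (auto dest: inj_matsD)
  thus "h \<in> inj_mats n n" using g hc by (intro left_inverse_inj_mats) (auto dest: inj_matsD)
qed

lemma sur_mats_factor:
  fixes Q :: "'a::{field,finite} mat"
  assumes "Q \<in> sur_mats k n"
  obtains h where "h \<in> inj_mats n n" "Q = pid k n * h" "k \<le> n"
proof -
  have Q: "transpose_mat Q \<in> inj_mats n k" using assms by (simp add: sur_mats_def)
  obtain g where g: "g \<in> inj_mats n n" "transpose_mat Q = g * pid n k" "k \<le> n"
    using inj_mats_factor[OF Q] .
  have gc: "g \<in> carrier_mat n n" using g(1) by (rule inj_matsD)
  have "transpose_mat g \<in> inj_mats n n"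
    unfolding inj_mats_sq_iff_sur_mats using g(1) gc by (simp add: sur_mats_def)
  moreover have "Q = pid k n * transpose_mat g"
    using transpose_mult[OF gc, of "pid n k" k] arg_cong[OF g(2), of transpose_mat] by (simp add: transpose_pid)
  ultimately show ?thesis using g(3) by (intro that)
qed

lemma sur_mats_right_inverse:
  fixes Q :: "'a::{field,finite} mat"
  assumes "Q \<in> sur_mats k n"
  obtains R where "R \<in> carrier_mat n k" "Q * R = 1\<^sub>m k"
proof -
  have *: "transpose_mat Q \<in> inj_mats n k" "Q \<in> carrier_mat k n" using assms by (auto simp: sur_mats_def)
  obtain L where L: "L \<in> carrier_mat k n" "L * transpose_mat Q = 1\<^sub>m k"
    using inj_mats_left_inverse[OF *(1)] .
  hence "Q * transpose_mat L = 1\<^sub>m k"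
    using transpose_mult[OF L(1), of "transpose_mat Q" k] * by auto
  thus ?thesis using that[of "transpose_mat L"] L by auto
qed

section \<open>Centralizers and rank factorization\<close>

lemma mult_pid_eq_0_iff:
  fixes A :: "'a::semiring_1 mat"
  assumes "A \<in> carrier_mat m n" "k \<le> n"
  shows "A * pid n k = 0\<^sub>m m k \<longleftrightarrow> (\<forall>i<m. \<forall>j<k. A $$ (i, j) = 0)"
proof
  assume eq: "A * pid n k = 0\<^sub>m m k"
  show "\<forall>i<m. \<forall>j<k. A $$ (i, j) = 0"
  proof (intro allI impI)
    fix i j assume "i < m" "j < k"
    thus "A $$ (i, j) = 0" using index_mult_pid[OF assms, of i j] by (simp add: eq)
  qed
next
  assume *: "\<forall>i<m. \<forall>j<k. A $$ (i, j) = 0"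
  show "A * pid n k = 0\<^sub>m m k"
  proof (rule eq_matI)
    fix i j assume "i < dim_row (0\<^sub>m m k :: 'a mat)" "j < dim_col (0\<^sub>m m k :: 'a mat)"
    thus "(A * pid n k) $$ (i, j) = 0\<^sub>m m k $$ (i, j)"
      using index_mult_pid[OF assms, of i j] * by simp
  qed (use assms in simp_all)
qed

lemma pid_mult_eq_0_iff:
  fixes A :: "'a::semiring_1 mat"
  assumes "A \<in> carrier_mat n m" "k \<le> n"
  shows "pid k n * A = 0\<^sub>m k m \<longleftrightarrow> (\<forall>i<k. \<forall>j<m. A $$ (i, j) = 0)"
proof
  assume eq: "pid k n * A = 0\<^sub>m k m"
  show "\<forall>i<k. \<forall>j<m. A $$ (i, j) = 0"
  proof (intro allI impI)
    fix i j assume "i < k" "j < m"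
    thus "A $$ (i, j) = 0" using index_pid_mult[OF assms, of i j] by (simp add: eq)
  qed
next
  assume *: "\<forall>i<k. \<forall>j<m. A $$ (i, j) = 0"
  show "pid k n * A = 0\<^sub>m k m"
  proof (rule eq_matI)
    fix i j assume "i < dim_row (0\<^sub>m k m :: 'a mat)" "j < dim_col (0\<^sub>m k m :: 'a mat)"
    thus "(pid k n * A) $$ (i, j) = 0\<^sub>m k m $$ (i, j)"
      using index_pid_mult[OF assms, of i j] * by simp
  qed (use assms in simp_all)
qed

text \<open>The two equations make the first \<open>k\<close> columns and the first \<open>k\<close>
  rows vanish, and the remaining square block of size \<open>n - k\<close> is free.\<close>

lemma card_corner:
  assumes "k \<le> n"
  shows "card {Y \<in> carrier_mat n n. Y * pid n k = 0\<^sub>m n k \<and> pid k n * Y = (0\<^sub>m k n :: 'a::{field,finite} mat)}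
           = CARD('a) ^ ((n - k) * (n - k))" (is "card ?S = _")
proof -
  let ?f = "\<lambda>D::'a mat. mat n n (\<lambda>(i, j). if i < k \<or> j < k then 0 else D $$ (i - k, j - k))"
  let ?g = "\<lambda>Y::'a mat. mat (n - k) (n - k) (\<lambda>(i, j). Y $$ (i + k, j + k))"
  have S: "Y \<in> ?S \<longleftrightarrow> Y \<in> carrier_mat n n \<and> (\<forall>i<n. \<forall>j<n. i < k \<or> j < k \<longrightarrow> Y $$ (i, j) = 0)" for Y :: "'a mat"
  proof (cases "Y \<in> carrier_mat n n")
    case True
    have "i < n" if "i < k" for i using that assms by simp
    thus ?thesis
      unfolding mem_Collect_eq mult_pid_eq_0_iff[OF True assms] pid_mult_eq_0_iff[OF True assms] by blast
  qed simp
  have "bij_betw ?f (carrier_mat (n - k) (n - k)) ?S"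
  proof (rule bij_betw_byWitness[where f' = ?g])
    show "\<forall>D\<in>carrier_mat (n - k) (n - k). ?g (?f D) = D"
    proof (intro ballI eq_matI)
      fix D :: "'a mat" and i j
      assume "D \<in> carrier_mat (n - k) (n - k)" "i < dim_row D" "j < dim_col D"
      thus "?g (?f D) $$ (i, j) = D $$ (i, j)" by simp
    qed simp_all
    show "\<forall>Y\<in>?S. ?f (?g Y) = Y"
    proof
      fix Y :: "'a mat" assume "Y \<in> ?S"
      hence Y: "Y \<in> carrier_mat n n" "\<forall>i<n. \<forall>j<n. i < k \<or> j < k \<longrightarrow> Y $$ (i, j) = 0"
        unfolding S by blast+
      show "?f (?g Y) = Y"
      proof (rule eq_matI)
        fix i j assume ij: "i < dim_row Y" "j < dim_col Y"
        thus "?f (?g Y) $$ (i, j) = Y $$ (i, j)"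
          using Y assms by (cases "i < k"; cases "j < k") (simp_all add: not_less diff_less_mono)
      qed (use Y in simp_all)
    qed
    show "?f ` carrier_mat (n - k) (n - k) \<subseteq> ?S"
    proof (rule image_subsetI)
      fix D :: "'a mat" show "?f D \<in> ?S" unfolding S by simp
    qed
    show "?g ` ?S \<subseteq> carrier_mat (n - k) (n - k)"
      by (rule image_subsetI) simp
  qed
  from bij_betw_same_card[OF this] show ?thesis by (simp add: card_carrier_mat)
qed

lemma bij_betw_mult_both:
  fixes g h :: "'a::field mat"
  assumes "h \<in> inj_mats n n" "g \<in> inj_mats m m"
  shows "bij_betw (\<lambda>Z. h * Z * g) (carrier_mat n m) (carrier_mat n m)"
proof -
  obtain h' where h': "h' \<in> inj_mats n n" "h * h' = 1\<^sub>m n" "h' * h = 1\<^sub>m n"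
    using inj_mats_inverse[OF assms(1)] .
  obtain g' where g': "g' \<in> inj_mats m m" "g * g' = 1\<^sub>m m" "g' * g = 1\<^sub>m m"
    using inj_mats_inverse[OF assms(2)] .
  note c = inj_matsD[OF assms(1)] inj_matsD[OF assms(2)] inj_matsD[OF h'(1)] inj_matsD[OF g'(1)]
  have 1: "h' * (h * Z * g) * g' = Z" if "Z \<in> carrier_mat n m" for Z
    using that c by (simp add: mult_assoc_dim mult_cancel_dim[OF h'(3)] g')
  have 2: "h * (h' * Z * g') * g = Z" if "Z \<in> carrier_mat n m" for Z
    using that c by (simp add: mult_assoc_dim mult_cancel_dim[OF h'(2)] g')
  show ?thesis
    by (rule bij_betw_byWitness[where f' = "\<lambda>Z. h' * Z * g'"])
       (use 1 2 c in \<open>simp_all add: image_subset_iff\<close>)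
qed

text \<open>With \<open>P = g * pid n k\<close> and \<open>Q = pid k n * h\<close>, the substitution
  \<open>Z \<mapsto> h * Z * g\<close> turns both conditions into those of
  \<open>card_corner\<close>.\<close>

lemma card_annihilators:
  fixes P Q :: "'a::{field,finite} mat"
  assumes P: "P \<in> inj_mats n k" and Q: "Q \<in> sur_mats k n"
  shows "card {Z \<in> carrier_mat n n. Z * P = 0\<^sub>m n k \<and> Q * Z = 0\<^sub>m k n} = CARD('a) ^ ((n - k) * (n - k))"
proof -
  obtain g where g: "g \<in> inj_mats n n" "P = g * pid n k" and k: "k \<le> n" using inj_mats_factor[OF P] .
  obtain h where h: "h \<in> inj_mats n n" "Q = pid k n * h" using sur_mats_factor[OF Q] .
  obtain h' where h': "h' \<in> inj_mats n n" "h * h' = 1\<^sub>m n" "h' * h = 1\<^sub>m n"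
    using inj_mats_inverse[OF h(1)] .
  obtain g' where g': "g' \<in> inj_mats n n" "g * g' = 1\<^sub>m n" "g' * g = 1\<^sub>m n"
    using inj_mats_inverse[OF g(1)] .
  note c = inj_matsD[OF g(1)] inj_matsD[OF h(1)] inj_matsD[OF g'(1)] inj_matsD[OF h'(1)]
  let ?S = "{Z \<in> carrier_mat n n. Z * P = 0\<^sub>m n k \<and> Q * Z = 0\<^sub>m k n}"
  let ?T = "{Y \<in> carrier_mat n n. Y * pid n k = 0\<^sub>m n k \<and> pid k n * Y = (0\<^sub>m k n :: 'a mat)}"
  let ?f = "\<lambda>Z. h * Z * g"
  have bij: "bij_betw ?f (carrier_mat n n) (carrier_mat n n)" by (rule bij_betw_mult_both[OF h(1) g(1)])
  have iff: "?f Z \<in> ?T \<longleftrightarrow> Z \<in> ?S" if Z: "Z \<in> carrier_mat n n" for Z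
  proof -
    have 1: "?f Z * pid n k = h * (Z * P)" using c Z by (simp add: g(2) mult_assoc_dim)
    have 2: "pid k n * ?f Z = Q * Z * g" using c Z by (simp add: h(2) mult_assoc_dim)
    have 3: "h' * (h * (Z * P)) = Z * P" using c Z by (simp add: mult_cancel_dim[OF h'(3)])
    have 4: "Q * Z * g * g' = Q * Z" using c Z sur_matsD[OF Q] by (simp add: mult_assoc_dim g'(2))
    have "h * (Z * P) = 0\<^sub>m n k \<longleftrightarrow> Z * P = 0\<^sub>m n k" using 3 c by fastforce
    moreover have "Q * Z * g = 0\<^sub>m k n \<longleftrightarrow> Q * Z = 0\<^sub>m k n" using 4 c by fastforce
    moreover have "?f Z \<in> carrier_mat n n" using Z c by simp
    ultimately show ?thesis using Z unfolding mem_Collect_eq 1 2 by blast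
  qed
  have "bij_betw ?f ?S ?T"
    unfolding bij_betw_def
  proof
    show "inj_on ?f ?S" using bij by (auto simp: bij_betw_def intro: inj_on_subset)
    show "?f ` ?S = ?T"
    proof (intro equalityI subsetI)
      fix Y assume "Y \<in> ?f ` ?S" thus "Y \<in> ?T" using iff by blast
    next
      fix Y assume Y: "Y \<in> ?T"
      then obtain Z where "Z \<in> carrier_mat n n" "Y = ?f Z" using bij unfolding bij_betw_def by blast
      thus "Y \<in> ?f ` ?S" using iff Y by blast
    qed
  qed
  from bij_betw_same_card[OF this] show ?thesis by (simp add: card_corner[OF k])
qed

section \<open>Centralizers of \<open>PQ\<close> and \<open>QP\<close>\<close>

definition cent :: "nat \<Rightarrow> 'a::semiring_0 mat \<Rightarrow> 'a mat set" where
  "cent n A = {B \<in> carrier_mat n n. A * B = B * A}"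

lemma finite_cent [simp]: "finite (cent n A :: 'a::{semiring_0,finite} mat set)"
  by (rule finite_subset[of _ "carrier_mat n n"]) (simp_all add: cent_def)

lemma card_cent_mult_swap:
  fixes P Q :: "'a::{field,finite} mat"
  assumes P: "P \<in> inj_mats n k" and Q: "Q \<in> sur_mats k n"
  shows "card (cent n (P * Q)) = CARD('a) ^ ((n - k) * (n - k)) * card (cent k (Q * P))"
proof -
  obtain L where L: "L \<in> carrier_mat k n" "L * P = 1\<^sub>m k" using inj_mats_left_inverse[OF P] .
  obtain R where R: "R \<in> carrier_mat n k" "Q * R = 1\<^sub>m k" using sur_mats_right_inverse[OF Q] .
  note c = inj_matsD[OF P] sur_matsD[OF Q] L(1) R(1)
  note cc = carrier_matD[OF c(1)] carrier_matD[OF c(2)] carrier_matD[OF L(1)] carrier_matD[OF R(1)]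
  \<comment> \<open>\<open>B\<close> commutes with \<open>PQ\<close> iff it descends through \<open>P\<close> and \<open>Q\<close> to a matrix \<open>B'\<close> commuting
    with \<open>QP\<close>; the matrices over a given \<open>B'\<close> differ by those killed by \<open>P\<close> and \<open>Q\<close>.\<close>
  define S where "S B' = {B \<in> carrier_mat n n. B * P = P * B' \<and> Q * B = B' * Q}" for B'
  have cent: "cent n (P * Q) = (\<Union>B'\<in>cent k (Q * P). S B')"
  proof (intro equalityI subsetI)
    fix B assume "B \<in> cent n (P * Q)"
    hence B: "B \<in> carrier_mat n n" and comm: "P * Q * B = B * (P * Q)" by (simp_all add: cent_def)
    note d = carrier_matD[OF B]
    \<comment> \<open>The only candidate: multiply \<open>Q * B = B' * Q\<close> by the right
      inverse \<open>R\<close> of \<open>Q\<close>.\<close>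
    define B' where "B' = Q * (B * R)"
    have B': "B' \<in> carrier_mat k k" using B c by (simp add: B'_def)
    have 1: "B * P = P * B'"
    proof -
      have "B * P = B * (P * Q) * R" using cc d by (simp add: mult_assoc_dim R(2))
      also have "\<dots> = P * B'" using cc d by (simp add: comm[symmetric] mult_assoc_dim B'_def)
      finally show ?thesis .
    qed
    have 2: "Q * B = B' * Q"
    proof -
      have "Q * B = L * (P * (Q * B))" using cc d by (simp add: mult_cancel_dim[OF L(2)])
      also have "P * (Q * B) = B * P * Q" using cc d comm by (simp add: mult_assoc_dim)
      also have "L * \<dots> = L * (P * (B' * Q))" using cc d carrier_matD[OF B'] by (simp add: 1 mult_assoc_dim)
      also have "\<dots> = B' * Q" using cc carrier_matD[OF B'] by (simp add: mult_cancel_dim[OF L(2)])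
      finally show ?thesis .
    qed
    have "Q * P * B' = Q * B * P" using cc d carrier_matD[OF B'] by (simp add: mult_assoc_dim 1)
    also have "\<dots> = B' * (Q * P)" using cc d carrier_matD[OF B'] by (simp add: mult_assoc_dim 2)
    finally have "B' \<in> cent k (Q * P)" using B' by (simp add: cent_def)
    thus "B \<in> (\<Union>B'\<in>cent k (Q * P). S B')" using B 1 2 by (intro UN_I[of B']) (simp_all add: S_def)
  next
    fix B assume "B \<in> (\<Union>B'\<in>cent k (Q * P). S B')"
    then obtain B' where B': "B' \<in> carrier_mat k k" and B: "B \<in> carrier_mat n n"
      "B * P = P * B'" "Q * B = B' * Q"
      by (fastforce simp: S_def cent_def)
    note d = carrier_matD[OF B(1)] carrier_matD[OF B']
    have "P * Q * B = P * B' * Q" using cc d by (simp add: mult_assoc_dim B)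
    also have "\<dots> = B * P * Q" by (simp only: B)
    also have "\<dots> = B * (P * Q)" using cc d by (simp add: mult_assoc_dim)
    finally show "B \<in> cent n (P * Q)" using B(1) by (simp add: cent_def)
  qed
  have finS: "finite (S B')" for B'
    by (rule finite_subset[of _ "carrier_mat n n"]) (simp_all add: S_def)
  have disj: "S B' \<inter> S B'' = {}" if "B' \<in> cent k (Q * P)" "B'' \<in> cent k (Q * P)" "B' \<noteq> B''" for B' B''
  proof (rule ccontr)
    assume "S B' \<inter> S B'' \<noteq> {}"
    then obtain B where "B * P = P * B'" "B * P = P * B''" by (fastforce simp: S_def)
    hence "L * (P * B') = L * (P * B'')" by simp
    moreover have "B' \<in> carrier_mat k k" "B'' \<in> carrier_mat k k" using that by (simp_all add: cent_def)
    ultimately show False using that(3) cc by (simp add: mult_cancel_dim[OF L(2)])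
  qed
  have cardS: "card (S B') = CARD('a) ^ ((n - k) * (n - k))" if B': "B' \<in> cent k (Q * P)" for B'
  proof -
    have B'c: "B' \<in> carrier_mat k k" and B'comm: "Q * P * B' = B' * (Q * P)" using B' by (simp_all add: cent_def)
    note d = carrier_matD[OF B'c]
    \<comment> \<open>A particular solution. On the image of \<open>P\<close> the value
      \<open>P * B' * L\<close> is forced; on the complement onto which \<open>1 - P * L\<close>
      projects, the lift of \<open>B' * Q\<close> through \<open>R\<close> is taken. That both
      prescriptions agree after applying \<open>Q\<close> is the commutation of \<open>B'\<close>
      with \<open>Q * P\<close>.\<close>
    define B0 where "B0 = P * B' * L + R * (B' * Q) * (1\<^sub>m n - P * L)"
    let ?Z = "{Z \<in> carrier_mat n n. Z * P = 0\<^sub>m n k \<and> Q * Z = 0\<^sub>m k n}"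
    have PL: "P * L \<in> carrier_mat n n" and PBL: "P * B' * L \<in> carrier_mat n n"
      and RBQ: "R * (B' * Q) \<in> carrier_mat n n" and BQ: "B' * Q \<in> carrier_mat k n" using c B'c by simp_all
    have E: "1\<^sub>m n - P * L \<in> carrier_mat n n" by (rule minus_carrier_mat[OF PL])
    have RE: "R * (B' * Q) * (1\<^sub>m n - P * L) \<in> carrier_mat n n" by (rule mult_carrier_mat[OF RBQ E])
    have B0c: "B0 \<in> carrier_mat n n" unfolding B0_def by (rule add_carrier_mat[OF RE])
    have B0P: "B0 * P = P * B'"
    proof -
      have "(1\<^sub>m n - P * L) * P = 0\<^sub>m n k"
      proof -
        have "(1\<^sub>m n - P * L) * P = 1\<^sub>m n * P - P * L * P"
          using c by (intro minus_mult_distrib_mat[of _ n n]) simp_all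
        also have "P * L * P = P" using cc by (simp add: mult_assoc_dim L(2))
        finally show ?thesis using c by simp
      qed
      hence z: "R * (B' * Q) * (1\<^sub>m n - P * L) * P = 0\<^sub>m n k"
        using assoc_mult_mat[OF RBQ E c(1)] right_mult_zero_mat[OF RBQ] by simp
      have "B0 * P = P * B' * L * P + R * (B' * Q) * (1\<^sub>m n - P * L) * P"
        unfolding B0_def by (rule add_mult_distrib_mat[OF PBL RE c(1)])
      also have "P * B' * L * P = P * B'" using cc d by (simp add: mult_assoc_dim L(2))
      finally show ?thesis using z c B'c by simp
    qed
    have QB0: "Q * B0 = B' * Q"
    proof -
      have "Q * B0 = Q * (P * B' * L) + Q * (R * (B' * Q) * (1\<^sub>m n - P * L))"
        unfolding B0_def by (rule mult_add_distrib_mat[OF c(2) PBL RE])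
      also have "Q * (P * B' * L) = B' * (Q * P) * L" using cc d by (simp add: mult_assoc_dim B'comm[symmetric])
      also have "Q * (R * (B' * Q) * (1\<^sub>m n - P * L)) = B' * Q * (1\<^sub>m n - P * L)"
        using cc d by (simp add: mult_assoc_dim mult_cancel_dim[OF R(2)])
      also have "\<dots> = B' * Q * 1\<^sub>m n - B' * Q * (P * L)"
        by (rule mult_minus_distrib_mat[OF BQ one_carrier_mat PL])
      also have "B' * Q * (P * L) = B' * (Q * P) * L" using cc d by (simp add: mult_assoc_dim)
      finally have eq: "Q * B0 = B' * (Q * P) * L + (B' * Q * 1\<^sub>m n - B' * (Q * P) * L)" .
      show ?thesis
        unfolding eq by (rule eq_matI) (use c B'c in simp_all)
    qed
    have "bij_betw (\<lambda>Z. B0 + Z) ?Z (S B')"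
    proof (rule bij_betw_byWitness[where f' = "\<lambda>B. B - B0"])
      show "\<forall>Z\<in>?Z. B0 + Z - B0 = Z"
      proof
        fix Z assume "Z \<in> ?Z"
        hence "Z \<in> carrier_mat n n" by simp
        thus "B0 + Z - B0 = Z" using B0c by (intro eq_matI) simp_all
      qed
      show "\<forall>B\<in>S B'. B0 + (B - B0) = B"
      proof
        fix B assume "B \<in> S B'"
        hence "B \<in> carrier_mat n n" by (simp add: S_def)
        thus "B0 + (B - B0) = B" using B0c by (intro eq_matI) simp_all
      qed
      show "(+) B0 ` ?Z \<subseteq> S B'"
      proof (rule image_subsetI)
        fix Z assume "Z \<in> ?Z"
        hence Z: "Z \<in> carrier_mat n n" "Z * P = 0\<^sub>m n k" "Q * Z = 0\<^sub>m k n" by simp_all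
        have "(B0 + Z) * P = B0 * P + Z * P" by (rule add_mult_distrib_mat[OF B0c Z(1) c(1)])
        moreover have "Q * (B0 + Z) = Q * B0 + Q * Z" by (rule mult_add_distrib_mat[OF c(2) B0c Z(1)])
        ultimately show "B0 + Z \<in> S B'" using Z B0P QB0 c B'c B0c by (simp add: S_def)
      qed
      show "(\<lambda>B. B - B0) ` S B' \<subseteq> ?Z"
      proof (rule image_subsetI)
        fix B assume "B \<in> S B'"
        hence B: "B \<in> carrier_mat n n" "B * P = P * B'" "Q * B = B' * Q" by (simp_all add: S_def)
        have "(B - B0) * P = B * P - B0 * P" by (rule minus_mult_distrib_mat[OF B(1) B0c c(1)])
        moreover have "Q * (B - B0) = Q * B - Q * B0" by (rule mult_minus_distrib_mat[OF c(2) B(1) B0c])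
        ultimately show "B - B0 \<in> ?Z" using B B0P QB0 c B'c minus_carrier_mat[OF B0c, of B] by simp
      qed
    qed
    from bij_betw_same_card[OF this] show ?thesis by (simp add: card_annihilators[OF P Q])
  qed
  have "card (cent n (P * Q)) = (\<Sum>B'\<in>cent k (Q * P). card (S B'))"
    unfolding cent using finS disj by (intro card_UN_disjoint ballI impI) simp_all
  also have "\<dots> = (\<Sum>B'\<in>cent k (Q * P). CARD('a) ^ ((n - k) * (n - k)))"
    by (rule sum.cong) (simp_all add: cardS)
  finally show ?thesis by simp
qed

section \<open>Kernels, rank factorization and nullity\<close>

lemma mat_kernel_iff:
  assumes "A \<in> carrier_mat m n"
  shows "v \<in> mat_kernel A \<longleftrightarrow> v \<in> carrier_vec n \<and> A *\<^sub>v v = 0\<^sub>v m"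
  using assms by (simp add: mat_kernel_def)

text \<open>A right inverse \<open>R\<close> splits the space into the image of \<open>R\<close>, a
  copy of \<open>carrier_vec k\<close>, and the kernel of \<open>Q\<close>.\<close>

lemma card_mat_kernel_sur:
  fixes Q :: "'a::{field,finite} mat"
  assumes "Q \<in> sur_mats k n"
  shows "card (mat_kernel Q) = CARD('a) ^ (n - k)"
proof -
  obtain h where k: "k \<le> n" using sur_mats_factor[OF assms] .
  obtain R where R: "R \<in> carrier_mat n k" "Q * R = 1\<^sub>m k" using sur_mats_right_inverse[OF assms] .
  note Q = sur_matsD[OF assms]
  have QRy: "Q *\<^sub>v (R *\<^sub>v y) = y" if "y \<in> carrier_vec k" for y
    using assoc_mult_mat_vec[OF Q R(1) that] that by (simp add: R(2))
  have "bij_betw (\<lambda>(y, v). R *\<^sub>v y + v) (carrier_vec k \<times> mat_kernel Q) (carrier_vec n)"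
  proof (rule bij_betw_byWitness[where f' = "\<lambda>w. (Q *\<^sub>v w, w - R *\<^sub>v (Q *\<^sub>v w))"])
    show "\<forall>x\<in>carrier_vec k \<times> mat_kernel Q. (\<lambda>w. (Q *\<^sub>v w, w - R *\<^sub>v (Q *\<^sub>v w))) ((\<lambda>(y, v). R *\<^sub>v y + v) x) = x"
    proof
      fix x :: "'a vec \<times> 'a vec" assume "x \<in> carrier_vec k \<times> mat_kernel Q"
      then obtain y v where x: "x = (y, v)" "y \<in> carrier_vec k" "v \<in> carrier_vec n" "Q *\<^sub>v v = 0\<^sub>v k"
        using mat_kernel_iff[OF Q] by (cases x) simp
      have Ry: "R *\<^sub>v y \<in> carrier_vec n" using R x by simp
      have "Q *\<^sub>v (R *\<^sub>v y + v) = y"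
        using mult_add_distrib_mat_vec[OF Q Ry x(3)] QRy[OF x(2)] x by simp
      moreover have "R *\<^sub>v y + v - R *\<^sub>v y = v" by (rule eq_vecI) (use x R in simp_all)
      ultimately show "(\<lambda>w. (Q *\<^sub>v w, w - R *\<^sub>v (Q *\<^sub>v w))) ((\<lambda>(y, v). R *\<^sub>v y + v) x) = x"
        by (simp add: x(1))
    qed
    show "\<forall>w\<in>carrier_vec n. (\<lambda>(y, v). R *\<^sub>v y + v) (Q *\<^sub>v w, w - R *\<^sub>v (Q *\<^sub>v w)) = w"
    proof
      fix w :: "'a vec" assume w: "w \<in> carrier_vec n"
      have "R *\<^sub>v (Q *\<^sub>v w) + (w - R *\<^sub>v (Q *\<^sub>v w)) = w" by (rule eq_vecI) (use w R Q in simp_all)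
      thus "(\<lambda>(y, v). R *\<^sub>v y + v) (Q *\<^sub>v w, w - R *\<^sub>v (Q *\<^sub>v w)) = w" by simp
    qed
    show "(\<lambda>(y, v). R *\<^sub>v y + v) ` (carrier_vec k \<times> mat_kernel Q) \<subseteq> carrier_vec n"
    proof (rule image_subsetI)
      fix x :: "'a vec \<times> 'a vec" assume "x \<in> carrier_vec k \<times> mat_kernel Q"
      then obtain y v where x: "x = (y, v)" "y \<in> carrier_vec k" "v \<in> carrier_vec n"
        using mat_kernel_iff[OF Q] by (cases x) simp
      thus "(\<lambda>(y, v). R *\<^sub>v y + v) x \<in> carrier_vec n" using R by simp
    qed
    show "(\<lambda>w. (Q *\<^sub>v w, w - R *\<^sub>v (Q *\<^sub>v w))) ` carrier_vec n \<subseteq> carrier_vec k \<times> mat_kernel Q"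
    proof (rule image_subsetI)
      fix w :: "'a vec" assume w: "w \<in> carrier_vec n"
      have Qw: "Q *\<^sub>v w \<in> carrier_vec k" using w Q by simp
      have RQw: "R *\<^sub>v (Q *\<^sub>v w) \<in> carrier_vec n" using Qw R by simp
      have "Q *\<^sub>v (w - R *\<^sub>v (Q *\<^sub>v w)) = 0\<^sub>v k"
        using mult_minus_distrib_mat_vec[OF Q w RQw] QRy[OF Qw] Qw by simp
      moreover have "w - R *\<^sub>v (Q *\<^sub>v w) \<in> carrier_vec n" using w RQw by simp
      ultimately show "(Q *\<^sub>v w, w - R *\<^sub>v (Q *\<^sub>v w)) \<in> carrier_vec k \<times> mat_kernel Q"
        using Qw mat_kernel_iff[OF Q] by simp
    qed
  qed
  from bij_betw_same_card[OF this]
  have "CARD('a) ^ k * card (mat_kernel Q) = CARD('a) ^ n"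
    by (simp add: card_cartesian_product card_carrier_vec)
  also have "\<dots> = CARD('a) ^ k * CARD('a) ^ (n - k)" using k by (simp add: power_add[symmetric])
  finally show ?thesis by simp
qed

lemma mat_kernel_inj_mult:
  assumes P: "P \<in> inj_mats n k" and Q: "Q \<in> carrier_mat k m"
  shows "mat_kernel (P * Q) = mat_kernel Q"
proof -
  note Pc = inj_matsD[OF P]
  have PQ: "P * Q \<in> carrier_mat n m" using Pc Q by simp
  show ?thesis
  proof (intro equalityI subsetI)
    fix v assume "v \<in> mat_kernel (P * Q)"
    hence v: "v \<in> carrier_vec m" "P * Q *\<^sub>v v = 0\<^sub>v n" using mat_kernel_iff[OF PQ] by simp_all
    have "P *\<^sub>v (Q *\<^sub>v v) = 0\<^sub>v n" using v assoc_mult_mat_vec[OF Pc Q v(1)] by simp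
    moreover have "Q *\<^sub>v v \<in> carrier_vec k" using Q v by simp
    ultimately have "Q *\<^sub>v v = 0\<^sub>v k" using P unfolding inj_mats_def by blast
    thus "v \<in> mat_kernel Q" using v mat_kernel_iff[OF Q] by simp
  next
    fix v assume "v \<in> mat_kernel Q"
    hence v: "v \<in> carrier_vec m" "Q *\<^sub>v v = 0\<^sub>v k" using mat_kernel_iff[OF Q] by simp_all
    have "P *\<^sub>v 0\<^sub>v k = 0\<^sub>v n" by (rule eq_vecI) (use Pc in simp_all)
    thus "v \<in> mat_kernel (P * Q)" using v assoc_mult_mat_vec[OF Pc Q v(1)] mat_kernel_iff[OF PQ] by simp
  qed
qed

text \<open>The columns of \<open>P\<close> are a basis of the image of \<open>A\<close>, and
  \<open>Q\<close> holds the coordinates of the columns of \<open>A\<close> in this basis. As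
  \<open>A\<close> maps onto the image of \<open>P\<close>, every unit vector has a preimage under
  \<open>Q\<close>; these preimages are the columns of a right inverse.\<close>

lemma rank_factorization:
  fixes A :: "'a::{field,finite} mat"
  assumes A: "A \<in> carrier_mat n n"
  obtains k P Q where "P \<in> inj_mats n k" "Q \<in> sur_mats k n" "A = P * Q" "k \<le> n"
proof -
  have "\<exists>k P. P \<in> inj_mats n k \<and> (*\<^sub>v) P ` carrier_vec k = (*\<^sub>v) A ` carrier_vec n"
  proof -
    obtain k P where "P \<in> inj_mats n k" "(*\<^sub>v) P ` carrier_vec k = (*\<^sub>v) A ` carrier_vec n"
    proof (rule subspace_basis)
      show "(*\<^sub>v) A ` carrier_vec n \<subseteq> carrier_vec n" using A by (intro image_subsetI) simp
      have "A *\<^sub>v 0\<^sub>v n = 0\<^sub>v n" by (rule eq_vecI) (use A in simp_all)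
      thus "0\<^sub>v n \<in> (*\<^sub>v) A ` carrier_vec n" by (intro image_eqI[of _ _ "0\<^sub>v n"]) simp_all
    next
      fix v w assume "v \<in> (*\<^sub>v) A ` carrier_vec n" "w \<in> (*\<^sub>v) A ` carrier_vec n"
      then obtain x y where "x \<in> carrier_vec n" "y \<in> carrier_vec n" "v = A *\<^sub>v x" "w = A *\<^sub>v y" by blast
      thus "v + w \<in> (*\<^sub>v) A ` carrier_vec n"
        using mult_add_distrib_mat_vec[OF A] by (intro image_eqI[of _ _ "x + y"]) simp_all
    next
      fix c :: 'a and v assume "v \<in> (*\<^sub>v) A ` carrier_vec n"
      then obtain x where "x \<in> carrier_vec n" "v = A *\<^sub>v x" by blast
      thus "c \<cdot>\<^sub>v v \<in> (*\<^sub>v) A ` carrier_vec n"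
        using mult_mat_vec[OF A] by (intro image_eqI[of _ _ "c \<cdot>\<^sub>v x"]) simp_all
    qed
    thus ?thesis by blast
  qed
  then obtain k P where P: "P \<in> inj_mats n k" and im: "(*\<^sub>v) P ` carrier_vec k = (*\<^sub>v) A ` carrier_vec n"
    by blast
  note Pc = inj_matsD[OF P]
  have "\<exists>y\<in>carrier_vec k. P *\<^sub>v y = col A j" if "j < n" for j
  proof -
    have "col A j = A *\<^sub>v unit_vec n j" by (rule eq_vecI) (use A that in simp_all)
    hence "col A j \<in> (*\<^sub>v) P ` carrier_vec k"
      unfolding im by (rule image_eqI) (rule unit_vec_carrier)
    thus ?thesis by (metis image_iff)
  qed
  then obtain y where y: "y j \<in> carrier_vec k" "P *\<^sub>v y j = col A j" if "j < n" for j by metis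
  define Q where "Q = mat k n (\<lambda>(i, j). y j $ i)"
  have Qc: "Q \<in> carrier_mat k n" by (simp add: Q_def)
  have colQ: "col Q j = y j" if "j < n" for j
    by (rule eq_vecI) (use y(1)[OF that] that in \<open>simp_all add: Q_def\<close>)
  have APQ: "A = P * Q"
  proof (rule mat_col_eqI)
    fix j assume "j < dim_col (P * Q)"
    hence j: "j < n" using Qc by simp
    show "col A j = col (P * Q) j"
      using col_mult2[OF Pc Qc j] y(2)[OF j] by (simp add: colQ[OF j])
  qed (use A Pc Qc in simp_all)
  have "\<exists>x\<in>carrier_vec n. Q *\<^sub>v x = z" if z: "z \<in> carrier_vec k" for z
  proof -
    have "P *\<^sub>v z \<in> (*\<^sub>v) A ` carrier_vec n" using z im by blast
    then obtain x where x: "x \<in> carrier_vec n" "P *\<^sub>v z = A *\<^sub>v x" by blast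
    have "P *\<^sub>v z = P *\<^sub>v (Q *\<^sub>v x)" using x assoc_mult_mat_vec[OF Pc Qc x(1)] APQ by simp
    moreover have "Q *\<^sub>v x \<in> carrier_vec k" using Qc x by simp
    ultimately have "z = Q *\<^sub>v x" using inj_onD[OF inj_mats_inj_on[OF P]] z by blast
    thus ?thesis using x(1) by blast
  qed
  hence "\<exists>x\<in>carrier_vec n. Q *\<^sub>v x = unit_vec k i" for i by simp
  then obtain x where x: "x i \<in> carrier_vec n" "Q *\<^sub>v x i = unit_vec k i" for i by metis
  define R where "R = mat n k (\<lambda>(i, j). x j $ i)"
  have Rc: "R \<in> carrier_mat n k" by (simp add: R_def)
  have colR: "col R j = x j" if "j < k" for j
    by (rule eq_vecI) (use x(1)[of j] that in \<open>simp_all add: R_def\<close>)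
  have "Q * R = 1\<^sub>m k"
  proof (rule mat_col_eqI)
    fix j assume "j < dim_col (1\<^sub>m k :: 'a mat)"
    hence j: "j < k" by simp
    show "col (Q * R) j = col (1\<^sub>m k) j"
      using col_mult2[OF Qc Rc j] x(2)[of j] j by (simp add: colR[OF j])
  qed (use Qc Rc in simp_all)
  hence "Q \<in> sur_mats k n" using right_inverse_sur_mats[OF Qc Rc] by simp
  thus ?thesis using that[OF P _ APQ inj_mats_le[OF P]] by simp
qed

text \<open>The nullity is measured by the size of the kernel, so that cardinalities alone determine
  it.\<close>

definition null_mats :: "nat \<Rightarrow> nat \<Rightarrow> 'a::{field,finite} mat set" where
  "null_mats n m = {A \<in> carrier_mat n n. card (mat_kernel A) = CARD('a) ^ m}"

lemma finite_null_mats [simp]: "finite (null_mats n m :: 'a::{field,finite} mat set)"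
  by (rule finite_subset[of _ "carrier_mat n n"]) (simp_all add: null_mats_def)

lemma mult_in_null_mats:
  fixes P Q :: "'a::{field,finite} mat"
  assumes "P \<in> inj_mats n k" "Q \<in> sur_mats k n"
  shows "P * Q \<in> null_mats n (n - k)"
  using mat_kernel_inj_mult[OF assms(1) sur_matsD[OF assms(2)]] card_mat_kernel_sur[OF assms(2)]
    inj_matsD[OF assms(1)] sur_matsD[OF assms(2)] by (simp add: null_mats_def)

lemma null_mats_disjoint:
  assumes "A \<in> null_mats n m" "A \<in> (null_mats n m' :: 'a::{field,finite} mat set)"
  shows "m = m'"
proof -
  have "CARD('a) ^ m = CARD('a) ^ m'" using assms by (simp add: null_mats_def)
  thus ?thesis using CARD_field_gt_1[where 'a = 'a] by simp
qed

lemma null_mats_factor: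
  fixes A :: "'a::{field,finite} mat"
  assumes "A \<in> null_mats (k + m) m"
  obtains P Q where "P \<in> inj_mats (k + m) k" "Q \<in> sur_mats k (k + m)" "A = P * Q"
proof -
  have "A \<in> carrier_mat (k + m) (k + m)" using assms by (simp add: null_mats_def)
  then obtain k' P Q where *: "P \<in> inj_mats (k + m) k'" "Q \<in> sur_mats k' (k + m)" "A = P * Q" "k' \<le> k + m"
    by (rule rank_factorization)
  have "k + m - k' = m"
    using null_mats_disjoint[OF mult_in_null_mats[OF *(1,2)], of m] assms *(3) by simp
  hence "k' = k" using *(4) by simp
  with * that show ?thesis by simp
qed

lemma carrier_mat_eq_UN_null_mats:
  "carrier_mat n n = (\<Union>m\<in>{..n}. null_mats n m :: 'a::{field,finite} mat set)"
proof (intro equalityI subsetI)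
  fix A :: "'a mat" assume "A \<in> carrier_mat n n"
  then obtain k P Q where *: "P \<in> inj_mats n k" "Q \<in> sur_mats k n" "A = P * Q" "k \<le> n"
    by (rule rank_factorization)
  thus "A \<in> (\<Union>m\<in>{..n}. null_mats n m)" using mult_in_null_mats[OF *(1,2)] by (intro UN_I[of "n - k"]) simp_all
next
  fix A :: "'a mat" assume "A \<in> (\<Union>m\<in>{..n}. null_mats n m)"
  thus "A \<in> carrier_mat n n" unfolding null_mats_def by blast
qed

lemma sum_carrier_mat_by_nullity:
  fixes F :: "'a::{field,finite} mat \<Rightarrow> 'b::comm_monoid_add"
  shows "(\<Sum>A\<in>carrier_mat n n. F A) = (\<Sum>m\<le>n. \<Sum>A\<in>null_mats n m. F A)"
proof -
  have "(\<Sum>A\<in>(\<Union>m\<in>{..n}. null_mats n m). F A) = (\<Sum>m\<le>n. \<Sum>A\<in>null_mats n m. F A)"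
  proof (rule sum.UNION_disjoint)
    show "\<forall>i\<in>{..n}. \<forall>j\<in>{..n}. i \<noteq> j \<longrightarrow> null_mats n i \<inter> (null_mats n j :: 'a mat set) = {}"
      using null_mats_disjoint by blast
  qed simp_all
  thus ?thesis using carrier_mat_eq_UN_null_mats by metis
qed

text \<open>The factorizations of a fixed matrix form one free orbit of \<open>GL_k\<close>, on
  which \<open>g\<close> acts by \<open>(P0 * g, g^-1 * Q0)\<close>. From any factorization
  \<open>(P, Q)\<close> the group element is recovered as \<open>L * P\<close>.\<close>

lemma card_factorizations:
  fixes P0 Q0 :: "'a::{field,finite} mat"
  assumes P0: "P0 \<in> inj_mats n k" and Q0: "Q0 \<in> sur_mats k n"
  shows "card {x \<in> inj_mats n k \<times> sur_mats k n. fst x * snd x = P0 * Q0} = card (inj_mats k k :: 'a mat set)"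
    (is "card ?S = _")
proof -
  obtain L where L: "L \<in> carrier_mat k n" "L * P0 = 1\<^sub>m k" using inj_mats_left_inverse[OF P0] .
  obtain R0 where R0: "R0 \<in> carrier_mat n k" "Q0 * R0 = 1\<^sub>m k" using sur_mats_right_inverse[OF Q0] .
  have "\<forall>g::'a mat. \<exists>h. g \<in> inj_mats k k \<longrightarrow> h \<in> inj_mats k k \<and> g * h = 1\<^sub>m k \<and> h * g = 1\<^sub>m k"
  proof
    fix g :: "'a mat"
    show "\<exists>h. g \<in> inj_mats k k \<longrightarrow> h \<in> inj_mats k k \<and> g * h = 1\<^sub>m k \<and> h * g = 1\<^sub>m k"
    proof (cases "g \<in> inj_mats k k")
      case True
      obtain h where "h \<in> inj_mats k k" "g * h = 1\<^sub>m k" "h * g = 1\<^sub>m k" using inj_mats_inverse[OF True] .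
      thus ?thesis by blast
    qed blast
  qed
  from choice[OF this] obtain \<iota> :: "'a mat \<Rightarrow> 'a mat" where
    \<iota>: "\<And>g. g \<in> inj_mats k k \<Longrightarrow> \<iota> g \<in> inj_mats k k \<and> g * \<iota> g = 1\<^sub>m k \<and> \<iota> g * g = 1\<^sub>m k" by blast
  note c = inj_matsD[OF P0] sur_matsD[OF Q0] L(1) R0(1)
  note cc = carrier_matD[OF c(1)] carrier_matD[OF c(2)] carrier_matD[OF L(1)] carrier_matD[OF R0(1)]
  have "bij_betw (\<lambda>g. (P0 * g, \<iota> g * Q0)) (inj_mats k k) ?S"
  proof (rule bij_betw_byWitness[where f' = "\<lambda>x. L * fst x"])
    show "\<forall>g\<in>inj_mats k k. L * fst (P0 * g, \<iota> g * Q0) = g"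
    proof
      fix g :: "'a mat" assume "g \<in> inj_mats k k"
      from inj_matsD[OF this] show "L * fst (P0 * g, \<iota> g * Q0) = g"
        using cc by (simp add: mult_cancel_dim[OF L(2)])
    qed
    have *: "L * P \<in> inj_mats k k \<and> P0 * (L * P) = P \<and> \<iota> (L * P) * Q0 = Q"
      if P: "P \<in> inj_mats n k" and Q: "Q \<in> sur_mats k n" and eq: "P * Q = P0 * Q0" for P Q
    proof -
      obtain R where R: "R \<in> carrier_mat n k" "Q * R = 1\<^sub>m k" using sur_mats_right_inverse[OF Q] .
      note d = carrier_matD[OF inj_matsD[OF P]] carrier_matD[OF sur_matsD[OF Q]] carrier_matD[OF R(1)]
      have "P = P * Q * R" using cc d by (simp add: mult_assoc_dim R(2))
      also have "\<dots> = P0 * (Q0 * R)" using cc d by (simp add: mult_assoc_dim eq)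
      finally have P': "P = P0 * (Q0 * R)" .
      have LP: "L * P = Q0 * R" using cc d by (simp add: P' mult_cancel_dim[OF L(2)])
      have LPc: "L * P \<in> carrier_mat k k" using c inj_matsD[OF P] by simp
      have 2: "P0 * (L * P) = P" by (simp add: LP P'[symmetric])
      have LPQ: "L * P * Q = Q0" using cc d by (simp add: mult_assoc_dim eq mult_cancel_dim[OF L(2)])
      have "L * P * (Q * R0) = 1\<^sub>m k" using cc d LPQ by (simp add: mult_assoc_dim[symmetric] R0(2))
      hence 1: "L * P \<in> inj_mats k k"
        unfolding inj_mats_sq_iff_sur_mats
        using LPc c sur_matsD[OF Q] by (intro right_inverse_sur_mats[of _ k k "Q * R0"]) simp_all
      have "\<iota> (L * P) * Q0 = \<iota> (L * P) * (L * P * Q)" by (simp add: LPQ)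
      also have "\<dots> = Q"
        using d cc LPc inj_matsD[of "\<iota> (L * P)" k k] \<iota>[OF 1] by (intro mult_cancel_dim) simp_all
      finally show ?thesis using 1 2 by simp
    qed
    show "\<forall>x\<in>?S. (\<lambda>g. (P0 * g, \<iota> g * Q0)) (L * fst x) = x"
    proof
      fix x assume "x \<in> ?S"
      thus "(\<lambda>g. (P0 * g, \<iota> g * Q0)) (L * fst x) = x" using *[of "fst x" "snd x"] by (cases x) simp
    qed
    show "(\<lambda>x. L * fst x) ` ?S \<subseteq> inj_mats k k"
    proof (rule image_subsetI)
      fix x assume "x \<in> ?S"
      thus "L * fst x \<in> inj_mats k k" using *[of "fst x" "snd x"] by (cases x) simp
    qed
    show "(\<lambda>g. (P0 * g, \<iota> g * Q0)) ` inj_mats k k \<subseteq> ?S"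
    proof (rule image_subsetI)
      fix g :: "'a mat" assume g: "g \<in> inj_mats k k"
      note i = \<iota>[OF g]
      note gc = inj_matsD[OF g] inj_matsD[of "\<iota> g" k k]
      note gd = carrier_matD[OF gc(1)] carrier_matD[of "\<iota> g" k k]
      have 1: "P0 * g \<in> inj_mats n k" by (rule inj_mats_mult[OF P0 g])
      have "\<iota> g * Q0 * (R0 * g) = 1\<^sub>m k"
        using i gc gd cc by (simp add: mult_assoc_dim mult_cancel_dim[OF R0(2)])
      hence 2: "\<iota> g * Q0 \<in> sur_mats k n"
        using i gc c by (intro right_inverse_sur_mats[of _ k n "R0 * g"]) simp_all
      have "P0 * g * (\<iota> g * Q0) = P0 * Q0"
        using i gc gd cc by (simp add: mult_assoc_dim mult_cancel_dim[of g "\<iota> g" k])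
      with 1 2 show "(P0 * g, \<iota> g * Q0) \<in> ?S" by simp
    qed
  qed
  from bij_betw_same_card[OF this] show ?thesis by simp
qed

section \<open>Injective matrices with a prescribed upper block\<close>

definition stack :: "nat \<Rightarrow> nat \<Rightarrow> 'a mat \<Rightarrow> 'a mat \<Rightarrow> 'a mat" where
  "stack k m A X = mat (k + m) k (\<lambda>(i, j). if i < k then A $$ (i, j) else X $$ (i - k, j))"

lemma stack_mult_vec_eq_0_iff:
  fixes A X :: "'a::field mat"
  assumes A: "A \<in> carrier_mat k k" and X: "X \<in> carrier_mat m k" and v: "v \<in> carrier_vec k"
  shows "stack k m A X *\<^sub>v v = 0\<^sub>v (k + m) \<longleftrightarrow> A *\<^sub>v v = 0\<^sub>v k \<and> X *\<^sub>v v = 0\<^sub>v m"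
proof -
  have S: "stack k m A X \<in> carrier_mat (k + m) k" by (simp add: stack_def)
  have 1: "(stack k m A X *\<^sub>v v) $ i = (A *\<^sub>v v) $ i" if "i < k" for i
  proof -
    have "i < k + m" using that by simp
    show ?thesis unfolding mult_mat_vec_mat[OF S v \<open>i < k + m\<close>] mult_mat_vec_mat[OF A v that]
      by (rule sum.cong) (use that in \<open>simp_all add: stack_def\<close>)
  qed
  have 2: "(stack k m A X *\<^sub>v v) $ (k + i) = (X *\<^sub>v v) $ i" if "i < m" for i
  proof -
    have "k + i < k + m" using that by simp
    show ?thesis unfolding mult_mat_vec_mat[OF S v \<open>k + i < k + m\<close>] mult_mat_vec_mat[OF X v that]
      by (rule sum.cong) (use that in \<open>simp_all add: stack_def\<close>)
  qed
  show ?thesis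
  proof (intro iffI conjI)
    assume eq: "stack k m A X *\<^sub>v v = 0\<^sub>v (k + m)"
    show "A *\<^sub>v v = 0\<^sub>v k"
    proof (rule eq_vecI)
      fix i assume "i < dim_vec (0\<^sub>v k :: 'a vec)"
      thus "(A *\<^sub>v v) $ i = 0\<^sub>v k $ i" using 1[of i] unfolding eq by simp
    qed (use A in simp)
    show "X *\<^sub>v v = 0\<^sub>v m"
    proof (rule eq_vecI)
      fix i assume "i < dim_vec (0\<^sub>v m :: 'a vec)"
      thus "(X *\<^sub>v v) $ i = 0\<^sub>v m $ i" using 2[of i] unfolding eq by simp
    qed (use X in simp)
  next
    assume eq: "A *\<^sub>v v = 0\<^sub>v k \<and> X *\<^sub>v v = 0\<^sub>v m"
    show "stack k m A X *\<^sub>v v = 0\<^sub>v (k + m)"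
    proof (rule eq_vecI)
      fix i assume "i < dim_vec (0\<^sub>v (k + m) :: 'a vec)"
      hence i: "i < k + m" by simp
      show "(stack k m A X *\<^sub>v v) $ i = 0\<^sub>v (k + m) $ i"
      proof (cases "i < k")
        case True
        thus ?thesis using 1[OF True] i by (simp only: eq) simp
      next
        case False
        hence "i - k < m" using i by simp
        from 2[OF this] show ?thesis using False i eq by (simp del: index_mult_mat_vec)
      qed
    qed (use S in simp)
  qed
qed

text \<open>The condition concerns the first \<open>j\<close> columns only; the other
  \<open>l\<close> columns are free.\<close>

lemma card_mats_take_cols:
  fixes S :: "'a::{field,finite} mat set"
  assumes S: "S \<subseteq> carrier_mat m j"
  shows "card {Y \<in> carrier_mat m (j + l). Y * pid (j + l) j \<in> S} = card S * CARD('a) ^ (m * l)"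
    (is "card ?T = _")
proof -
  let ?f = "\<lambda>(Y1, Y2). mat m (j + l) (\<lambda>(i, c). if c < j then Y1 $$ (i, c) else Y2 $$ (i, c - j)) :: 'a mat"
  let ?g = "\<lambda>Y. (Y * pid (j + l) j, mat m l (\<lambda>(i, c). Y $$ (i, c + j)) :: 'a mat)"
  have pidY: "(Y * pid (j + l) j) $$ (i, c) = Y $$ (i, c)" if "Y \<in> carrier_mat m (j + l)" "i < m" "c < j" for Y :: "'a mat" and i c
    by (rule index_mult_pid[OF that(1) _ that(2,3)]) simp
  have f1: "?f (Y1, Y2) * pid (j + l) j = Y1" if "Y1 \<in> carrier_mat m j" for Y1 Y2 :: "'a mat"
  proof (rule eq_matI)
    fix i c assume "i < dim_row Y1" "c < dim_col Y1"
    hence ic: "i < m" "c < j" using that by simp_all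
    have "?f (Y1, Y2) \<in> carrier_mat m (j + l)" by simp
    from pidY[OF this ic] show "(?f (Y1, Y2) * pid (j + l) j) $$ (i, c) = Y1 $$ (i, c)" using ic by simp
  qed (use that in simp_all)
  have "bij_betw ?f (S \<times> carrier_mat m l) ?T"
  proof (rule bij_betw_byWitness[where f' = ?g])
    show "\<forall>x\<in>S \<times> carrier_mat m l. ?g (?f x) = x"
    proof
      fix x :: "'a mat \<times> 'a mat" assume "x \<in> S \<times> carrier_mat m l"
      then obtain Y1 Y2 where x: "x = (Y1, Y2)" "Y1 \<in> S" "Y2 \<in> carrier_mat m l" by (cases x) simp
      have Y1: "Y1 \<in> carrier_mat m j" using x(2) S by blast
      have 2: "mat m l (\<lambda>(i, c). ?f (Y1, Y2) $$ (i, c + j)) = Y2"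
        by (rule eq_matI) (use x(3) in simp_all)
      show "?g (?f x) = x" using f1[OF Y1, of Y2] 2 unfolding x(1) by simp
    qed
    show "\<forall>Y\<in>?T. ?f (?g Y) = Y"
    proof
      fix Y assume "Y \<in> ?T"
      hence Y: "Y \<in> carrier_mat m (j + l)" by simp
      have "?f (?g Y) $$ (i, c) = Y $$ (i, c)" if "i < m" "c < j + l" for i c
        using that pidY[OF Y, of i c] by (cases "c < j") simp_all
      thus "?f (?g Y) = Y" using Y by (intro eq_matI) simp_all
    qed
    show "?f ` (S \<times> carrier_mat m l) \<subseteq> ?T"
    proof (rule image_subsetI)
      fix x :: "'a mat \<times> 'a mat" assume "x \<in> S \<times> carrier_mat m l"
      then obtain Y1 Y2 where x: "x = (Y1, Y2)" "Y1 \<in> S" "Y2 \<in> carrier_mat m l" by (cases x) simp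
      have Y1: "Y1 \<in> carrier_mat m j" using x(2) S by blast
      show "?f x \<in> ?T" using f1[OF Y1, of Y2] x by simp
    qed
    show "?g ` ?T \<subseteq> S \<times> carrier_mat m l" by (rule image_subsetI) simp
  qed
  from bij_betw_same_card[OF this] show ?thesis by (simp add: card_cartesian_product card_carrier_mat)
qed

text \<open>With \<open>A\<close> as upper block, \<open>P\<close> is injective iff its lower block
  \<open>X\<close> is injective on the kernel of \<open>A\<close>, that is, iff \<open>X * K\<close>
  is injective for a matrix \<open>K\<close> whose columns are a basis of this kernel. After a
  change of basis \<open>K\<close> is a truncated identity, and the condition constrains only
  \<open>j\<close> of the \<open>k\<close> columns.\<close>

lemma card_inj_extensions:
  fixes A :: "'a::{field,finite} mat"
  assumes A: "A \<in> null_mats k j"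
  shows "card {P \<in> inj_mats (k + m) k. pid k (k + m) * P = A}
           = card (inj_mats m j :: 'a mat set) * CARD('a) ^ (m * (k - j))" (is "card ?S = _")
proof -
  have Ac: "A \<in> carrier_mat k k" using A by (simp add: null_mats_def)
  have "\<exists>j' K. K \<in> inj_mats k j' \<and> (*\<^sub>v) K ` carrier_vec j' = mat_kernel A"
  proof -
    obtain j' K where "K \<in> inj_mats k j'" "(*\<^sub>v) K ` carrier_vec j' = mat_kernel A"
    proof (rule subspace_basis)
      show "mat_kernel A \<subseteq> carrier_vec k" using mat_kernel_iff[OF Ac] by blast
      have "A *\<^sub>v 0\<^sub>v k = 0\<^sub>v k" by (rule eq_vecI) (use Ac in simp_all)
      thus "0\<^sub>v k \<in> mat_kernel A" using mat_kernel_iff[OF Ac] by simp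
    next
      fix v w assume "v \<in> mat_kernel A" "w \<in> mat_kernel A"
      thus "v + w \<in> mat_kernel A"
        using mult_add_distrib_mat_vec[OF Ac, of v w] mat_kernel_iff[OF Ac] by simp
    next
      fix c :: 'a and v assume "v \<in> mat_kernel A"
      hence v: "v \<in> carrier_vec k" "A *\<^sub>v v = 0\<^sub>v k" using mat_kernel_iff[OF Ac] by simp_all
      have "c \<cdot>\<^sub>v 0\<^sub>v k = 0\<^sub>v k" by (rule eq_vecI) simp_all
      thus "c \<cdot>\<^sub>v v \<in> mat_kernel A" using mult_mat_vec[OF Ac v(1), of c] mat_kernel_iff[OF Ac] v by simp
    qed
    thus ?thesis by blast
  qed
  then obtain j' K where K': "K \<in> inj_mats k j'" "(*\<^sub>v) K ` carrier_vec j' = mat_kernel A" by blast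
  have "CARD('a) ^ j' = CARD('a) ^ j"
    using card_mult_image[OF K'(1)] A by (simp add: K'(2) null_mats_def)
  hence "j' = j" using CARD_field_gt_1[where 'a = 'a] by simp
  hence K: "K \<in> inj_mats k j" and ker: "mat_kernel A = (*\<^sub>v) K ` carrier_vec j" using K' by simp_all
  note Kc = inj_matsD[OF K]
  obtain g where g: "g \<in> inj_mats k k" "K = g * pid k j" and jk: "j \<le> k" using inj_mats_factor[OF K] .
  have id: "(1\<^sub>m m :: 'a mat) \<in> inj_mats m m"
    by (rule left_inverse_inj_mats[of _ _ _ "1\<^sub>m m"]) simp_all
  let ?X = "{X \<in> carrier_mat m k. X * K \<in> inj_mats m j}"
  let ?Y = "{Y \<in> carrier_mat m (j + (k - j)). Y * pid (j + (k - j)) j \<in> (inj_mats m j :: 'a mat set)}"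
  have stack_iff: "stack k m A X \<in> inj_mats (k + m) k \<longleftrightarrow> X * K \<in> inj_mats m j"
    if X: "X \<in> carrier_mat m k" for X
  proof
    assume *: "stack k m A X \<in> inj_mats (k + m) k"
    have "u = 0\<^sub>v j" if u: "u \<in> carrier_vec j" "X * K *\<^sub>v u = 0\<^sub>v m" for u
    proof -
      have Ku: "K *\<^sub>v u \<in> carrier_vec k" using Kc u by simp
      have "X *\<^sub>v (K *\<^sub>v u) = 0\<^sub>v m" using assoc_mult_mat_vec[OF X Kc u(1)] u(2) by simp
      moreover have "K *\<^sub>v u \<in> mat_kernel A" unfolding ker using u(1) by blast
      ultimately have "stack k m A X *\<^sub>v (K *\<^sub>v u) = 0\<^sub>v (k + m)"
        using stack_mult_vec_eq_0_iff[OF Ac X Ku] mat_kernel_iff[OF Ac] by blast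
      hence "K *\<^sub>v u = 0\<^sub>v k" using * Ku unfolding inj_mats_def by blast
      thus ?thesis using K u(1) unfolding inj_mats_def by blast
    qed
    thus "X * K \<in> inj_mats m j" using X Kc unfolding inj_mats_def by simp
  next
    assume *: "X * K \<in> inj_mats m j"
    have "v = 0\<^sub>v k" if v: "v \<in> carrier_vec k" "stack k m A X *\<^sub>v v = 0\<^sub>v (k + m)" for v
    proof -
      have Av: "A *\<^sub>v v = 0\<^sub>v k" "X *\<^sub>v v = 0\<^sub>v m" using stack_mult_vec_eq_0_iff[OF Ac X v(1)] v(2) by blast+
      hence "v \<in> (*\<^sub>v) K ` carrier_vec j" using v(1) mat_kernel_iff[OF Ac] ker by blast
      then obtain u where u: "u \<in> carrier_vec j" "v = K *\<^sub>v u" by blast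
      have "X * K *\<^sub>v u = 0\<^sub>v m" using assoc_mult_mat_vec[OF X Kc u(1)] Av u(2) by simp
      hence "u = 0\<^sub>v j" using * u(1) unfolding inj_mats_def by blast
      thus ?thesis using u(2) Kc by (intro eq_vecI) simp_all
    qed
    thus "stack k m A X \<in> inj_mats (k + m) k" unfolding inj_mats_def by (simp add: stack_def)
  qed
  have "bij_betw (stack k m A) ?X ?S"
  proof (rule bij_betw_byWitness[where f' = "\<lambda>P. mat m k (\<lambda>(i, j). P $$ (i + k, j))"])
    show "\<forall>X\<in>?X. mat m k (\<lambda>(i, j). stack k m A X $$ (i + k, j)) = X"
    proof
      fix X assume "X \<in> ?X"
      hence "X \<in> carrier_mat m k" by simp
      thus "mat m k (\<lambda>(i, j). stack k m A X $$ (i + k, j)) = X"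
        by (intro eq_matI) (simp_all add: stack_def)
    qed
    have unstack: "stack k m A (mat m k (\<lambda>(i, j). P $$ (i + k, j))) = P" if "P \<in> ?S" for P :: "'a mat"
    proof (rule eq_matI)
      fix i c assume "i < dim_row P" "c < dim_col P"
      hence P: "P \<in> carrier_mat (k + m) k" "pid k (k + m) * P = A" and ic: "i < k + m" "c < k"
        using that inj_matsD[of P "k + m" k] by simp_all
      show "stack k m A (mat m k (\<lambda>(i, j). P $$ (i + k, j))) $$ (i, c) = P $$ (i, c)"
        using ic index_pid_mult[OF P(1), of k i c] by (cases "i < k") (simp_all add: stack_def P(2))
    qed (use that inj_matsD[of P "k + m" k] in \<open>simp_all add: stack_def\<close>)
    thus "\<forall>P\<in>?S. stack k m A (mat m k (\<lambda>(i, j). P $$ (i + k, j))) = P" by blast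
    show "stack k m A ` ?X \<subseteq> ?S"
    proof (rule image_subsetI)
      fix X assume X: "X \<in> ?X"
      have S: "stack k m A X \<in> carrier_mat (k + m) k" by (simp add: stack_def)
      have "pid k (k + m) * stack k m A X = A"
      proof (rule eq_matI)
        fix i c assume "i < dim_row A" "c < dim_col A"
        hence ic: "i < k" "c < k" using Ac by simp_all
        show "(pid k (k + m) * stack k m A X) $$ (i, c) = A $$ (i, c)"
          using index_pid_mult[OF S _ ic] ic by (simp add: stack_def)
      qed (use Ac S in simp_all)
      thus "stack k m A X \<in> ?S" using stack_iff[of X] X by simp
    qed
    show "(\<lambda>P. mat m k (\<lambda>(i, j). P $$ (i + k, j))) ` ?S \<subseteq> ?X"
    proof (rule image_subsetI)
      fix P assume P: "P \<in> ?S"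
      show "mat m k (\<lambda>(i, j). P $$ (i + k, j)) \<in> ?X"
        using stack_iff[of "mat m k (\<lambda>(i, j). P $$ (i + k, j))"] P unstack[OF P] by simp
    qed
  qed
  hence "card ?S = card ?X" by (simp add: bij_betw_same_card)
  also have "card ?X = card ?Y"
  proof (rule bij_betw_same_card)
    let ?f = "\<lambda>X. 1\<^sub>m m * X * g"
    have bij: "bij_betw ?f (carrier_mat m k) (carrier_mat m k)" by (rule bij_betw_mult_both[OF id g(1)])
    have iff: "?f X \<in> ?Y \<longleftrightarrow> X \<in> ?X" if "X \<in> carrier_mat m k" for X
      using that jk inj_matsD[OF g(1)] by (simp add: g(2) mult_assoc_dim)
    show "bij_betw ?f ?X ?Y"
      unfolding bij_betw_def
    proof
      show "inj_on ?f ?X" using bij unfolding bij_betw_def by (elim conjE inj_on_subset) blast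
      show "?f ` ?X = ?Y"
      proof (intro equalityI subsetI)
        fix Y assume "Y \<in> ?f ` ?X" thus "Y \<in> ?Y" using iff by blast
      next
        fix Y assume Y: "Y \<in> ?Y"
        hence "Y \<in> carrier_mat m k" using jk by simp
        then obtain X where "X \<in> carrier_mat m k" "Y = ?f X" using bij unfolding bij_betw_def by blast
        thus "Y \<in> ?f ` ?X" using iff Y by blast
      qed
    qed
  qed
  also have "card ?Y = card (inj_mats m j :: 'a mat set) * CARD('a) ^ (m * (k - j))"
    using card_mats_take_cols[of "inj_mats m j :: 'a mat set" m j "k - j"] inj_matsD[of _ m j] by blast
  finally show ?thesis .
qed

text \<open>This is \<open>R(n, m)\<close> of the overview.\<close>

definition cent_sum :: "'a::{field,finite} itself \<Rightarrow> nat \<Rightarrow> nat \<Rightarrow> nat" where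
  "cent_sum _ n m = (\<Sum>A\<in>(null_mats n m :: 'a mat set). card (cent n A))"

text \<open>Double counting of the centralizers of \<open>P * Q\<close> over all pairs
  \<open>(P, Q)\<close>. Grouped by the product, each matrix of nullity \<open>m\<close> occurs
  \<open>|GL_k|\<close> times. Passing to \<open>Q * P\<close> and normalizing \<open>Q\<close> to a
  truncated identity leaves the upper square block of \<open>P\<close>, and the sum is grouped by
  this block and its nullity \<open>j\<close>.\<close>

lemma cent_sum_recursion:
  "card (inj_mats k k :: 'a::{field,finite} mat set) * cent_sum TYPE('a) (k + m) m
     = CARD('a) ^ (m * m) * card (inj_mats (k + m) k :: 'a mat set) *
       (\<Sum>j\<le>k. card (inj_mats m j :: 'a mat set) * CARD('a) ^ (m * (k - j)) * cent_sum TYPE('a) k j)"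
proof -
  let ?n = "k + m"
  let ?I = "inj_mats ?n k :: 'a mat set" and ?S = "sur_mats k ?n :: 'a mat set"
  let ?F = "\<lambda>x. card (cent ?n (fst x * snd x :: 'a mat))"
  have fiber: "(\<Sum>x\<in>{x \<in> ?I \<times> ?S. fst x * snd x = A}. ?F x)
                 = card (inj_mats k k :: 'a mat set) * card (cent ?n A)" if A: "A \<in> null_mats ?n m" for A
  proof -
    obtain P Q where PQ: "P \<in> ?I" "Q \<in> ?S" "A = P * Q" using null_mats_factor[OF A] .
    have "(\<Sum>x\<in>{x \<in> ?I \<times> ?S. fst x * snd x = A}. ?F x)
        = (\<Sum>x\<in>{x \<in> ?I \<times> ?S. fst x * snd x = A}. card (cent ?n A))" by (rule sum.cong) simp_all
    thus ?thesis using card_factorizations[OF PQ(1,2)] by (simp add: PQ(3))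
  qed
  have "(\<Sum>x\<in>?I \<times> ?S. ?F x) = (\<Sum>A\<in>null_mats ?n m. \<Sum>x\<in>{x \<in> ?I \<times> ?S. fst x * snd x = A}. ?F x)"
  proof (rule sum.group[symmetric])
    show "(\<lambda>x. fst x * snd x) ` (?I \<times> ?S) \<subseteq> null_mats ?n m"
      using mult_in_null_mats[of _ ?n k, where 'a = 'a] by (intro image_subsetI) (simp add: mem_Times_iff)
  qed simp_all
  also have "\<dots> = card (inj_mats k k :: 'a mat set) * cent_sum TYPE('a) ?n m"
    unfolding cent_sum_def sum_distrib_left by (rule sum.cong[OF refl fiber])
  finally have lhs: "card (inj_mats k k :: 'a mat set) * cent_sum TYPE('a) ?n m = (\<Sum>x\<in>?I \<times> ?S. ?F x)" ..
  have "(\<Sum>x\<in>?I \<times> ?S. ?F x) = (\<Sum>P\<in>?I. \<Sum>Q\<in>?S. card (cent ?n (P * Q)))"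
    by (simp add: sum.cartesian_product split_def)
  also have "\<dots> = (\<Sum>Q\<in>?S. \<Sum>P\<in>?I. card (cent ?n (P * Q)))" by (rule sum.swap)
  also have "\<dots> = (\<Sum>Q\<in>?S. \<Sum>P\<in>?I. CARD('a) ^ (m * m) * card (cent k (Q * P)))"
    by (intro sum.cong refl) (simp add: card_cent_mult_swap)
  also have "\<dots> = CARD('a) ^ (m * m) * (\<Sum>Q\<in>?S. \<Sum>P\<in>?I. card (cent k (Q * P)))"
    by (simp add: sum_distrib_left)
  also have "(\<Sum>Q\<in>?S. \<Sum>P\<in>?I. card (cent k (Q * P))) = (\<Sum>Q\<in>?S. \<Sum>P\<in>?I. card (cent k (pid k ?n * P)))"
  proof (rule sum.cong)
    fix Q assume "Q \<in> ?S"
    then obtain h where h: "h \<in> inj_mats ?n ?n" "Q = pid k ?n * h" by (rule sur_mats_factor)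
    obtain h' where h': "h' \<in> inj_mats ?n ?n" "h * h' = 1\<^sub>m ?n" "h' * h = 1\<^sub>m ?n"
      using inj_mats_inverse[OF h(1)] .
    note c = carrier_matD[OF inj_matsD[OF h(1)]] carrier_matD[OF inj_matsD[OF h'(1)]]
    \<comment> \<open>Since \<open>Q * P = pid k ?n * (h * P)\<close>, the factor \<open>h\<close>
      is absorbed by a permutation of the injective matrices \<open>P\<close>.\<close>
    have "bij_betw ((*) h) ?I ?I"
    proof (rule bij_betw_byWitness[where f' = "(*) h'"])
      show "\<forall>P\<in>?I. h' * (h * P) = P"
      proof
        fix P assume "P \<in> ?I"
        from carrier_matD[OF inj_matsD[OF this]] c show "h' * (h * P) = P" by (intro mult_cancel_dim[OF h'(3)]) simp_all
      qed
      show "\<forall>P\<in>?I. h * (h' * P) = P"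
      proof
        fix P assume "P \<in> ?I"
        from carrier_matD[OF inj_matsD[OF this]] c show "h * (h' * P) = P" by (intro mult_cancel_dim[OF h'(2)]) simp_all
      qed
    qed (use inj_mats_mult[OF h(1)] inj_mats_mult[OF h'(1)] in blast)+
    from sum.reindex_bij_betw[OF this, of "\<lambda>P. card (cent k (pid k ?n * P))"]
    have "(\<Sum>P\<in>?I. card (cent k (pid k ?n * P))) = (\<Sum>P\<in>?I. card (cent k (pid k ?n * (h * P))))" ..
    also have "\<dots> = (\<Sum>P\<in>?I. card (cent k (Q * P)))"
    proof (rule sum.cong)
      fix P assume "P \<in> ?I"
      from carrier_matD[OF inj_matsD[OF this]] c
      have "pid k ?n * (h * P) = Q * P" by (simp add: h(2) mult_assoc_dim)
      thus "card (cent k (pid k ?n * (h * P))) = card (cent k (Q * P))" by simp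
    qed simp
    finally show "(\<Sum>P\<in>?I. card (cent k (Q * P))) = (\<Sum>P\<in>?I. card (cent k (pid k ?n * P)))" ..
  qed simp
  also have "\<dots> = card ?I * (\<Sum>P\<in>?I. card (cent k (pid k ?n * P)))"
    by (simp add: card_sur_mats)
  also have "(\<Sum>P\<in>?I. card (cent k (pid k ?n * P)))
      = (\<Sum>A\<in>carrier_mat k k. \<Sum>P\<in>{P \<in> ?I. pid k ?n * P = A}. card (cent k (pid k ?n * P)))"
  proof (rule sum.group[symmetric])
    show "(*) (pid k ?n) ` ?I \<subseteq> carrier_mat k k"
    proof (rule image_subsetI)
      fix P assume "P \<in> ?I"
      from inj_matsD[OF this] show "pid k ?n * P \<in> carrier_mat k k" by (rule mult_carrier_mat[OF pid_dim(3)])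
    qed
  qed simp_all
  also have "\<dots> = (\<Sum>A\<in>carrier_mat k k. card {P \<in> ?I. pid k ?n * P = A} * card (cent k A))"
    by (rule sum.cong) simp_all
  also have "\<dots> = (\<Sum>j\<le>k. \<Sum>A\<in>null_mats k j. card {P \<in> ?I. pid k ?n * P = A} * card (cent k A))"
    by (rule sum_carrier_mat_by_nullity)
  also have "\<dots> = (\<Sum>j\<le>k. card (inj_mats m j :: 'a mat set) * CARD('a) ^ (m * (k - j)) * cent_sum TYPE('a) k j)"
    unfolding cent_sum_def sum_distrib_left by (intro sum.cong refl) (simp add: card_inj_extensions)
  finally show ?thesis using lhs by (simp add: mult.assoc)
qed

lemma num_commuting_pairs_eq_sum:
  "num_commuting_pairs TYPE('a::{field,finite}) n = (\<Sum>m\<le>n. cent_sum TYPE('a) n m)"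
proof -
  have "commuting_pairs n = Sigma (carrier_mat n n) (cent n :: 'a mat \<Rightarrow> _)"
    unfolding commuting_pairs_def cent_def by blast
  hence "num_commuting_pairs TYPE('a) n = (\<Sum>A\<in>(carrier_mat n n :: 'a mat set). card (cent n A))"
    unfolding num_commuting_pairs_def by simp
  thus ?thesis by (simp add: sum_carrier_mat_by_nullity cent_sum_def)
qed

section \<open>Polynomials over a finite field\<close>

text \<open>The polynomials of degree below \<open>d\<close>, defined by coefficients so that
  \<open>0\<close> belongs to the set even for \<open>d = 0\<close>. They serve as residues modulo a
  polynomial of degree \<open>d\<close>.\<close>

definition polys :: "nat \<Rightarrow> 'a::zero poly set" where
  "polys d = {p. \<forall>i\<ge>d. coeff p i = 0}"

lemma polys_0: "polys 0 = {0}"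
  by (auto simp: polys_def poly_eq_iff)

lemma polys_Suc: "polys (Suc d) = (\<lambda>(c, p). pCons c p) ` (UNIV \<times> polys d)"
proof (intro equalityI subsetI)
  fix p :: "'a poly" assume p: "p \<in> polys (Suc d)"
  obtain c r where cr: "p = pCons c r" by (cases p)
  have "coeff r i = 0" if "i \<ge> d" for i using p that by (auto simp: polys_def cr coeff_pCons split: nat.splits)
  hence "r \<in> polys d" by (simp add: polys_def)
  thus "p \<in> (\<lambda>(c, p). pCons c p) ` (UNIV \<times> polys d)" using cr by force
qed (auto simp: polys_def coeff_pCons split: nat.splits)

lemma finite_polys [simp]: "finite (polys d :: 'a::{zero,finite} poly set)"
  by (induction d) (simp_all add: polys_0 polys_Suc)

lemma card_polys: "card (polys d :: 'a::{zero,finite} poly set) = CARD('a) ^ d"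
proof (induction d)
  case (Suc d)
  have "inj_on (\<lambda>(c, p). pCons c p) (UNIV \<times> (polys d :: 'a poly set))"
    by (auto simp: inj_on_def)
  thus ?case by (simp add: polys_Suc card_image card_cartesian_product Suc)
qed (simp add: polys_0)

lemma polys_iff: "p \<in> polys d \<longleftrightarrow> p = 0 \<or> degree p < d"
proof
  assume "p \<in> polys d"
  thus "p = 0 \<or> degree p < d" using leading_coeff_0_iff[of p] by (cases "degree p < d") (simp_all add: polys_def)
qed (auto simp: polys_def intro: coeff_eq_0)

lemma zero_in_polys [simp]: "0 \<in> polys d"
  by (simp add: polys_def)

lemma polys_add: "p \<in> polys d \<Longrightarrow> r \<in> polys d \<Longrightarrow> p + r \<in> polys d"
  and polys_diff: "p' \<in> polys d \<Longrightarrow> r' \<in> polys d \<Longrightarrow> p' - r' \<in> polys d"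
  for p r :: "'a::comm_monoid_add poly" and p' r' :: "'b::ab_group_add poly"
  by (simp_all add: polys_def)

lemma mod_in_polys: "f \<noteq> 0 \<Longrightarrow> p mod f \<in> polys (degree f)" for f p :: "'a::field poly"
  using degree_mod_less[of f p] by (auto simp: polys_iff)

lemma polys_mod_eq: "p \<in> polys (degree f) \<Longrightarrow> p mod f = p" for f p :: "'a::field poly"
  by (auto simp: polys_iff mod_poly_less)

lemma card_monic:
  "card {h :: 'a::{field,finite} poly. lead_coeff h = 1 \<and> degree h = d} = CARD('a) ^ d"
proof -
  have "bij_betw (\<lambda>p. monom 1 d + p) (polys d) {h :: 'a poly. lead_coeff h = 1 \<and> degree h = d}"
  proof (rule bij_betw_byWitness[where f' = "\<lambda>h. h - monom 1 d"])
    show "(\<lambda>p. monom 1 d + p) ` polys d \<subseteq> {h :: 'a poly. lead_coeff h = 1 \<and> degree h = d}"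
    proof (rule image_subsetI)
      fix p :: "'a poly" assume p: "p \<in> polys d"
      have "degree (monom 1 d + p) = d"
        using p degree_add_eq_left[of p "monom 1 d"] by (auto simp: polys_iff degree_monom_eq)
      moreover have "coeff (monom 1 d + p) d = 1" using p by (simp add: polys_def)
      ultimately show "monom 1 d + p \<in> {h. lead_coeff h = 1 \<and> degree h = d}" by simp
    qed
    show "(\<lambda>h. h - monom 1 d) ` {h :: 'a poly. lead_coeff h = 1 \<and> degree h = d} \<subseteq> polys d"
    proof (rule image_subsetI)
      fix h :: "'a poly" assume h: "h \<in> {h. lead_coeff h = 1 \<and> degree h = d}"
      have "coeff (h - monom 1 d) i = 0" if "i \<ge> d" for i
        using h that by (cases "i = d") (auto intro: coeff_eq_0)
      thus "h - monom 1 d \<in> polys d" by (simp add: polys_def)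
    qed
  qed auto
  from bij_betw_same_card[OF this] show ?thesis by (simp add: card_polys)
qed

text \<open>Division with remainder by a monic element of least degree. It is applied to
  annihilators of vectors and to the ideals \<open>{a. p dvd a * y}\<close>.\<close>

lemma poly_ideal_generator:
  fixes I :: "'a::field poly \<Rightarrow> bool"
  assumes "I g0" "g0 \<noteq> 0" and diff: "\<And>a b. I a \<Longrightarrow> I b \<Longrightarrow> I (a - b)" and mult: "\<And>a c. I a \<Longrightarrow> I (c * a)"
  obtains f where "lead_coeff f = 1" "\<And>g. I g \<longleftrightarrow> f dvd g"
proof -
  define k where "k = (LEAST k. \<exists>g. I g \<and> g \<noteq> 0 \<and> degree g = k)"
  have "\<exists>g. I g \<and> g \<noteq> 0 \<and> degree g = k"
    unfolding k_def by (rule LeastI[of _ "degree g0"]) (use assms in blast)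
  then obtain g where g: "I g" "g \<noteq> 0" "degree g = k" by blast
  have least: "k \<le> degree h" if "I h" "h \<noteq> 0" for h
    unfolding k_def by (rule Least_le) (use that in blast)
  define f where "f = Polynomial.smult (inverse (lead_coeff g)) g"
  have "coeff g k \<noteq> 0" using g by (metis leading_coeff_0_iff)
  hence f: "lead_coeff f = 1" "degree f = k" "f \<noteq> 0" using g by (simp_all add: f_def)
  have If: "I f" using mult[OF g(1), of "[:inverse (lead_coeff g):]"] by (simp add: f_def)
  have "I h \<longleftrightarrow> f dvd h" for h
  proof
    assume h: "I h"
    have "h mod f = h - (h div f) * f" by (simp add: minus_div_mult_eq_mod)
    hence "I (h mod f)" using diff[OF h mult[OF If]] by simp
    hence "h mod f = 0" using least degree_mod_less'[of f h] f by fastforce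
    thus "f dvd h" by (simp add: dvd_eq_mod_eq_0)
  next
    assume "f dvd h"
    then obtain c where "h = f * c" by (rule dvdE)
    thus "I h" using mult[OF If, of c] by (simp add: mult.commute)
  qed
  with f(1) that show ?thesis by blast
qed

text \<open>A nonconstant divisor \<open>p\<close> of least degree is prime: if
  \<open>p dvd x * y\<close>, the ideal of all \<open>a\<close> with \<open>p dvd a * y\<close>
  contains both \<open>p\<close> and \<open>x\<close>. Its generator divides \<open>p\<close>, so by
  minimality it is a unit, giving \<open>p dvd y\<close>, or an associate of \<open>p\<close>,
  giving \<open>p dvd x\<close>.\<close>

lemma exists_prime_poly_factor:
  fixes b :: "'a::field poly"
  assumes "b \<noteq> 0" "degree b > 0"
  obtains p where "prime_elem p" "degree p > 0" "p dvd b"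
proof -
  define k where "k = (LEAST k. \<exists>p. p dvd b \<and> degree p > 0 \<and> degree p = k)"
  have "\<exists>p. p dvd b \<and> degree p > 0 \<and> degree p = k"
    unfolding k_def by (rule LeastI[of _ "degree b"], rule exI[of _ b]) (use assms in simp)
  then obtain p where p: "p dvd b" "degree p > 0" "degree p = k" by blast
  have least: "k \<le> degree h" if "h dvd b" "degree h > 0" for h
    unfolding k_def by (rule Least_le) (use that in blast)
  have p0: "p \<noteq> 0" using p by auto
  have "prime_elem p"
  proof (rule prime_elemI)
    show "\<not> is_unit p" using p p0 by (simp add: is_unit_iff_degree)
  next
    fix x y assume xy: "p dvd x * y"
    obtain h where h: "\<And>a. p dvd a * y \<longleftrightarrow> h dvd a"
    proof (rule poly_ideal_generator[of "\<lambda>a. p dvd a * y" p])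
      show "p dvd (a - b) * y" if "p dvd a * y" "p dvd b * y" for a b
        using that by (simp add: left_diff_distrib dvd_diff)
      show "p dvd c * a * y" if "p dvd a * y" for a c
        using that by (simp add: mult.assoc dvd_mult)
      show "p dvd p * y" by simp
      show "p \<noteq> 0" by (rule p0)
    qed (rule that)
    have hp: "h dvd p" and hx: "h dvd x" using h[of p] h[of x] xy by simp_all
    show "p dvd x \<or> p dvd y"
    proof (cases "degree h = 0")
      case True
      have "h \<noteq> 0" using hp p0 dvd_0_left by blast
      hence "h dvd 1" using True by (simp add: is_unit_iff_degree)
      thus ?thesis using h[of 1] by simp
    next
      case False
      moreover have "h dvd b" using hp p(1) by (rule dvd_trans)
      ultimately have "degree h \<ge> degree p" using least[of h] p(3) by simp
      moreover obtain c where c: "p = h * c" using hp by blast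
      moreover have nz: "h \<noteq> 0" "c \<noteq> 0" using p0 unfolding c by simp_all
      moreover have "degree p = degree h + degree c" unfolding c by (rule degree_mult_eq[OF nz])
      ultimately have "is_unit c" using is_unit_iff_degree[OF nz(2)] by simp
      hence "p dvd h" unfolding c by (simp add: mult_unit_dvd_iff)
      thus ?thesis using hx dvd_trans by blast
    qed
  qed (rule p0)
  with p(1,2) that show ?thesis by (intro that)
qed

lemma prime_poly_decompose:
  fixes b p :: "'a::field poly"
  assumes "b \<noteq> 0" "degree p > 0"
  obtains e c where "b = p ^ e * c" "\<not> p dvd c"
proof -
  have "\<exists>e c. b = p ^ e * c \<and> \<not> p dvd c" using assms(1)
  proof (induction "degree b" arbitrary: b rule: less_induct)
    case less
    show ?case
    proof (cases "p dvd b")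
      case True
      then obtain c where c: "b = p * c" by blast
      have c0: "p \<noteq> 0" "c \<noteq> 0" using less.prems unfolding c by simp_all
      have "degree b = degree p + degree c" unfolding c by (rule degree_mult_eq[OF c0])
      hence "degree c < degree b" using assms(2) by simp
      then obtain e c' where "c = p ^ e * c'" "\<not> p dvd c'" using less.hyps[of c] c0 by blast
      thus ?thesis using c by (intro exI[of _ "Suc e"] exI[of _ c']) (simp add: mult.assoc)
    next
      case False
      thus ?thesis by (intro exI[of _ 0] exI[of _ b]) simp
    qed
  qed
  thus ?thesis using that by blast
qed

lemma prime_power_dvd_cancel:
  fixes p :: "'a::idom"
  assumes "prime_elem p" "\<not> p dvd a" "p ^ e dvd a * s"
  shows "p ^ e dvd s"
  using assms(3)
proof (induction e arbitrary: s)
  case (Suc e)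
  have p0: "p \<noteq> 0" using assms(1) by (simp add: prime_elem_def)
  have "p dvd p ^ Suc e" by simp
  from dvd_trans[OF this Suc.prems] have "p dvd a * s" .
  hence "p dvd s" using prime_elem_dvd_mult_iff[OF assms(1), of a s] assms(2) by blast
  then obtain t where t: "s = p * t" by (rule dvdE)
  have eq: "a * s = p * (a * t)" unfolding t by (rule mult.left_commute)
  have "p * p ^ e dvd p * (a * t)" using Suc.prems unfolding eq power_Suc .
  hence "p ^ e dvd a * t" using dvd_mult_cancel_left[of p "p ^ e" "a * t"] p0 by blast
  from mult_dvd_mono[OF dvd_refl Suc.IH[OF this], of p] show ?case unfolding t power_Suc .
qed simp

lemma dvd_prime_power_cancel:
  fixes p :: "'a::idom"
  assumes "prime_elem p" "\<not> p dvd a" "a dvd p ^ e * s"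
  shows "a dvd s"
  using assms(3)
proof (induction e)
  case (Suc e)
  have p0: "p \<noteq> 0" using assms(1) by (simp add: prime_elem_def)
  obtain t where t: "p ^ Suc e * s = a * t" using Suc.prems by (rule dvdE)
  hence "a * t = p * (p ^ e * s)" by (simp add: mult.assoc)
  hence "p dvd a * t" by (rule dvdI)
  hence "p dvd t" using prime_elem_dvd_mult_iff[OF assms(1), of a t] assms(2) by blast
  then obtain t' where t': "t = p * t'" by (rule dvdE)
  have "a * t = p * (a * t')" unfolding t' by (rule mult.left_commute)
  with t have "p * (p ^ e * s) = p * (a * t')" by (simp only: power_Suc mult.assoc)
  hence "p ^ e * s = a * t'" using mult_cancel_left[of p "p ^ e * s" "a * t'"] p0 by blast
  hence "a dvd p ^ e * s" by (rule dvdI)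
  thus ?case by (rule Suc.IH)
qed simp

text \<open>One prime at a time: either the full \<open>p\<close>-part of \<open>b\<close> fails to
  divide \<open>a\<close>, or it is cancelled from both, which lowers the degree of \<open>b\<close>
  and keeps the non-divisibility.\<close>

lemma not_dvd_prime_power_witness:
  fixes a b :: "'a::field poly"
  assumes "a \<noteq> 0" "b \<noteq> 0" "\<not> b dvd a"
  obtains p e where "prime_elem p" "degree p > 0" "p ^ e dvd b" "\<not> p ^ e dvd a"
proof -
  have "\<exists>p e. prime_elem p \<and> degree p > 0 \<and> p ^ e dvd b \<and> \<not> p ^ e dvd a" using assms
  proof (induction "degree b" arbitrary: a b rule: less_induct)
    case less
    have "degree b > 0"
    proof (rule ccontr)
      assume "\<not> degree b > 0"
      hence "is_unit b" using less.prems by (simp add: is_unit_iff_degree)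
      thus False using less.prems by (simp add: unit_imp_dvd)
    qed
    then obtain p where p: "prime_elem p" "degree p > 0" "p dvd b"
      using exists_prime_poly_factor[OF less.prems(2)] by blast
    obtain e c where c: "b = p ^ e * c" "\<not> p dvd c" using prime_poly_decompose[OF less.prems(2) p(2)] .
    show ?case
    proof (cases "p ^ e dvd a")
      case False
      thus ?thesis using p c(1) by (intro exI[of _ p] exI[of _ e]) simp
    next
      case True
      then obtain s where s: "a = p ^ e * s" by blast
      have e: "e \<noteq> 0" using c p(3) by (intro notI) simp
      have nz: "c \<noteq> 0" "s \<noteq> 0" using c s less.prems by auto
      have "degree b = e * degree p + degree c" using c nz p(1) by (auto simp: degree_mult_eq degree_power_eq)
      hence "degree c < degree b" using e p(2) by simp
      moreover have "\<not> c dvd s" using less.prems(3) c s by auto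
      ultimately obtain r k where r: "prime_elem r" "degree r > 0" "r ^ k dvd c" "\<not> r ^ k dvd s"
        using less.hyps[of c s] nz by blast
      have "\<not> r dvd p ^ e"
      proof
        assume "r dvd p ^ e"
        hence "r dvd p" using r(1) prime_elem_dvd_power by blast
        then obtain t where t: "p = r * t" by blast
        hence "p dvd r * t" by simp
        hence "p dvd r \<or> p dvd t" using p(1) by (simp only: prime_elem_dvd_mult_iff)
        thus False
        proof
          assume "p dvd r"
          moreover have "r dvd c" using r(3,4) by (cases k) (auto dest: dvd_mult_left)
          ultimately show False using c(2) dvd_trans by blast
        next
          assume "p dvd t"
          moreover have "t \<noteq> 0" using t p by auto
          ultimately have "degree p \<le> degree t" by (rule dvd_imp_degree_le)
          moreover have "r \<noteq> 0" using r(2) by auto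
          ultimately show False using t r(2) \<open>t \<noteq> 0\<close> by (simp add: degree_mult_eq)
        qed
      qed
      hence "\<not> r ^ k dvd a" using prime_power_dvd_cancel[OF r(1)] r(4) s by blast
      moreover have "r ^ k dvd b" using r(3) c by simp
      ultimately show ?thesis using r by blast
    qed
  qed
  thus ?thesis using that by blast
qed

section \<open>Invariant factors of finite modules\<close>

text \<open>A module over the polynomial ring; \<open>subspace\<close> inside this locale means
  submodule.\<close>

locale poly_module = Modules.module act
  for act :: "'a::{field,finite} poly \<Rightarrow> 'b::ab_group_add \<Rightarrow> 'b"
begin

text \<open>Pigeonhole: there are more polynomials of degree below \<open>card V\<close> than
  elements of \<open>V\<close>, so two of them agree on \<open>v\<close> and their difference
  annihilates it. The annihilator is thus a nonzero ideal, and \<open>f\<close> is its monic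
  generator.\<close>

lemma order_exists:
  assumes V: "subspace V" "finite V" and v: "v \<in> V"
  obtains f where "lead_coeff f = 1" "\<And>g. act g v = 0 \<longleftrightarrow> f dvd g"
proof -
  have "\<exists>g. g \<noteq> 0 \<and> act g v = 0"
  proof (rule ccontr)
    assume *: "\<nexists>g. g \<noteq> 0 \<and> act g v = 0"
    have "inj_on (\<lambda>p. act p v) (polys (card V))"
    proof (rule inj_onI)
      fix p r assume "act p v = act r v"
      hence "act (p - r) v = 0" by (simp add: scale_left_diff_distrib)
      with * have "p - r = 0" by blast
      thus "p = r" by simp
    qed
    moreover have "(\<lambda>p. act p v) ` polys (card V) \<subseteq> V" using V v by (auto intro: subspace_scale)
    ultimately have "CARD('a) ^ card V \<le> card V"
      using card_inj_on_le[OF _ _ V(2)] by (metis card_polys)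
    moreover have "CARD('a) > 1" using card_mono[of UNIV "{0,1::'a}"] by simp
    ultimately show False using power_gt_expt[of "CARD('a)" "card V"] by simp
  qed
  then obtain g0 where "act g0 v = 0" "g0 \<noteq> 0" by blast
  thus ?thesis
  proof (rule poly_ideal_generator[of "\<lambda>g. act g v = 0" g0])
    show "act (a - b) v = 0" if "act a v = 0" "act b v = 0" for a b
      using that by (simp add: scale_left_diff_distrib)
    show "act (c * a) v = 0" if "act a v = 0" for a c
      using that scale_scale[of c a v] by simp
  qed (rule that)
qed

lemma max_order_vector:
  assumes V: "subspace V" "finite V"
  obtains v f where "v \<in> V" "lead_coeff f = 1" "\<And>g. act g v = 0 \<longleftrightarrow> f dvd g"
    "\<And>u. u \<in> V \<Longrightarrow> act f u = 0"
proof -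
  have "\<forall>v. \<exists>f. v \<in> V \<longrightarrow> lead_coeff f = 1 \<and> (\<forall>g. act g v = 0 \<longleftrightarrow> f dvd g)"
  proof
    fix v
    show "\<exists>f. v \<in> V \<longrightarrow> lead_coeff f = 1 \<and> (\<forall>g. act g v = 0 \<longleftrightarrow> f dvd g)"
    proof (cases "v \<in> V")
      case True
      obtain f where "lead_coeff f = 1" "\<And>g. act g v = 0 \<longleftrightarrow> f dvd g" by (rule order_exists[OF V True]) blast
      thus ?thesis by blast
    qed simp
  qed
  from choice[OF this] obtain ordp where
    o: "\<And>v. v \<in> V \<Longrightarrow> lead_coeff (ordp v) = 1" "\<And>v g. v \<in> V \<Longrightarrow> act g v = 0 \<longleftrightarrow> ordp v dvd g"
    by blast
  have nz: "ordp v \<noteq> 0" if "v \<in> V" for v using o(1)[OF that] by auto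
  have "V \<noteq> {}" using subspace_0[OF V(1)] by blast
  hence "Max ((\<lambda>w. degree (ordp w)) ` V) \<in> (\<lambda>w. degree (ordp w)) ` V" using V(2) by (intro Max_in) simp_all
  then obtain v where v: "v \<in> V" "degree (ordp v) = Max ((\<lambda>w. degree (ordp w)) ` V)" by force
  have max: "degree (ordp w) \<le> degree (ordp v)" if "w \<in> V" for w
    unfolding v(2) using V(2) that by (intro Max_ge) simp_all
  note v = v(1)
  \<comment> \<open>Otherwise the \<open>p\<close>-part of \<open>v\<close> could be exchanged for the larger \<open>p\<close>-part of \<open>u\<close>.\<close>
  have "act (ordp v) u = 0" if u: "u \<in> V" for u
  proof (rule ccontr)
    assume "act (ordp v) u \<noteq> 0"
    hence "\<not> ordp u dvd ordp v" using o(2)[OF u] by simp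
    then obtain p e where p: "prime_elem p" "degree p > 0" "p ^ e dvd ordp u" "\<not> p ^ e dvd ordp v"
      by (rule not_dvd_prime_power_witness[OF nz[OF v] nz[OF u]])
    obtain b where b: "ordp u = p ^ e * b" using p(3) by (rule dvdE)
    obtain i a where a: "ordp v = p ^ i * a" "\<not> p dvd a" using prime_poly_decompose[OF nz[OF v] p(2)] .
    have ie: "i < e"
    proof (rule ccontr)
      assume "\<not> i < e"
      hence "p ^ e dvd p ^ i" by (intro le_imp_power_dvd) simp
      thus False using p(4) unfolding a(1) by simp
    qed
    \<comment> \<open>Here \<open>act (p ^ i) v\<close> has order \<open>a\<close> and
      \<open>act b u\<close> has order \<open>p ^ e\<close>. These are coprime, so the order of the
      sum is divisible by \<open>a * p ^ e\<close>, whose degree exceeds that of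
      \<open>p ^ i * a\<close> because \<open>i < e\<close>.\<close>
    define w where "w = act (p ^ i) v + act b u"
    have w: "w \<in> V" using V v u by (simp add: w_def subspace_add subspace_scale)
    define g where "g = ordp w"
    have gw: "act g w = 0" using o(2)[OF w] by (simp add: g_def)
    have kill: "act (c * g) w = 0" for c using gw scale_scale[of c g w] by simp
    have exp: "act h w = act (h * p ^ i) v + act (h * b) u" for h
      by (simp add: w_def scale_right_distrib)
    have "act (a * g * p ^ i) v = 0"
      unfolding o(2)[OF v] a(1) by (rule dvdI[of _ _ g]) (simp add: mult_ac)
    hence "act (a * g * b) u = 0" using exp[of "a * g"] kill[of a] by simp
    hence "p ^ e * b dvd a * g * b" using o(2)[OF u] b by simp
    moreover have "b \<noteq> 0" using nz[OF u] unfolding b by simp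
    ultimately have "p ^ e dvd a * g" using dvd_mult_cancel_right[of "p ^ e" b "a * g"] by blast
    hence 1: "p ^ e dvd g" by (rule prime_power_dvd_cancel[OF p(1) a(2)])
    have "act (p ^ e * g * b) u = 0"
      unfolding o(2)[OF u] b by (rule dvdI[of _ _ g]) (simp add: mult_ac)
    hence "act (p ^ e * g * p ^ i) v = 0" using exp[of "p ^ e * g"] kill[of "p ^ e"] by simp
    hence "p ^ i * a dvd p ^ i * (p ^ e * g)" unfolding o(2)[OF v] a(1) by (simp only: mult.commute[of "p ^ i"])
    moreover have "p ^ i \<noteq> 0" using p(1) by (simp add: prime_elem_def)
    ultimately have "a dvd p ^ e * g" using dvd_mult_cancel_left[of "p ^ i" a "p ^ e * g"] by blast
    hence "a dvd g" by (rule dvd_prime_power_cancel[OF p(1) a(2)])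
    then obtain s where s: "g = a * s" by (rule dvdE)
    have "p ^ e dvd s" by (rule prime_power_dvd_cancel[OF p(1) a(2) 1[unfolded s]])
    hence "a * p ^ e dvd g" unfolding s by (rule mult_dvd_mono[OF dvd_refl])
    moreover have g0: "g \<noteq> 0" using nz[OF w] by (simp add: g_def)
    ultimately have "degree (a * p ^ e) \<le> degree g" by (rule dvd_imp_degree_le)
    moreover have "a \<noteq> 0" "p \<noteq> 0" using nz[OF v] p(1) unfolding a(1) by (simp_all add: prime_elem_def)
    ultimately have "degree a + e * degree p \<le> degree (ordp v)"
      using max[OF w] by (simp add: g_def degree_mult_eq degree_power_eq)
    also have "degree (ordp v) = i * degree p + degree a"
      unfolding a(1) using \<open>a \<noteq> 0\<close> \<open>p \<noteq> 0\<close> by (simp add: degree_mult_eq degree_power_eq)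
    finally show False using ie p(2) by simp
  qed
  with o(2)[OF v] show ?thesis by (intro that[OF v o(1)[OF v]])
qed

text \<open>The vectors \<open>x^i v\<close> with \<open>i < degree f\<close> are linearly
  independent over the field, so a functional may take the value 1 on the last of them and 0 on the
  others. The top coefficient is chosen because it vanishes on no nonzero submodule of the cyclic
  module, as \<open>functional_zero_imp_zero\<close> shows.\<close>

lemma linear_functional_exists:
  assumes ord: "\<And>g. act g v = 0 \<longleftrightarrow> f dvd g" and d: "degree f > 0"
  obtains l :: "'b \<Rightarrow> 'a" where "\<And>x y. l (x + y) = l x + l y" "\<And>c x. l (act [:c:] x) = c * l x"
    "\<And>p. p \<in> polys (degree f) \<Longrightarrow> l (act p v) = coeff p (degree f - 1)"
proof -
  interpret vs: Vector_Spaces.vector_space "\<lambda>c. act [:c:]"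
    by unfold_locales
      (simp_all add: scale_right_distrib scale_left_distrib[symmetric] one_pCons[symmetric] mult.commute)
  interpret fs: Vector_Spaces.vector_space "(*) :: 'a \<Rightarrow> 'a \<Rightarrow> 'a"
    by unfold_locales (simp_all add: algebra_simps)
  interpret vp: vector_space_pair "\<lambda>c. act [:c:]" "(*) :: 'a \<Rightarrow> 'a \<Rightarrow> 'a" ..
  let ?d = "degree f"
  let ?b = "\<lambda>i. act (monom 1 i) v"
  have zero: "p = 0" if "p \<in> polys ?d" "act p v = 0" for p
  proof (rule ccontr)
    assume "p \<noteq> 0"
    thus False using that dvd_imp_degree_le[of f p] unfolding ord polys_iff by simp
  qed
  have inj: "inj_on ?b {..<?d}"
  proof (rule inj_onI)
    fix i j assume ij: "i \<in> {..<?d}" "j \<in> {..<?d}" "?b i = ?b j"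
    have "monom 1 i - monom 1 j \<in> (polys ?d :: 'a poly set)" using ij by (auto simp: polys_def)
    moreover have "act (monom 1 i - monom 1 j) v = 0" using ij(3) by (simp add: scale_left_diff_distrib)
    ultimately have "monom (1::'a) i - monom 1 j = 0" by (rule zero)
    hence "coeff (monom (1::'a) i) i = coeff (monom 1 j) i" by simp
    thus "i = j" by (auto split: if_splits)
  qed
  have "vs.independent (?b ` {..<?d})"
  proof (rule vs.independent_if_scalars_zero)
    fix c x assume sum: "(\<Sum>x\<in>?b ` {..<?d}. act [:c x:] x) = 0" and x: "x \<in> ?b ` {..<?d}"
    define p where "p = (\<Sum>i<?d. monom (c (?b i)) i)"
    have cp: "coeff p j = (if j < ?d then c (?b j) else 0)" for j by (simp add: p_def coeff_sum)
    have "act p v = (\<Sum>i<?d. act [:c (?b i):] (?b i))"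
      by (simp add: p_def scale_sum_left smult_monom)
    also have "\<dots> = 0" using sum by (simp add: sum.reindex[OF inj])
    finally have "p = 0" by (intro zero) (simp_all add: polys_def cp)
    thus "c x = 0" using x cp by (metis (no_types, lifting) coeff_0 imageE lessThan_iff)
  qed simp
  from vp.linear_independent_extend[OF this, of "\<lambda>x. if x = ?b (?d - 1) then 1 else 0"]
  obtain l where lin: "Vector_Spaces.linear (\<lambda>c. act [:c:]) (*) l"
    and l: "\<And>i. i < ?d \<Longrightarrow> l (?b i) = (if ?b i = ?b (?d - 1) then 1 else 0)" by auto
  interpret lin: Vector_Spaces.linear "\<lambda>c. act [:c:]" "(*)" l by (rule lin)
  have "l (act p v) = coeff p (?d - 1)" if p: "p \<in> polys ?d" for p
  proof -
    have "p = (\<Sum>i<?d. monom (coeff p i) i)"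
      using p by (intro poly_eqI) (auto simp: coeff_sum polys_def)
    hence "act p v = (\<Sum>i<?d. act [:coeff p i:] (?b i))"
      by (metis (no_types, lifting) scale_sum_left scale_scale mult_1_right smult_monom sum.cong mult_pCons_left mult_zero_left pCons_0_0 add_0_right)
    hence "l (act p v) = (\<Sum>i<?d. coeff p i * l (?b i))" by (simp only: lin.sum lin.scale)
    also have "\<dots> = (\<Sum>i<?d. if i = ?d - 1 then coeff p i else 0)"
      using l inj d by (intro sum.cong) (auto simp: inj_on_def)
    also have "\<dots> = coeff p (?d - 1)" using d by simp
    finally show ?thesis .
  qed
  with that[of l] lin.add lin.scale show ?thesis by blast
qed

text \<open>A suitable power of \<open>x\<close> lifts the leading term of \<open>p\<close> to
  degree \<open>degree f - 1\<close> without reduction modulo \<open>f\<close>, and there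
  \<open>l\<close> reads off the leading coefficient.\<close>

lemma functional_zero_imp_zero:
  assumes l: "\<And>p. p \<in> polys (degree f) \<Longrightarrow> l (act p v) = coeff p (degree f - 1)"
    and p: "p \<in> polys (degree f)" and zero: "\<And>i. i < degree f \<Longrightarrow> l (act (monom 1 i * p) v) = 0"
  shows "p = 0"
proof (rule ccontr)
  assume p0: "p \<noteq> 0"
  hence dp: "degree p < degree f" using p by (simp add: polys_iff)
  let ?i = "degree f - 1 - degree p"
  have i: "?i < degree f" using dp by simp
  have deg: "degree (monom 1 ?i * p) = degree f - 1"
    using p0 dp by (simp add: degree_mult_eq degree_monom_eq)
  have "monom 1 ?i * p \<in> polys (degree f)" using deg dp by (simp add: polys_iff)
  hence "coeff (monom 1 ?i * p) (degree f - 1) = 0" using l zero[OF i] by simp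
  hence "lead_coeff (monom 1 ?i * p) = 0" using deg by simp
  hence "monom 1 ?i * p = 0" by (simp only: leading_coeff_0_iff)
  thus False using p0 by simp
qed

text \<open>The values of \<open>l\<close> on \<open>x^i u\<close>, \<open>i < degree f\<close>,
  define a linear map on \<open>V\<close> with kernel \<open>W\<close>. On the cyclic submodule
  generated by \<open>v\<close> it is injective, hence by counting a bijection onto all value
  tuples, so every \<open>u\<close> differs from exactly one element of that submodule by an element
  of \<open>W\<close>.\<close>

lemma cyclic_complement:
  assumes V: "subspace V" and v: "v \<in> V" and f: "lead_coeff f = 1"
    and ord: "\<And>g. act g v = 0 \<longleftrightarrow> f dvd g" and kill: "\<And>u. u \<in> V \<Longrightarrow> act f u = 0"
    and d: "degree f > 0"
  obtains W where "subspace W" "W \<subseteq> V"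
    "bij_betw (\<lambda>(p, w). act p v + w) (polys (degree f) \<times> W) V"
proof -
  obtain l :: "'b \<Rightarrow> 'a" where add: "\<And>x y. l (x + y) = l x + l y"
    and scale: "\<And>c x. l (act [:c:] x) = c * l x"
    and l: "\<And>p. p \<in> polys (degree f) \<Longrightarrow> l (act p v) = coeff p (degree f - 1)"
    by (rule linear_functional_exists[OF ord d]) blast
  let ?d = "degree f"
  have f0: "f \<noteq> 0" using f by auto
  have "l 0 + l 0 = l 0 + 0" using add[of 0 0] by simp
  hence l0: "l 0 = 0" by (rule add_left_imp_eq)
  have lminus: "l (- x) = - l x" for x
    using add[of x "- x"] l0 by (simp add: eq_neg_iff_add_eq_0 add.commute)
  have ldiff: "l (x - y) = l x - l y" for x y using add[of x "- y"] lminus[of y] by simp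
  have lsum: "l (sum h S) = (\<Sum>i\<in>S. l (h i))" for h and S :: "nat set"
    by (induction S rule: infinite_finite_induct) (simp_all add: l0 add)
  \<comment> \<open>the largest submodule of \<open>V\<close> on which \<open>l\<close> vanishes\<close>
  define W where "W = {u \<in> V. \<forall>p. l (act p u) = 0}"
  have subW: "subspace W"
    unfolding W_def
  proof (rule subspaceI)
    show "0 \<in> {u \<in> V. \<forall>p. l (act p u) = 0}" using subspace_0[OF V] by (simp add: l0)
    show "x + y \<in> {u \<in> V. \<forall>p. l (act p u) = 0}"
      if "x \<in> {u \<in> V. \<forall>p. l (act p u) = 0}" "y \<in> {u \<in> V. \<forall>p. l (act p u) = 0}" for x y
      using that subspace_add[OF V] by (simp add: scale_right_distrib add)
    show "act c x \<in> {u \<in> V. \<forall>p. l (act p u) = 0}"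
      if "x \<in> {u \<in> V. \<forall>p. l (act p u) = 0}" for c x
      using that subspace_scale[OF V] by simp
  qed
  \<comment> \<open>As \<open>f\<close> kills all of \<open>V\<close>, polynomials act through their
    residues modulo \<open>f\<close>, so membership in \<open>W\<close> need only be tested on
    powers of \<open>x\<close> below \<open>degree f\<close>.\<close>
  have exps: "l (act g u) = 0" if u: "u \<in> V" and z: "\<And>i. i < ?d \<Longrightarrow> l (act (monom 1 i) u) = 0" for g u
  proof -
    have "act g u = act (g mod f) u + act (g div f * f) u"
      by (simp add: scale_left_distrib[symmetric])
    also have "act (g div f * f) u = 0" using kill[OF u] scale_scale[of "g div f" f u] by simp
    finally have eq: "act g u = act (g mod f) u" by simp
    have "g mod f = (\<Sum>i<?d. [:coeff (g mod f) i:] * monom 1 i)"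
      using mod_in_polys[OF f0, of g] by (intro poly_eqI) (auto simp: coeff_sum polys_def smult_monom)
    hence "act (g mod f) u = act (\<Sum>i<?d. [:coeff (g mod f) i:] * monom 1 i) u" by (rule arg_cong)
    also have "\<dots> = (\<Sum>i<?d. act [:coeff (g mod f) i:] (act (monom 1 i) u))"
      by (simp only: scale_sum_left scale_scale)
    finally have "l (act g u) = (\<Sum>i<?d. coeff (g mod f) i * l (act (monom 1 i) u))"
      unfolding eq by (simp only: lsum scale)
    also have "\<dots> = 0" by (rule sum.neutral) (simp add: z)
    finally show ?thesis .
  qed
  let ?\<Phi> = "\<lambda>p. \<lambda>i\<in>{..<?d}. l (act (monom 1 i * p) v)"
  have inj\<Phi>: "inj_on ?\<Phi> (polys ?d)"
  proof (rule inj_onI)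
    fix p r assume pr: "p \<in> polys ?d" "r \<in> polys ?d" "?\<Phi> p = ?\<Phi> r"
    have "l (act (monom 1 i * (p - r)) v) = 0" if "i < ?d" for i
      using fun_cong[OF pr(3), of i] that
      by (simp add: right_diff_distrib scale_left_diff_distrib ldiff)
    hence "p - r = 0" by (intro functional_zero_imp_zero[of f l v, OF l] polys_diff pr(1,2)) simp_all
    thus "p = r" by simp
  qed
  have surj\<Phi>: "?\<Phi> ` polys ?d = PiE {..<?d} (\<lambda>_. UNIV)"
  proof (rule card_subset_eq)
    show "?\<Phi> ` polys ?d \<subseteq> PiE {..<?d} (\<lambda>_. UNIV)" by (rule image_subsetI) (simp add: PiE_def)
    show "card (?\<Phi> ` polys ?d) = card (PiE {..<?d} (\<lambda>_. UNIV :: 'a set))"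
      using card_image[OF inj\<Phi>] by (simp add: card_polys card_PiE)
  qed (simp add: finite_PiE)
  let ?g = "\<lambda>(p, w). act p v + w"
  have "inj_on ?g (polys ?d \<times> W)"
  proof (rule inj_onI)
    fix x y assume x: "x \<in> polys ?d \<times> W" and y: "y \<in> polys ?d \<times> W" and eq: "?g x = ?g y"
    obtain p w where pw: "x = (p, w)" "p \<in> polys ?d" "w \<in> W" using x by (cases x) simp
    obtain r u where ru: "y = (r, u)" "r \<in> polys ?d" "u \<in> W" using y by (cases y) simp
    have eq': "act (p - r) v = u - w" using eq pw(1) ru(1) by (simp add: scale_left_diff_distrib algebra_simps)
    have "u - w \<in> W" by (rule subspace_diff[OF subW ru(3) pw(3)])
    hence "l (act (monom 1 i) (act (p - r) v)) = 0" for i unfolding eq' W_def by simp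
    hence "l (act (monom 1 i * (p - r)) v) = 0" for i by simp
    hence "p - r = 0" by (intro functional_zero_imp_zero[of f l v, OF l] polys_diff pw(2) ru(2)) simp_all
    thus "x = y" using eq' pw(1) ru(1) by simp
  qed
  moreover have "?g ` (polys ?d \<times> W) = V"
  proof (intro equalityI subsetI)
    fix u assume "u \<in> ?g ` (polys ?d \<times> W)"
    then obtain p w where "u = act p v + w" "w \<in> W" by auto
    thus "u \<in> V" using V v by (simp add: W_def subspace_add subspace_scale)
  next
    fix u assume u: "u \<in> V"
    have "(\<lambda>i\<in>{..<?d}. l (act (monom 1 i) u)) \<in> PiE {..<?d} (\<lambda>_. UNIV)" by (simp add: PiE_def)
    then obtain p where p: "p \<in> polys ?d" "?\<Phi> p = (\<lambda>i\<in>{..<?d}. l (act (monom 1 i) u))"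
      unfolding surj\<Phi>[symmetric] by (metis (no_types, lifting) imageE)
    define w where "w = u - act p v"
    have wV: "w \<in> V" using u V v by (simp add: w_def subspace_diff subspace_scale)
    have "l (act (monom 1 i) w) = 0" if "i < ?d" for i
      using fun_cong[OF p(2), of i] that by (simp add: w_def scale_right_diff_distrib ldiff)
    hence "l (act g w) = 0" for g by (rule exps[OF wV])
    hence "w \<in> W" using wV by (simp add: W_def)
    moreover have "u = ?g (p, w)" by (simp add: w_def)
    ultimately show "u \<in> ?g ` (polys ?d \<times> W)" using p(1) by blast
  qed
  ultimately have "bij_betw ?g (polys ?d \<times> W) V" by (simp add: bij_betw_def)
  moreover have "W \<subseteq> V" by (auto simp: W_def)
  ultimately show ?thesis using that[OF subW] by blast
qed

text \<open>\<open>decomp V fs\<close>: the submodule \<open>V\<close> is an internal direct sum of cyclic submodules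
  \<open>F[x]/(f)\<close> with \<open>f\<close> running through the list \<open>fs\<close>.\<close>

inductive decomp :: "'b set \<Rightarrow> 'a poly list \<Rightarrow> bool" where
  decomp_Nil: "decomp {0} []"
| decomp_Cons: "decomp V (f # fs)" if "decomp W fs" "subspace W" "lead_coeff f = 1" "act f v = 0"
    "bij_betw (\<lambda>(p, w). act p v + w) (polys (degree f) \<times> W) V"

text \<open>Split off a cyclic summand generated by a vector of maximal order and continue in the
  complement. The last conjunct carries the induction: \<open>f\<close> kills \<open>V\<close> and
  hence the complement, so all later factors divide \<open>f\<close>.\<close>

lemma decomp_exists:
  assumes "subspace V" "finite V"
  shows "\<exists>fs. decomp V fs \<and> sorted_wrt (\<lambda>f g. g dvd f) fs \<and> (\<forall>f\<in>set fs. degree f > 0) \<and>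
           (\<forall>g. (\<forall>u\<in>V. act g u = 0) \<longrightarrow> (\<forall>f\<in>set fs. f dvd g))"
  using assms
proof (induction "card V" arbitrary: V rule: less_induct)
  case less
  show ?case
  proof (cases "V = {0}")
    case True
    thus ?thesis by (intro exI[of _ "[]"]) (simp add: decomp_Nil)
  next
    case False
    obtain v f where v: "v \<in> V" "lead_coeff f = 1" and ord: "\<And>g. act g v = 0 \<longleftrightarrow> f dvd g"
      and kill: "\<And>u. u \<in> V \<Longrightarrow> act f u = 0"
      by (rule max_order_vector[OF less.prems]) blast
    have f0: "f \<noteq> 0" using v(2) by auto
    have d: "degree f > 0"
    proof (rule ccontr)
      assume "\<not> degree f > 0"
      then obtain c where "f = [:c:]" by (auto elim: degree_eq_zeroE)
      hence "f = 1" using v(2) by (simp add: one_pCons)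
      hence "u = 0" if "u \<in> V" for u using kill[OF that] by simp
      thus False using False subspace_0[OF less.prems(1)] by blast
    qed
    obtain W where W: "subspace W" "W \<subseteq> V"
      and bij: "bij_betw (\<lambda>(p, w). act p v + w) (polys (degree f) \<times> W) V"
      by (rule cyclic_complement[OF less.prems(1) v ord kill d]) blast
    have finW: "finite W" using W less.prems by (blast intro: finite_subset)
    have "card V = CARD('a) ^ degree f * card W"
      using bij_betw_same_card[OF bij] by (simp add: card_cartesian_product card_polys)
    moreover have "card W > 0" using finW subspace_0[OF W(1)] card_gt_0_iff by blast
    moreover have "CARD('a) ^ degree f > 1"
      using card_mono[of UNIV "{0,1::'a}"] d by (intro one_less_power) simp_all
    ultimately have "card W < card V" by simp
    from less.hyps[OF this W(1) finW] obtain fs where fs: "decomp W fs" "sorted_wrt (\<lambda>f g. g dvd f) fs"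
      "\<forall>f\<in>set fs. degree f > 0" "\<forall>g. (\<forall>u\<in>W. act g u = 0) \<longrightarrow> (\<forall>f\<in>set fs. f dvd g)" by blast
    have "decomp V (f # fs)" using ord[of f] by (intro decomp_Cons[OF fs(1) W(1) v(2) _ bij]) simp
    moreover have "\<forall>g\<in>set fs. g dvd f" using fs(4) kill W(2) by blast
    moreover have "\<forall>g. (\<forall>u\<in>V. act g u = 0) \<longrightarrow> (\<forall>h\<in>set (f # fs). h dvd g)"
      using fs(4) W(2) v(1) ord by (metis set_ConsD subsetD)
    ultimately show ?thesis using fs(2,3) d by (intro exI[of _ "f # fs"]) simp
  qed
qed

end

section \<open>Torsion counts and uniqueness of the invariant factors\<close>

definition ann_count :: "'a::{field,finite} poly \<Rightarrow> 'a poly \<Rightarrow> nat" where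
  "ann_count g f = card {p \<in> polys (degree f). f dvd g * p}"

lemma ann_count_le: "ann_count g f \<le> CARD('a) ^ degree f" for f g :: "'a::{field,finite} poly"
  unfolding ann_count_def card_polys[symmetric] by (rule card_mono) auto

lemma ann_count_pos: "ann_count g f > 0"
proof -
  have "0 \<in> {p \<in> polys (degree f). f dvd g * p}" by simp
  moreover have "finite {p \<in> polys (degree f). f dvd g * p}" by simp
  ultimately show ?thesis unfolding ann_count_def by (metis card_gt_0_iff empty_iff)
qed

lemma ann_count_dvd: "f dvd g \<Longrightarrow> ann_count g f = CARD('a) ^ degree f" for f g :: "'a::{field,finite} poly"
proof -
  assume "f dvd g"
  hence "{p \<in> polys (degree f). f dvd g * p} = polys (degree f)" by auto
  thus ?thesis by (simp add: ann_count_def card_polys)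
qed

lemma dvd_if_ann_count_eq:
  fixes f g :: "'a::{field,finite} poly"
  assumes "lead_coeff f = 1" "ann_count g f = CARD('a) ^ degree f"
  shows "f dvd g"
proof (cases "degree f = 0")
  case True
  then obtain c where "f = [:c:]" by (auto elim: degree_eq_zeroE)
  hence "f = 1" using assms(1) by (simp add: one_pCons)
  thus ?thesis by simp
next
  case False
  have "{p \<in> polys (degree f). f dvd g * p} = polys (degree f)"
    by (rule card_subset_eq) (use assms(2) in \<open>simp_all add: ann_count_def card_polys\<close>)
  moreover have "(1 :: 'a poly) \<in> polys (degree f)" using False by (simp add: polys_iff)
  ultimately have "1 \<in> {p \<in> polys (degree f). f dvd g * p}" by simp
  thus ?thesis by simp
qed

text \<open>Taking \<open>g\<close> to be the head \<open>f\<close> of the first list makes every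
  factor on the left maximal, since all its members divide \<open>f\<close>. Equality of the
  products forces the same on the right, so the head \<open>h\<close> of the second list divides
  \<open>f\<close>. By symmetry and monicity \<open>f = h\<close>, and the positive head factors
  cancel.\<close>

lemma chain_unique:
  fixes fs gs :: "'a::{field,finite} poly list"
  assumes "length fs = length gs" "sorted_wrt (\<lambda>f g. g dvd f) fs" "sorted_wrt (\<lambda>f g. g dvd f) gs"
    "\<forall>f\<in>set fs. lead_coeff f = 1" "\<forall>f\<in>set gs. lead_coeff f = 1"
    "\<And>g. (\<Prod>f\<leftarrow>fs. ann_count g f) = (\<Prod>f\<leftarrow>gs. ann_count g f)"
  shows "fs = gs"
  using assms
proof (induction fs gs rule: list_induct2)
  case (Cons f fs h gs)
  have le: "(\<Prod>f\<leftarrow>xs. ann_count g f) \<le> (\<Prod>f\<leftarrow>xs. CARD('a) ^ degree f)" for g :: "'a poly" and xs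
    by (induction xs) (simp_all add: mult_mono ann_count_le)
  \<comment> \<open>For \<open>g = 0\<close> every factor is maximal, which compares the total
    sizes.\<close>
  have deg: "(\<Prod>f\<leftarrow>f # fs. CARD('a) ^ degree f) = (\<Prod>f\<leftarrow>h # gs. CARD('a) ^ degree f)"
    using Cons.prems(5)[of 0] by (simp add: ann_count_dvd)
  have full: "(\<Prod>g\<leftarrow>xs. ann_count x g) = (\<Prod>f\<leftarrow>xs. CARD('a) ^ degree f)"
    if "\<forall>g\<in>set xs. g dvd x" for x :: "'a poly" and xs
    using that by (induction xs) (simp_all add: ann_count_dvd)
  have pos: "(\<Prod>f\<leftarrow>xs. CARD('a) ^ degree f) > 0" for xs :: "'a poly list"
    by (induction xs) simp_all
  have eq_head: "ann_count x y = CARD('a) ^ degree y"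
    if "(\<Prod>f\<leftarrow>y # ys. ann_count x f) = (\<Prod>f\<leftarrow>y # ys. CARD('a) ^ degree f)" for x y :: "'a poly" and ys
  proof (rule ccontr)
    assume "ann_count x y \<noteq> CARD('a) ^ degree y"
    hence "ann_count x y < CARD('a) ^ degree y" using ann_count_le[of x y] by simp
    hence "ann_count x y * (\<Prod>f\<leftarrow>ys. CARD('a) ^ degree f) < CARD('a) ^ degree y * (\<Prod>f\<leftarrow>ys. CARD('a) ^ degree f)"
      using pos[of ys] by (rule mult_strict_right_mono)
    moreover have "ann_count x y * (\<Prod>f\<leftarrow>ys. ann_count x f) \<le> ann_count x y * (\<Prod>f\<leftarrow>ys. CARD('a) ^ degree f)"
      by (rule mult_le_mono2[OF le])
    ultimately have "ann_count x y * (\<Prod>f\<leftarrow>ys. ann_count x f) < CARD('a) ^ degree y * (\<Prod>f\<leftarrow>ys. CARD('a) ^ degree f)"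
      by (rule le_less_trans[rotated])
    thus False using that by simp
  qed
  have lc: "lead_coeff f = 1" "lead_coeff h = 1" using Cons.prems(3,4) by simp_all
  have "\<forall>g\<in>set (f # fs). g dvd f" using Cons.prems(1) by simp
  from Cons.prems(5)[of f] full[OF this] deg
  have "(\<Prod>g\<leftarrow>h # gs. ann_count f g) = (\<Prod>g\<leftarrow>h # gs. CARD('a) ^ degree g)" by (simp only:)
  from dvd_if_ann_count_eq[OF lc(2) eq_head[OF this]] have hf: "h dvd f" .
  have "\<forall>g\<in>set (h # gs). g dvd h" using Cons.prems(2) by simp
  from Cons.prems(5)[of h] full[OF this] deg
  have "(\<Prod>g\<leftarrow>f # fs. ann_count h g) = (\<Prod>g\<leftarrow>f # fs. CARD('a) ^ degree g)" by (simp only:)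
  from dvd_if_ann_count_eq[OF lc(1) eq_head[OF this]] have fh: "f dvd h" .
  obtain c where c: "f = h * c" using hf by (rule dvdE)
  from lc have nz: "f \<noteq> 0" "h \<noteq> 0" by auto
  have c0: "c \<noteq> 0" using nz(1) unfolding c by simp
  have "degree h + degree c = degree f" unfolding c by (rule degree_mult_eq[OF nz(2) c0, symmetric])
  hence "degree c = 0" using dvd_imp_degree_le[OF fh nz(2)] by simp
  then obtain d where d: "c = [:d:]" by (auto elim: degree_eq_zeroE)
  have "lead_coeff f = lead_coeff h * lead_coeff c" unfolding c by (rule lead_coeff_mult)
  hence "d = 1" using lc d by simp
  hence "f = h" using c d by simp
  moreover have "fs = gs"
  proof (rule Cons.IH)
    show "(\<Prod>f\<leftarrow>fs. ann_count g f) = (\<Prod>f\<leftarrow>gs. ann_count g f)" for g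
      using Cons.prems(5)[of g] ann_count_pos[of g f] \<open>f = h\<close> by simp
  qed (use Cons.prems(1-4) in simp_all)
  ultimately show ?case by simp
qed simp

context poly_module
begin

lemma act_mod: "act f v = 0 \<Longrightarrow> act (p mod f) v = act p v"
proof -
  assume "act f v = 0"
  hence "act (p div f * f) v = 0" using scale_scale[of "p div f" f v] by simp
  moreover have "act p v = act (p div f * f) v + act (p mod f) v"
    by (simp only: scale_left_distrib[symmetric] div_mult_mod_eq)
  ultimately show ?thesis by simp
qed

lemma cyclic_sum_image:
  assumes "lead_coeff f = 1" "act f v = 0" "bij_betw (\<lambda>(p, w). act p v + w) (polys (degree f) \<times> W) V"
  shows "w \<in> W \<Longrightarrow> act p v + w \<in> V"
    and "u \<in> V \<Longrightarrow> \<exists>p\<in>polys (degree f). \<exists>w\<in>W. u = act p v + w"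
proof -
  have f0: "f \<noteq> 0" using assms(1) by auto
  show "act p v + w \<in> V" if "w \<in> W"
  proof -
    have "(p mod f, w) \<in> polys (degree f) \<times> W" using that mod_in_polys[OF f0] by simp
    hence "(\<lambda>(p, w). act p v + w) (p mod f, w) \<in> V" by (rule bij_betwE[OF assms(3), rule_format])
    thus ?thesis by (simp add: act_mod[OF assms(2)])
  qed
  show "\<exists>p\<in>polys (degree f). \<exists>w\<in>W. u = act p v + w" if "u \<in> V"
    using that bij_betw_imp_surj_on[OF assms(3)] by auto
qed

lemma decomp_imp:
  assumes "decomp V fs"
  shows "subspace V" "\<forall>f\<in>set fs. lead_coeff f = 1" "finite V" "card V = CARD('a) ^ sum_list (map degree fs)"
proof -
  have "subspace V \<and> (\<forall>f\<in>set fs. lead_coeff f = 1) \<and> finite V \<and> card V = CARD('a) ^ sum_list (map degree fs)"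
    using assms
  proof induction
    case decomp_Nil
    show ?case by (simp add: subspace_single_0)
  next
    case (decomp_Cons W fs f v V)
    note img = cyclic_sum_image[OF decomp_Cons(3-5)]
    have "subspace V"
    proof (rule subspaceI)
      show "0 \<in> V" using img(1)[OF subspace_0[OF decomp_Cons(2)], of 0] by simp
      show "x + y \<in> V" if xy: "x \<in> V" "y \<in> V" for x y
      proof -
        obtain p w where "w \<in> W" "x = act p v + w" using img(2)[OF xy(1)] by blast
        moreover obtain r u where "u \<in> W" "y = act r v + u" using img(2)[OF xy(2)] by blast
        ultimately show ?thesis
          using img(1)[OF subspace_add[OF decomp_Cons(2), of w u], of "p + r"]
          by (simp add: scale_left_distrib add_ac)
      qed
      show "act c x \<in> V" if x: "x \<in> V" for c x
      proof -
        obtain p w where "w \<in> W" "x = act p v + w" using img(2)[OF x] by blast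
        thus ?thesis using img(1)[OF subspace_scale[OF decomp_Cons(2), of w c], of "c * p"]
          by (simp add: scale_right_distrib)
      qed
    qed
    moreover have "finite V" using bij_betw_finite[OF decomp_Cons(5)] decomp_Cons.IH by simp
    moreover have "card V = CARD('a) ^ (degree f + sum_list (map degree fs))"
      using bij_betw_same_card[OF decomp_Cons(5)] decomp_Cons.IH
      by (simp add: card_cartesian_product card_polys power_add)
    ultimately show ?case using decomp_Cons by simp
  qed
  thus "subspace V" "\<forall>f\<in>set fs. lead_coeff f = 1" "finite V" "card V = CARD('a) ^ sum_list (map degree fs)"
    by simp_all
qed

text \<open>\<open>ann_count g f\<close> counts the elements of \<open>F[x]/(f)\<close> killed by
  \<open>g\<close>, and torsion is multiplicative over direct sums. The left side does not mention
  the decomposition, which is what yields uniqueness.\<close>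

lemma card_annihilated:
  assumes "decomp V fs"
  shows "card {u \<in> V. act g u = 0} = (\<Prod>f\<leftarrow>fs. ann_count g f)"
  using assms
proof induction
  case decomp_Nil
  have "{u \<in> {0}. act g u = 0} = {0}" by auto
  thus ?case by simp
next
  case (decomp_Cons W fs f v V)
  note img = cyclic_sum_image[OF decomp_Cons(3-5)]
  have f0: "f \<noteq> 0" using decomp_Cons(3) by auto
  let ?h = "\<lambda>(p, w). act p v + w"
  let ?A = "{p \<in> polys (degree f). f dvd g * p} \<times> {w \<in> W. act g w = 0}"
  have zero_iff: "act g (act p v + w) = 0 \<longleftrightarrow> f dvd g * p \<and> act g w = 0" if w: "w \<in> W" for p w
  proof -
    have gw: "act g w \<in> W" by (rule subspace_scale[OF decomp_Cons(2) w])
    have eq: "act g (act p v + w) = ?h (g * p mod f, act g w)"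
      by (simp add: scale_right_distrib act_mod[OF decomp_Cons(4)])
    have mem: "(g * p mod f, act g w) \<in> polys (degree f) \<times> W" "(0, 0) \<in> polys (degree f) \<times> W"
      using mod_in_polys[OF f0] gw subspace_0[OF decomp_Cons(2)] by simp_all
    have "act g (act p v + w) = 0 \<longleftrightarrow> ?h (g * p mod f, act g w) = ?h (0, 0)" unfolding eq by simp
    also have "\<dots> \<longleftrightarrow> (g * p mod f, act g w) = (0, 0)"
      using inj_on_eq_iff[OF bij_betw_imp_inj_on[OF decomp_Cons(5)] mem] .
    finally show ?thesis by (simp add: dvd_eq_mod_eq_0)
  qed
  have "bij_betw ?h ?A {u \<in> V. act g u = 0}"
    unfolding bij_betw_def
  proof
    show "inj_on ?h ?A" by (rule inj_on_subset[OF bij_betw_imp_inj_on[OF decomp_Cons(5)]]) auto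
    show "?h ` ?A = {u \<in> V. act g u = 0}"
    proof (intro equalityI subsetI)
      fix u assume "u \<in> ?h ` ?A"
      then obtain p w where "f dvd g * p" "w \<in> W" "act g w = 0" "u = act p v + w" by auto
      thus "u \<in> {u \<in> V. act g u = 0}" using zero_iff[of w p] img(1) by simp
    next
      fix u assume "u \<in> {u \<in> V. act g u = 0}"
      hence u: "u \<in> V" "act g u = 0" by simp_all
      then obtain p w where pw: "p \<in> polys (degree f)" "w \<in> W" "u = act p v + w" using img(2) by blast
      hence "(p, w) \<in> ?A" using zero_iff[of w p] u(2) by simp
      thus "u \<in> ?h ` ?A" using pw(3) by (intro image_eqI[of _ _ "(p, w)"]) simp_all
    qed
  qed
  from bij_betw_same_card[OF this] show ?case
    by (simp add: card_cartesian_product decomp_Cons.IH ann_count_def)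
qed

lemma decomp_unique:
  assumes "decomp V fs" "decomp V gs" "length fs = length gs"
    "sorted_wrt (\<lambda>f g. g dvd f) fs" "sorted_wrt (\<lambda>f g. g dvd f) gs"
  shows "fs = gs"
  using assms decomp_imp(2)[OF assms(1)] decomp_imp(2)[OF assms(2)]
  by (intro chain_unique) (simp_all flip: card_annihilated)

text \<open>The factor 1 contributes the zero module \<open>F[x]/(1)\<close>; padding by it brings
  all lists to a common length.\<close>

lemma decomp_append_ones:
  assumes "decomp V fs"
  shows "decomp V (fs @ replicate k 1)"
  using assms
proof induction
  case decomp_Nil
  have "decomp {0} (replicate k 1)"
  proof (induction k)
    case (Suc k)
    have "bij_betw (\<lambda>(p, w). act p 0 + w) (polys (degree (1 :: 'a poly)) \<times> {0}) {0}"
      by (simp add: bij_betw_def polys_0)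
    from decomp_Cons[OF Suc _ _ _ this] show ?case by (simp add: subspace_single_0)
  qed (simp add: decomp.decomp_Nil)
  thus ?case by simp
next
  case (decomp_Cons W fs f v V)
  from decomp.decomp_Cons[OF decomp_Cons.IH decomp_Cons(2-5)] show ?case by simp
qed

end

section \<open>Module isomorphisms and cyclic decompositions\<close>

definition module_iso_on :: "('a poly \<Rightarrow> 'b \<Rightarrow> 'b) \<Rightarrow> ('a::{field,finite} poly \<Rightarrow> 'c \<Rightarrow> 'c) \<Rightarrow>
    ('b::ab_group_add \<Rightarrow> 'c::ab_group_add) \<Rightarrow> 'b set \<Rightarrow> 'c set \<Rightarrow> bool" where
  "module_iso_on act1 act2 \<phi> V V' \<longleftrightarrow> bij_betw \<phi> V V' \<and>
     (\<forall>x\<in>V. \<forall>y\<in>V. \<phi> (x + y) = \<phi> x + \<phi> y) \<and> (\<forall>p. \<forall>x\<in>V. \<phi> (act1 p x) = act2 p (\<phi> x))"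

text \<open>Generators are sent to generators, one summand at a time.\<close>

lemma decomp_imp_iso:
  assumes "poly_module act1" "poly_module act2"
    and "poly_module.decomp act1 V fs" "poly_module.decomp act2 V' fs"
  shows "\<exists>\<phi>. module_iso_on act1 act2 \<phi> V V'"
proof -
  interpret m1: poly_module act1 by fact
  interpret m2: poly_module act2 by fact
  show ?thesis using assms(3,4)
  proof (induction arbitrary: V')
    case decomp_Nil
    hence "V' = {0}" by (cases rule: m2.decomp.cases) simp_all
    thus ?case by (intro exI[of _ "\<lambda>_. 0"]) (simp add: module_iso_on_def bij_betw_def)
  next
    case (decomp_Cons W fs f v V)
    from decomp_Cons.prems obtain W' v' where W': "m2.decomp W' fs" "m2.subspace W'" "act2 f v' = 0"
      and bij': "bij_betw (\<lambda>(p, w). act2 p v' + w) (polys (degree f) \<times> W') V'"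
      by (cases rule: m2.decomp.cases) simp_all
    obtain \<phi>0 where "module_iso_on act1 act2 \<phi>0 W W'" using decomp_Cons.IH[OF W'(1)] by blast
    hence \<phi>0: "bij_betw \<phi>0 W W'" "\<And>x y. x \<in> W \<Longrightarrow> y \<in> W \<Longrightarrow> \<phi>0 (x + y) = \<phi>0 x + \<phi>0 y"
      "\<And>p x. x \<in> W \<Longrightarrow> \<phi>0 (act1 p x) = act2 p (\<phi>0 x)"
      by (simp_all add: module_iso_on_def)
    let ?P = "polys (degree f) :: 'a poly set"
    let ?h = "\<lambda>(p, w). act1 p v + w" and ?h' = "\<lambda>(p, w). act2 p v' + w"
    have f0: "f \<noteq> 0" using decomp_Cons(3) by auto
    note img = m1.cyclic_sum_image[OF decomp_Cons(3-5)]
    define \<phi> where "\<phi> = ?h' \<circ> map_prod id \<phi>0 \<circ> inv_into (?P \<times> W) ?h"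
    have bij: "bij_betw \<phi> V V'"
      unfolding \<phi>_def
    proof (rule bij_betw_trans[OF _ bij_betw_trans])
      show "bij_betw (inv_into (?P \<times> W) ?h) V (?P \<times> W)" by (rule bij_betw_inv_into[OF decomp_Cons(5)])
      show "bij_betw (map_prod id \<phi>0) (?P \<times> W) (?P \<times> W')" by (rule bij_betw_map_prod) (simp_all add: \<phi>0)
      show "bij_betw ?h' (?P \<times> W') V'" by (rule bij')
    qed
    \<comment> \<open>This holds for every \<open>p\<close>, not only for reduced ones, because
      \<open>f\<close> kills both generators; additivity and compatibility with the action then need
      no reductions.\<close>
    have \<phi>: "\<phi> (act1 p v + w) = act2 p v' + \<phi>0 w" if w: "w \<in> W" for p w
    proof -
      have mem: "(p mod f, w) \<in> ?P \<times> W" using w mod_in_polys[OF f0] by simp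
      have "inv_into (?P \<times> W) ?h (?h (p mod f, w)) = (p mod f, w)"
        by (rule inv_into_f_f[OF bij_betw_imp_inj_on[OF decomp_Cons(5)] mem])
      hence "inv_into (?P \<times> W) ?h (act1 p v + w) = (p mod f, w)" by (simp add: m1.act_mod[OF decomp_Cons(4)])
      thus ?thesis by (simp add: \<phi>_def m2.act_mod[OF W'(3)])
    qed
    have "\<phi> (x + y) = \<phi> x + \<phi> y" if xy: "x \<in> V" "y \<in> V" for x y
    proof -
      obtain p w where pw: "w \<in> W" "x = act1 p v + w" using img(2)[OF xy(1)] by blast
      obtain r u where ru: "u \<in> W" "y = act1 r v + u" using img(2)[OF xy(2)] by blast
      have "x + y = act1 (p + r) v + (w + u)" by (simp add: pw ru m1.scale_left_distrib add_ac)
      hence "\<phi> (x + y) = act2 (p + r) v' + \<phi>0 (w + u)"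
        using \<phi>[OF m1.subspace_add[OF decomp_Cons(2) pw(1) ru(1)], of "p + r"] by simp
      thus ?thesis
        using \<phi>[OF pw(1), of p] \<phi>[OF ru(1), of r] \<phi>0(2)[OF pw(1) ru(1)]
        by (simp add: pw(2) ru(2) m2.scale_left_distrib add_ac)
    qed
    moreover have "\<phi> (act1 c x) = act2 c (\<phi> x)" if x: "x \<in> V" for c x
    proof -
      obtain p w where pw: "w \<in> W" "x = act1 p v + w" using img(2)[OF x] by blast
      have "act1 c x = act1 (c * p) v + act1 c w" by (simp add: pw m1.scale_right_distrib)
      thus ?thesis
        using \<phi>[OF m1.subspace_scale[OF decomp_Cons(2) pw(1)], of "c * p" c] \<phi>[OF pw(1), of p]
          \<phi>0(3)[OF pw(1), of c] by (simp add: pw(2) m2.scale_right_distrib)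
    qed
    ultimately show ?case using bij by (intro exI[of _ \<phi>]) (simp add: module_iso_on_def)
  qed
qed

lemma decomp_iso_transfer:
  assumes "poly_module act1" "poly_module act2"
    and "poly_module.decomp act1 V fs" "module_iso_on act1 act2 \<phi> V V'"
  shows "poly_module.decomp act2 V' fs"
proof -
  interpret m1: poly_module act1 by fact
  interpret m2: poly_module act2 by fact
  have iso0: "\<phi> 0 = 0" if "module_iso_on act1 act2 \<phi> V V'" "0 \<in> V" for V V'
  proof -
    have "\<phi> (0 + 0) = \<phi> 0 + \<phi> 0" using that unfolding module_iso_on_def by blast
    thus ?thesis by simp
  qed
  show ?thesis using assms(3,4)
  proof (induction arbitrary: V')
    case decomp_Nil
    hence "V' = {0}" using iso0[OF decomp_Nil] by (simp add: module_iso_on_def bij_betw_def)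
    thus ?case by (simp add: m2.decomp_Nil)
  next
    case (decomp_Cons W fs f v V)
    note iso = decomp_Cons.prems
    have bij: "bij_betw \<phi> V V'" and add: "\<And>x y. x \<in> V \<Longrightarrow> y \<in> V \<Longrightarrow> \<phi> (x + y) = \<phi> x + \<phi> y"
      and act: "\<And>p x. x \<in> V \<Longrightarrow> \<phi> (act1 p x) = act2 p (\<phi> x)"
      using iso by (simp_all add: module_iso_on_def)
    note img = m1.cyclic_sum_image[OF decomp_Cons(3-5)]
    have subV: "m1.subspace V" by (rule m1.decomp_imp[OF m1.decomp_Cons[OF decomp_Cons(1-5)]])
    have WV: "W \<subseteq> V" using img(1)[of _ 0] by auto
    have vV: "v \<in> V" using img(1)[OF m1.subspace_0[OF decomp_Cons(2)], of 1] by simp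
    have "bij_betw \<phi> W (\<phi> ` W)"
      by (rule inj_on_imp_bij_betw[OF inj_on_subset[OF bij_betw_imp_inj_on[OF bij] WV]])
    hence isoW: "module_iso_on act1 act2 \<phi> W (\<phi> ` W)"
      using add act subsetD[OF WV] by (simp add: module_iso_on_def)
    have "m2.subspace (\<phi> ` W)"
    proof (rule m2.subspaceI)
      show "0 \<in> \<phi> ` W"
        using iso0[OF isoW] m1.subspace_0[OF decomp_Cons(2)] by (intro image_eqI[of _ _ 0]) simp_all
      show "x + y \<in> \<phi> ` W" if xy: "x \<in> \<phi> ` W" "y \<in> \<phi> ` W" for x y
      proof -
        obtain a b where "a \<in> W" "b \<in> W" "x = \<phi> a" "y = \<phi> b" using xy by blast
        thus ?thesis using add[of a b] subsetD[OF WV, of a] subsetD[OF WV, of b] m1.subspace_add[OF decomp_Cons(2), of a b]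
          by (intro image_eqI[of _ _ "a + b"]) simp_all
      qed
      show "act2 c x \<in> \<phi> ` W" if x: "x \<in> \<phi> ` W" for c x
      proof -
        obtain a where "a \<in> W" "x = \<phi> a" using x by blast
        thus ?thesis using act[of a c] subsetD[OF WV, of a] m1.subspace_scale[OF decomp_Cons(2), of a c]
          by (intro image_eqI[of _ _ "act1 c a"]) simp_all
      qed
    qed
    moreover have "act2 f (\<phi> v) = 0"
      using act[OF vV, of f] decomp_Cons(4) iso0[OF iso m1.subspace_0[OF subV]] by simp
    moreover have "bij_betw (\<lambda>(p, w). act2 p (\<phi> v) + w) (polys (degree f) \<times> \<phi> ` W) V'"
    proof -
      let ?P = "polys (degree f) :: 'a poly set"
      have prod: "bij_betw (map_prod id \<phi>) (?P \<times> W) (?P \<times> \<phi> ` W)"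
        using isoW by (intro bij_betw_map_prod) (simp_all add: module_iso_on_def)
      have comp: "bij_betw (\<phi> \<circ> (\<lambda>(p, w). act1 p v + w)) (?P \<times> W) V'"
        by (rule bij_betw_trans[OF decomp_Cons(5) bij])
      have eq: "(\<phi> \<circ> (\<lambda>(p, w). act1 p v + w)) x = ((\<lambda>(p, w). act2 p (\<phi> v) + w) \<circ> map_prod id \<phi>) x"
        if x: "x \<in> ?P \<times> W" for x
      proof -
        obtain p w where pw: "x = (p, w)" "w \<in> W" using x by (cases x) simp
        have "act1 p v \<in> V" by (rule m1.subspace_scale[OF subV vV])
        thus ?thesis using add[of "act1 p v" w] act[OF vV, of p] pw(1) subsetD[OF WV pw(2)] by simp
      qed
      have "bij_betw ((\<lambda>(p, w). act2 p (\<phi> v) + w) \<circ> map_prod id \<phi>) (?P \<times> W) V'"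
        using comp by (subst bij_betw_cong[OF eq, symmetric])
      thus ?thesis by (subst bij_betw_comp_iff[OF prod])
    qed
    ultimately show ?case
      by (intro m2.decomp_Cons[OF decomp_Cons.IH[OF isoW] _ decomp_Cons(3)])
  qed
qed

section \<open>Similarity classes of matrices\<close>

text \<open>The vector \<open>p(T) u\<close>, evaluated by Horner's scheme.\<close>

definition op_act :: "('a::field \<Rightarrow> 'b \<Rightarrow> 'b) \<Rightarrow> ('b \<Rightarrow> 'b) \<Rightarrow> 'a poly \<Rightarrow> 'b \<Rightarrow> 'b::ab_group_add" where
  "op_act s T p u = fold_coeffs (\<lambda>a v. s a u + T v) p 0"

locale lin_op = Vector_Spaces.vector_space s
  for s :: "'a::{field,finite} \<Rightarrow> 'b::ab_group_add \<Rightarrow> 'b" +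
  fixes T :: "'b \<Rightarrow> 'b"
  assumes T_add: "T (x + y) = T x + T y" and T_scale: "T (s c x) = s c (T x)"
begin

abbreviation act where "act \<equiv> op_act s T"

lemma T_0: "T 0 = 0"
  using T_scale[of 0 0] by simp

lemma act_0: "act 0 u = 0"
  by (simp add: op_act_def)

lemma act_pCons: "act (pCons a p) u = s a u + T (act p u)"
proof (cases "a = 0 \<and> p = 0")
  case True
  thus ?thesis by (simp add: act_0 T_0)
qed (auto simp: op_act_def)

lemma act_const: "act [:c:] u = s c u"
  by (simp add: act_pCons act_0 T_0)

lemma act_X: "act [:0, 1:] u = T u"
  by (simp add: act_pCons act_0 T_0)

lemma act_add: "act (p + r) u = act p u + act r u"
proof (induction p r rule: poly_induct2)
  case (pCons a p b r)
  thus ?case by (simp add: act_pCons T_add scale_left_distrib)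
qed (simp add: act_0)

lemma act_smult: "act (Polynomial.smult c p) u = s c (act p u)"
  by (induction p) (simp_all add: act_0 act_pCons T_scale scale_right_distrib)

lemma act_mult: "act (p * r) u = act p (act r u)"
proof (induction p)
  case (pCons a p)
  have "act (pCons a p * r) u = act (Polynomial.smult a r) u + act (pCons 0 (p * r)) u"
    by (simp only: mult_pCons_left act_add)
  thus ?case by (simp add: act_smult act_pCons pCons.IH)
qed (simp add: act_0)

lemma act_right_distrib: "act p (x + y) = act p x + act p y"
  by (induction p) (simp_all add: act_0 act_pCons T_add scale_right_distrib)

lemma poly_module_act: "poly_module act"
proof (unfold_locales)
  show "act 1 x = x" for x by (simp add: one_pCons act_const)
qed (simp_all add: act_add act_right_distrib act_mult)

lemma act_closed:
  assumes "0 \<in> V" "\<And>x y. x \<in> V \<Longrightarrow> y \<in> V \<Longrightarrow> x + y \<in> V" "\<And>c x. x \<in> V \<Longrightarrow> s c x \<in> V"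
    "\<And>x. x \<in> V \<Longrightarrow> T x \<in> V" "x \<in> V"
  shows "act p x \<in> V"
  by (induction p) (use assms in \<open>simp_all add: act_0 act_pCons\<close>)

end

text \<open>The map is required to be linear on \<open>V\<close> only, since it will also be an
  inverse function that is arbitrary outside \<open>V\<close>.\<close>

lemma op_act_intertwine:
  assumes "lin_op s1 T1" "lin_op s2 T2"
    and V: "0 \<in> V" "\<And>x y. x \<in> V \<Longrightarrow> y \<in> V \<Longrightarrow> x + y \<in> V" "\<And>c x. x \<in> V \<Longrightarrow> s1 c x \<in> V"
      "\<And>x. x \<in> V \<Longrightarrow> T1 x \<in> V"
    and \<phi>: "\<And>x y. x \<in> V \<Longrightarrow> y \<in> V \<Longrightarrow> \<phi> (x + y) = \<phi> x + \<phi> y" "\<And>c x. x \<in> V \<Longrightarrow> \<phi> (s1 c x) = s2 c (\<phi> x)"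
      "\<And>x. x \<in> V \<Longrightarrow> \<phi> (T1 x) = T2 (\<phi> x)"
    and x: "x \<in> V"
  shows "\<phi> (op_act s1 T1 p x) = op_act s2 T2 p (\<phi> x)"
proof -
  interpret o1: lin_op s1 T1 by fact
  interpret o2: lin_op s2 T2 by fact
  have cl: "o1.act p x \<in> V" for p by (rule o1.act_closed[OF V x])
  show ?thesis
  proof (induction p)
    case 0
    have "\<phi> (0 + 0) = \<phi> 0 + \<phi> 0" using V(1) by (intro \<phi>(1))
    thus ?case by (simp add: o1.act_0 o2.act_0)
  next
    case (pCons a p)
    have "\<phi> (o1.act (pCons a p) x) = \<phi> (s1 a x) + \<phi> (T1 (o1.act p x))"
      unfolding o1.act_pCons by (rule \<phi>(1)) (use V x cl in simp_all)
    thus ?case using \<phi>(2)[OF x] \<phi>(3)[OF cl] pCons.IH by (simp add: o2.act_pCons)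
  qed
qed

text \<open>Vectors of length \<open>n\<close> are represented by the functions in \<open>fvec n\<close>, because the type of
  vectors of all lengths is not a group.\<close>

definition fscale :: "'a::times \<Rightarrow> (nat \<Rightarrow> 'a) \<Rightarrow> nat \<Rightarrow> 'a" where
  "fscale c u = (\<lambda>i. c * u i)"

definition fvec :: "nat \<Rightarrow> (nat \<Rightarrow> 'a::zero) set" where
  "fvec n = {u. \<forall>i\<ge>n. u i = 0}"

definition mop :: "nat \<Rightarrow> 'a::comm_ring_1 mat \<Rightarrow> (nat \<Rightarrow> 'a) \<Rightarrow> nat \<Rightarrow> 'a" where
  "mop n A u = (\<lambda>i. if i < n then \<Sum>j<n. A $$ (i, j) * u j else 0)"

definition funit :: "nat \<Rightarrow> nat \<Rightarrow> 'a::zero_neq_one" where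
  "funit j = (\<lambda>i. if i = j then 1 else 0)"

lemma vector_space_fscale: "Vector_Spaces.vector_space (fscale :: 'a::field \<Rightarrow> _)"
  by unfold_locales (simp_all add: fscale_def fun_eq_iff algebra_simps)

lemma lin_op_mop: "lin_op fscale (mop n (A :: 'a::{field,finite} mat))"
proof -
  interpret Vector_Spaces.vector_space "fscale :: 'a \<Rightarrow> _" by (rule vector_space_fscale)
  show ?thesis
  proof
    show "mop n A (x + y) = mop n A x + mop n A y" for x y
      by (rule ext) (simp add: mop_def distrib_left sum.distrib)
    show "mop n A (fscale c x) = fscale c (mop n A x)" for c x
      by (rule ext) (simp add: mop_def fscale_def sum_distrib_left mult.left_commute)
  qed
qed

lemma fvec_closed:
  "0 \<in> fvec n" "x \<in> fvec n \<Longrightarrow> y \<in> fvec n \<Longrightarrow> x + y \<in> fvec n" "x \<in> fvec n \<Longrightarrow> fscale c x \<in> fvec n"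
  "mop n A z \<in> fvec n"
  for x y z :: "nat \<Rightarrow> 'a::comm_ring_1"
  by (simp_all add: fvec_def fscale_def mop_def)

lemma bij_betw_fvec: "bij_betw (vec n) (fvec n) (carrier_vec n)"
proof (rule bij_betw_byWitness[where f' = "\<lambda>v i. if i < n then v $ i else 0"])
  show "\<forall>u\<in>fvec n. (\<lambda>i. if i < n then vec n u $ i else 0) = u"
    by (intro ballI ext) (simp add: fvec_def)
  show "\<forall>v\<in>carrier_vec n. vec n (\<lambda>i. if i < n then v $ i else 0) = v"
    by (intro ballI eq_vecI) simp_all
qed (simp_all add: image_subset_iff fvec_def)

lemma finite_fvec: "finite (fvec n :: (nat \<Rightarrow> 'a::{zero,finite}) set)"
  using bij_betw_finite[OF bij_betw_fvec[of n, where ?'a = 'a]] by simp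

lemma card_fvec: "card (fvec n :: (nat \<Rightarrow> 'a::{zero,finite}) set) = CARD('a) ^ n"
  using bij_betw_same_card[OF bij_betw_fvec[of n, where ?'a = 'a]] by (simp add: card_carrier_vec)

lemma mop_mult:
  assumes "A \<in> carrier_mat n n" "B \<in> carrier_mat n n"
  shows "mop n (A * B) u = mop n A (mop n B u)"
proof
  fix i
  show "mop n (A * B) u i = mop n A (mop n B u) i"
  proof (cases "i < n")
    case True
    have "(\<Sum>j<n. (A * B) $$ (i, j) * u j) = (\<Sum>j<n. (\<Sum>l<n. A $$ (i, l) * B $$ (l, j)) * u j)"
    proof (rule sum.cong)
      fix j assume "j \<in> {..<n}"
      thus "(A * B) $$ (i, j) * u j = (\<Sum>l<n. A $$ (i, l) * B $$ (l, j)) * u j"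
        using mult_mat_index[OF assms True, of j] by simp
    qed simp
    also have "\<dots> = (\<Sum>l<n. \<Sum>j<n. A $$ (i, l) * (B $$ (l, j) * u j))"
      unfolding sum_distrib_right by (subst sum.swap) (simp only: mult.assoc)
    finally show ?thesis using True by (simp add: mop_def sum_distrib_left)
  qed (simp add: mop_def)
qed

lemma mop_one:
  assumes "u \<in> fvec n"
  shows "mop n (1\<^sub>m n) u = u"
proof
  fix i
  show "mop n (1\<^sub>m n) u i = u i"
  proof (cases "i < n")
    case True
    hence "(\<Sum>j<n. 1\<^sub>m n $$ (i, j) * u j) = (\<Sum>j<n. if j = i then u i else 0)"
      by (intro sum.cong) simp_all
    thus ?thesis using True by (simp add: mop_def)
  qed (use assms in \<open>simp add: mop_def fvec_def\<close>)
qed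

lemma funit_in_fvec: "j < n \<Longrightarrow> funit j \<in> fvec n"
  by (simp add: funit_def fvec_def)

lemma mop_funit: "j < n \<Longrightarrow> i < n \<Longrightarrow> mop n A (funit j) i = A $$ (i, j)"
proof -
  assume ij: "j < n" "i < n"
  have "(\<Sum>l<n. A $$ (i, l) * funit j l) = (\<Sum>l<n. if l = j then A $$ (i, j) else 0)"
    by (intro sum.cong) (simp_all add: funit_def)
  thus ?thesis using ij by (simp add: mop_def)
qed

lemma mop_eqD:
  assumes "A \<in> carrier_mat n n" "B \<in> carrier_mat n n" "\<And>u. u \<in> fvec n \<Longrightarrow> mop n A u = mop n B u"
  shows "A = B"
proof (rule eq_matI)
  fix i j assume "i < dim_row B" "j < dim_col B"
  hence ij: "j < n" "i < n" using assms(2) by simp_all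
  show "A $$ (i, j) = B $$ (i, j)"
    using mop_funit[OF ij, of A] mop_funit[OF ij, of B] assms(3)[OF funit_in_fvec[OF ij(1)]] by simp
qed (use assms in simp_all)

lemma sum_fun_apply: "(\<Sum>j\<in>J. F j) i = (\<Sum>j\<in>J. F j i)" for F :: "'c \<Rightarrow> 'd \<Rightarrow> 'e::comm_monoid_add"
  by (induction J rule: infinite_finite_induct) simp_all

lemma fvec_expand:
  assumes u: "u \<in> (fvec n :: (nat \<Rightarrow> 'a::comm_ring_1) set)"
  shows "u = (\<Sum>j<n. fscale (u j) (funit j))"
proof
  fix i
  have "(\<Sum>j<n. fscale (u j) (funit j)) i = (\<Sum>j<n. fscale (u j) (funit j) i)" by (rule sum_fun_apply)
  also have "\<dots> = (\<Sum>j<n. if j = i then u i else 0)" by (intro sum.cong) (simp_all add: fscale_def funit_def)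
  also have "\<dots> = u i" using u by (simp add: fvec_def)
  finally show "u i = (\<Sum>j<n. fscale (u j) (funit j)) i" ..
qed

lemma linear_eq_mop:
  fixes \<phi> :: "(nat \<Rightarrow> 'a::comm_ring_1) \<Rightarrow> nat \<Rightarrow> 'a"
  assumes \<phi>: "\<And>x y. x \<in> fvec n \<Longrightarrow> y \<in> fvec n \<Longrightarrow> \<phi> (x + y) = \<phi> x + \<phi> y"
      "\<And>c x. x \<in> fvec n \<Longrightarrow> \<phi> (fscale c x) = fscale c (\<phi> x)" "\<And>x. x \<in> fvec n \<Longrightarrow> \<phi> x \<in> fvec n"
    and u: "u \<in> fvec n"
  shows "\<phi> u = mop n (mat n n (\<lambda>(i, j). \<phi> (funit j) i)) u"
proof
  fix i
  have \<phi>0: "\<phi> 0 = 0"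
  proof -
    have "\<phi> (0 + 0) = \<phi> 0 + \<phi> 0" by (rule \<phi>(1)) (simp_all add: fvec_closed)
    thus ?thesis by simp
  qed
  have sum: "(\<Sum>j\<in>J. fscale (u j) (funit j)) \<in> fvec n \<and>
     \<phi> (\<Sum>j\<in>J. fscale (u j) (funit j)) = (\<Sum>j\<in>J. fscale (u j) (\<phi> (funit j)))" if "J \<subseteq> {..<n}" for J
    using finite_subset[OF that finite_lessThan] that
  proof (induction J)
    case (insert j J)
    hence j: "funit j \<in> (fvec n :: (nat \<Rightarrow> 'a) set)" by (intro funit_in_fvec) simp
    from insert have IH: "(\<Sum>j\<in>J. fscale (u j) (funit j)) \<in> fvec n"
      "\<phi> (\<Sum>j\<in>J. fscale (u j) (funit j)) = (\<Sum>j\<in>J. fscale (u j) (\<phi> (funit j)))" by simp_all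
    have j': "fscale (u j) (funit j) \<in> fvec n" by (rule fvec_closed(3)[OF j])
    show ?case
      unfolding sum.insert[OF insert(1,2)] \<phi>(1)[OF j' IH(1)] \<phi>(2)[OF j] IH(2)
      by (intro conjI fvec_closed(2)[OF j' IH(1)] refl)
  qed (simp add: fvec_closed \<phi>0)
  have "\<phi> u i = \<phi> (\<Sum>j<n. fscale (u j) (funit j)) i" using fvec_expand[OF u] by simp
  also have "\<dots> = (\<Sum>j<n. fscale (u j) (\<phi> (funit j))) i" using sum[of "{..<n}"] by simp
  also have "\<dots> = (\<Sum>j<n. fscale (u j) (\<phi> (funit j)) i)" by (rule sum_fun_apply)
  also have "\<dots> = mop n (mat n n (\<lambda>(i, j). \<phi> (funit j) i)) u i"
  proof (cases "i < n")
    case True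
    thus ?thesis by (simp add: mop_def fscale_def mult.commute)
  next
    case False
    have "\<phi> (funit j) i = 0" if "j < n" for j
      using \<phi>(3)[OF funit_in_fvec[OF that]] False by (simp add: fvec_def)
    thus ?thesis using False by (simp add: mop_def fscale_def)
  qed
  finally show "\<phi> u i = mop n (mat n n (\<lambda>(i, j). \<phi> (funit j) i)) u i" .
qed

abbreviation mact :: "nat \<Rightarrow> 'a::{field,finite} mat \<Rightarrow> 'a poly \<Rightarrow> (nat \<Rightarrow> 'a) \<Rightarrow> nat \<Rightarrow> 'a" where
  "mact n A \<equiv> op_act fscale (mop n A)"

section \<open>Invariant factors of a matrix\<close>

definition has_chain :: "nat \<Rightarrow> 'a::{field,finite} mat \<Rightarrow> 'a poly list \<Rightarrow> bool" where
  "has_chain n A fs \<longleftrightarrow> poly_module.decomp (mact n A) (fvec n) fs"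

text \<open>Later members divide earlier ones. The length is fixed and entries 1 are allowed: this
  makes the chain of a matrix unique and permits a recursion on the length, the case needed in the
  end being \<open>r = n\<close>.\<close>

definition factor_chains :: "nat \<Rightarrow> nat \<Rightarrow> 'a::field poly list set" where
  "factor_chains r n = {fs. length fs = r \<and> sorted_wrt (\<lambda>f g. g dvd f) fs \<and>
     (\<forall>f\<in>set fs. lead_coeff f = 1) \<and> sum_list (map degree fs) = n}"

lemma poly_module_mact: "poly_module (mact n A)"
  by (rule lin_op.poly_module_act[OF lin_op_mop])

text \<open>Nonconstant factors with total degree \<open>n\<close> number at most \<open>n\<close>,
  so padding by 1 reaches length \<open>n\<close>.\<close>

lemma has_chain_exists: "\<exists>fs\<in>factor_chains n n. has_chain n (A :: 'a::{field,finite} mat) fs"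
proof -
  interpret lin_op fscale "mop n A" by (rule lin_op_mop)
  interpret m: poly_module "mact n A" by (rule poly_module_mact)
  have "m.subspace (fvec n)"
    by (rule m.subspaceI) (simp_all add: fvec_closed act_closed[of "fvec n"])
  from m.decomp_exists[OF this finite_fvec] obtain fs where fs: "m.decomp (fvec n) fs"
    "sorted_wrt (\<lambda>f g. g dvd f) fs" "\<forall>f\<in>set fs. degree f > 0" by blast
  have "CARD('a) ^ n = CARD('a) ^ sum_list (map degree fs)"
    using m.decomp_imp(4)[OF fs(1)] by (simp add: card_fvec)
  hence deg: "sum_list (map degree fs) = n" using CARD_field_gt_1[where 'a = 'a] by simp
  have "length xs \<le> sum_list (map degree xs)" if "\<forall>f\<in>set xs. degree f > 0" for xs :: "'a poly list"
    using that by (induction xs) auto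
  hence len: "length fs \<le> n" using fs(3) deg by blast
  let ?gs = "fs @ replicate (n - length fs) 1"
  have "has_chain n A ?gs" unfolding has_chain_def by (rule m.decomp_append_ones[OF fs(1)])
  moreover have "sorted_wrt (\<lambda>f g. g dvd f) (replicate k (1 :: 'a poly))" for k by (induction k) simp_all
  hence "?gs \<in> factor_chains n n"
    using len deg fs(2) m.decomp_imp(2)[OF fs(1)] by (auto simp: factor_chains_def sorted_wrt_append)
  ultimately show ?thesis by blast
qed

lemma has_chain_unique:
  assumes "has_chain n A fs" "has_chain n A gs" "fs \<in> factor_chains n n" "gs \<in> factor_chains n n"
  shows "fs = gs"
proof -
  interpret m: poly_module "mact n A" by (rule poly_module_mact)
  show ?thesis using assms by (intro m.decomp_unique) (simp_all add: has_chain_def factor_chains_def)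
qed

text \<open>A module isomorphism is linear because it respects the action of constants, and it
  intertwines \<open>A\<close> and \<open>B\<close> because it respects the action of
  \<open>x\<close>. Its matrix is the conjugating element.\<close>

lemma has_chain_imp_similar:
  fixes A B :: "'a::{field,finite} mat"
  assumes "has_chain n A fs" "has_chain n B fs" "A \<in> carrier_mat n n" "B \<in> carrier_mat n n"
  shows "\<exists>g\<in>inj_mats n n. g * A = B * g"
proof -
  interpret oA: lin_op fscale "mop n A" by (rule lin_op_mop)
  interpret oB: lin_op fscale "mop n B" by (rule lin_op_mop)
  obtain \<phi> where "module_iso_on (mact n A) (mact n B) \<phi> (fvec n) (fvec n)"
    using decomp_imp_iso[OF poly_module_mact poly_module_mact assms(1,2)[unfolded has_chain_def]] by blast
  hence \<phi>: "bij_betw \<phi> (fvec n) (fvec n)" "\<And>x y. x \<in> fvec n \<Longrightarrow> y \<in> fvec n \<Longrightarrow> \<phi> (x + y) = \<phi> x + \<phi> y"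
    "\<And>p x. x \<in> fvec n \<Longrightarrow> \<phi> (mact n A p x) = mact n B p (\<phi> x)"
    by (simp_all add: module_iso_on_def)
  have scale: "\<phi> (fscale c x) = fscale c (\<phi> x)" if "x \<in> fvec n" for c x
    using \<phi>(3)[OF that, of "[:c:]"] by (simp add: oA.act_const oB.act_const)
  have comm: "\<phi> (mop n A x) = mop n B (\<phi> x)" if "x \<in> fvec n" for x
    using \<phi>(3)[OF that, of "[:0, 1:]"] by (simp add: oA.act_X oB.act_X)
  have mem: "\<phi> x \<in> fvec n" if "x \<in> fvec n" for x using bij_betwE[OF \<phi>(1)] that by blast
  define g where "g = mat n n (\<lambda>(i, j). \<phi> (funit j) i)"
  have gc: "g \<in> carrier_mat n n" by (simp add: g_def)
  have g: "mop n g u = \<phi> u" if "u \<in> fvec n" for u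
    unfolding g_def by (rule linear_eq_mop[OF \<phi>(2) scale mem that, symmetric])
  have "g * A = B * g"
  proof (rule mop_eqD)
    fix u :: "nat \<Rightarrow> 'a" assume u: "u \<in> fvec n"
    show "mop n (g * A) u = mop n (B * g) u"
      using mop_mult[OF gc assms(3), of u] mop_mult[OF assms(4) gc, of u] g[OF u] g[OF fvec_closed(4), of A u]
        comm[OF u] by simp
  qed (use gc assms in simp_all)
  moreover have "g \<in> inj_mats n n"
  proof -
    have \<phi>0: "\<phi> 0 = 0"
    proof -
      have "\<phi> (0 + 0) = \<phi> 0 + \<phi> 0" by (rule \<phi>(2)) (simp_all add: fvec_closed)
      thus ?thesis by simp
    qed
    have "v = 0\<^sub>v n" if v: "v \<in> carrier_vec n" "g *\<^sub>v v = 0\<^sub>v n" for v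
    proof -
      define u where "u = (\<lambda>i. if i < n then v $ i else 0)"
      have u: "u \<in> fvec n" by (simp add: u_def fvec_def)
      have "mop n g u = 0"
      proof
        fix i
        show "mop n g u i = 0 i"
        proof (cases "i < n")
          case True
          have "(\<Sum>j<n. g $$ (i, j) * u j) = (\<Sum>j<n. g $$ (i, j) * v $ j)"
            by (intro sum.cong) (simp_all add: u_def)
          thus ?thesis using mult_mat_vec_mat[OF gc v(1) True] True by (simp add: v(2) mop_def)
        qed (simp add: mop_def)
      qed
      hence "\<phi> u = \<phi> 0" by (simp add: g[OF u] \<phi>0)
      hence "u = 0" using inj_onD[OF bij_betw_imp_inj_on[OF \<phi>(1)]] u fvec_closed(1) by blast
      moreover have "u i = v $ i" if "i < n" for i using that by (simp add: u_def)
      ultimately have "v $ i = 0" if "i < n" for i using that by (metis zero_fun_apply)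
      thus ?thesis using v(1) by (intro eq_vecI) simp_all
    qed
    thus ?thesis using gc unfolding inj_mats_def by blast
  qed
  ultimately show ?thesis by blast
qed

lemma has_chain_similar:
  fixes A B :: "'a::{field,finite} mat"
  assumes "has_chain n A fs" "g \<in> inj_mats n n" "g * A = B * g" "A \<in> carrier_mat n n" "B \<in> carrier_mat n n"
  shows "has_chain n B fs"
proof -
  obtain h where h: "h \<in> inj_mats n n" "g * h = 1\<^sub>m n" "h * g = 1\<^sub>m n" using inj_mats_inverse[OF assms(2)] .
  note gc = inj_matsD[OF assms(2)] and hc = inj_matsD[OF h(1)]
  interpret oA: lin_op fscale "mop n A" by (rule lin_op_mop)
  interpret og: lin_op fscale "mop n g" by (rule lin_op_mop)
  have "bij_betw (mop n g) (fvec n) (fvec n)"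
  proof (rule bij_betw_byWitness[where f' = "mop n h"])
    show "\<forall>u\<in>fvec n. mop n h (mop n g u) = u"
      by (simp add: mop_mult[OF hc gc, symmetric] h mop_one)
    show "\<forall>u\<in>fvec n. mop n g (mop n h u) = u"
      by (simp add: mop_mult[OF gc hc, symmetric] h mop_one)
  qed (simp_all add: image_subset_iff fvec_closed)
  moreover have "mop n g (mact n A p x) = mact n B p (mop n g x)" if x: "x \<in> fvec n" for p x
  proof (rule op_act_intertwine[OF lin_op_mop lin_op_mop _ _ _ _ _ _ _ x])
    show "mop n g (mop n A u) = mop n B (mop n g u)" for u
      by (simp add: mop_mult[OF gc assms(4), symmetric] mop_mult[OF assms(5) gc, symmetric] assms(3))
  qed (rule fvec_closed og.T_add og.T_scale | assumption)+
  ultimately have "module_iso_on (mact n A) (mact n B) (mop n g) (fvec n) (fvec n)"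
    unfolding module_iso_on_def using og.T_add by blast
  from decomp_iso_transfer[OF poly_module_mact poly_module_mact assms(1)[unfolded has_chain_def] this]
  show ?thesis by (simp add: has_chain_def)
qed

text \<open>Coordinates with respect to a basis of \<open>V\<close> carry the operator over to a
  matrix. The basis has \<open>n\<close> elements because the decomposition gives \<open>V\<close>
  exactly \<open>q^n\<close> elements.\<close>

lemma decomp_imp_has_chain:
  assumes "lin_op s T" and V: "\<And>c x. x \<in> V \<Longrightarrow> s c x \<in> V" "\<And>x. x \<in> V \<Longrightarrow> T x \<in> V"
    and dec: "poly_module.decomp (op_act s T) V fs" and n: "sum_list (map degree fs) = n"
  shows "\<exists>A\<in>carrier_mat n n. has_chain n (A :: 'a::{field,finite} mat) fs"
proof -
  interpret o: lin_op s T by fact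
  interpret m: poly_module "op_act s T" by (rule o.poly_module_act)
  note imp = m.decomp_imp[OF dec]
  have V0: "0 \<in> V" and Vadd: "\<And>x y. x \<in> V \<Longrightarrow> y \<in> V \<Longrightarrow> x + y \<in> V"
    by (rule m.subspace_0[OF imp(1)], rule m.subspace_add[OF imp(1)])
  have subV: "o.subspace V" by (rule o.subspaceI[OF V0 Vadd V(1)])
  obtain B where B: "B \<subseteq> V" "o.independent B" "V \<subseteq> o.span B"
    by (rule o.maximal_independent_subset[of V])
  have finB: "finite B" using B(1) imp(3) by (rule finite_subset)
  have spanB: "o.span B = V" using B(3) o.span_minimal[OF B(1) subV] by blast
  obtain b where b: "bij_betw b {0..<card B} B" using ex_bij_betw_nat_finite[OF finB] by blast
  define k where "k = card B"
  have b: "bij_betw b {..<k} B" using b by (simp add: k_def atLeast0LessThan)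
  define \<phi> where "\<phi> u = (\<Sum>j<k. s (u j) (b j))" for u :: "nat \<Rightarrow> 'a"
  have bV: "b j \<in> V" if "j < k" for j using bij_betwE[OF b] that B(1) by blast
  have \<phi>add: "\<phi> (x + y) = \<phi> x + \<phi> y" for x y
    by (simp add: \<phi>_def o.scale_left_distrib sum.distrib)
  have \<phi>scale: "\<phi> (fscale c x) = s c (\<phi> x)" for c x
    by (simp add: \<phi>_def fscale_def o.scale_sum_right)
  have \<phi>V: "\<phi> u \<in> V" for u
    unfolding \<phi>_def by (rule o.subspace_sum[OF subV]) (use V bV in simp)
  have inj: "inj_on \<phi> (fvec k)"
  proof (rule inj_onI)
    fix x y :: "nat \<Rightarrow> 'a" assume xy: "x \<in> fvec k" "y \<in> fvec k" "\<phi> x = \<phi> y"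
    define c where "c e = (x (inv_into {..<k} b e) - y (inv_into {..<k} b e))" for e
    have cb: "c (b j) = x j - y j" if "j < k" for j
      using inv_into_f_f[OF bij_betw_imp_inj_on[OF b], of j] that by (simp add: c_def)
    have "(\<Sum>e\<in>B. s (c e) e) = (\<Sum>j<k. s (c (b j)) (b j))"
      by (rule sum.reindex_bij_betw[OF b, symmetric])
    also have "\<dots> = (\<Sum>j<k. s (x j) (b j) - s (y j) (b j))"
      by (intro sum.cong) (simp_all add: cb o.scale_left_diff_distrib)
    also have "\<dots> = 0" using xy(3) by (simp add: sum_subtractf \<phi>_def)
    finally have sum0: "(\<Sum>e\<in>B. s (c e) e) = 0" .
    have "x j = y j" if "j < k" for j
    proof -
      have "b j \<in> B" using bij_betwE[OF b] that by blast
      hence "c (b j) = 0" using o.independentD[OF B(2) finB subset_refl sum0] by blast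
      thus ?thesis using cb[OF that] by simp
    qed
    moreover have "x j = y j" if "\<not> j < k" for j using xy(1,2) that by (simp add: fvec_def)
    ultimately show "x = y" by (intro ext) blast
  qed
  have surj: "\<phi> ` fvec k = V"
  proof (intro equalityI subsetI)
    fix v assume "v \<in> V"
    hence "v \<in> o.span B" by (simp add: spanB)
    then obtain c where c: "v = (\<Sum>e\<in>B. s (c e) e)" unfolding o.span_finite[OF finB] by blast
    define u where "u j = (if j < k then c (b j) else 0)" for j
    have "v = (\<Sum>j<k. s (c (b j)) (b j))" unfolding c by (rule sum.reindex_bij_betw[OF b, symmetric])
    also have "\<dots> = \<phi> u" unfolding \<phi>_def by (intro sum.cong) (simp_all add: u_def)
    finally have "v = \<phi> u" .
    moreover have "u \<in> fvec k" by (simp add: fvec_def u_def)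
    ultimately show "v \<in> \<phi> ` fvec k" by blast
  qed (use \<phi>V in blast)
  have bij: "bij_betw \<phi> (fvec k) V" using inj surj by (simp add: bij_betw_def)
  have "CARD('a) ^ k = CARD('a) ^ n" using bij_betw_same_card[OF bij] imp(4) n by (simp add: card_fvec)
  hence kn: "k = n" using CARD_field_gt_1[where 'a = 'a] by simp
  define \<psi> where "\<psi> = inv_into (fvec n) \<phi>"
  have \<psi>bij: "bij_betw \<psi> V (fvec n)" unfolding \<psi>_def kn[symmetric] by (rule bij_betw_inv_into[OF bij])
  have \<psi>V: "\<psi> v \<in> fvec n" if "v \<in> V" for v using bij_betwE[OF \<psi>bij] that by blast
  have \<phi>\<psi>: "\<phi> (\<psi> v) = v" if "v \<in> V" for v
  proof -
    have "v \<in> \<phi> ` fvec n" using that surj unfolding kn by simp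
    thus ?thesis unfolding \<psi>_def by (rule f_inv_into_f)
  qed
  have \<psi>\<phi>: "\<psi> (\<phi> u) = u" if "u \<in> fvec n" for u
    unfolding \<psi>_def by (rule inv_into_f_f) (use that inj kn in simp_all)
  have \<psi>add: "\<psi> (x + y) = \<psi> x + \<psi> y" if "x \<in> V" "y \<in> V" for x y
    using \<psi>\<phi>[OF fvec_closed(2)[OF \<psi>V[OF that(1)] \<psi>V[OF that(2)]]] unfolding \<phi>add by (simp only: \<phi>\<psi> that)
  have \<psi>scale: "\<psi> (s c x) = fscale c (\<psi> x)" if "x \<in> V" for c x
    using \<psi>\<phi>[OF fvec_closed(3)[OF \<psi>V[OF that], of c]] unfolding \<phi>scale by (simp only: \<phi>\<psi> that)
  define \<tau> where "\<tau> u = \<psi> (T (\<phi> u))" for u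
  define A where "A = mat n n (\<lambda>(i, j). \<tau> (funit j) i)"
  have TV: "T (\<phi> u) \<in> V" for u by (rule V(2)[OF \<phi>V])
  have \<tau>: "\<tau> u = mop n A u" if "u \<in> fvec n" for u
    unfolding A_def
  proof (rule linear_eq_mop[OF _ _ _ that])
    show "\<tau> (x + y) = \<tau> x + \<tau> y" for x y
      unfolding \<tau>_def \<phi>add o.T_add by (rule \<psi>add[OF TV TV])
    show "\<tau> (fscale c x) = fscale c (\<tau> x)" for c x
      unfolding \<tau>_def \<phi>scale o.T_scale by (rule \<psi>scale[OF TV])
    show "\<tau> x \<in> fvec n" for x unfolding \<tau>_def by (rule \<psi>V[OF TV])
  qed
  have \<psi>T: "\<psi> (T x) = mop n A (\<psi> x)" if "x \<in> V" for x
    using \<tau>[OF \<psi>V[OF that]] by (simp only: \<tau>_def \<phi>\<psi>[OF that])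
  have "\<psi> (op_act s T p x) = mact n A p (\<psi> x)" if "x \<in> V" for p x
    by (rule op_act_intertwine[OF assms(1) lin_op_mop V0 Vadd V \<psi>add \<psi>scale \<psi>T that])
  hence "module_iso_on (op_act s T) (mact n A) \<psi> V (fvec n)"
    using \<psi>bij \<psi>add by (simp only: module_iso_on_def) simp
  from decomp_iso_transfer[OF o.poly_module_act poly_module_mact dec this]
  have "has_chain n A fs" by (simp only: has_chain_def)
  moreover have "A \<in> carrier_mat n n" by (simp add: A_def)
  ultimately show ?thesis by blast
qed

text \<open>The module \<open>F[x]/(f\<^sub>1) \<oplus> \<dots> \<oplus> F[x]/(f\<^sub>r)\<close> is realised on sequences of polynomials,
  with \<open>x\<close> acting by \<open>quot_shift\<close>; \<open>quot_vecs k\<close> is the sum of the components from \<open>k\<close> on.\<close>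

definition quot_shift :: "'a::field poly list \<Rightarrow> (nat \<Rightarrow> 'a poly) \<Rightarrow> nat \<Rightarrow> 'a poly" where
  "quot_shift fs w = (\<lambda>i. if i < length fs then ([:0, 1:] * w i) mod fs ! i else 0)"

definition quot_vecs :: "'a::field poly list \<Rightarrow> nat \<Rightarrow> (nat \<Rightarrow> 'a poly) set" where
  "quot_vecs fs k = {w. \<forall>i. if k \<le> i \<and> i < length fs then w i \<in> polys (degree (fs ! i)) else w i = 0}"

definition pscale :: "'a::comm_semiring_0 \<Rightarrow> (nat \<Rightarrow> 'a poly) \<Rightarrow> nat \<Rightarrow> 'a poly" where
  "pscale c w = (\<lambda>i. Polynomial.smult c (w i))"

lemma lin_op_quot_shift: "lin_op pscale (quot_shift (fs :: 'a::{field,finite} poly list))"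
proof unfold_locales
  show "quot_shift fs (x + y) = quot_shift fs x + quot_shift fs y" for x y
  proof
    fix i
    have "([:0, 1:] * (x i + y i)) mod fs ! i = ([:0, 1:] * x i) mod fs ! i + ([:0, 1:] * y i) mod fs ! i"
      by (simp only: distrib_left poly_mod_add_left)
    thus "quot_shift fs (x + y) i = (quot_shift fs x + quot_shift fs y) i" by (simp add: quot_shift_def)
  qed
  show "quot_shift fs (pscale c x) = pscale c (quot_shift fs x)" for c x
    by (rule ext) (simp add: quot_shift_def pscale_def mod_smult_left flip: smult_pCons)
qed (simp_all add: pscale_def fun_eq_iff smult_add_right smult_add_left)

lemma quot_vecs_closed:
  "0 \<in> quot_vecs fs k" "x \<in> quot_vecs fs k \<Longrightarrow> y \<in> quot_vecs fs k \<Longrightarrow> x + y \<in> quot_vecs fs k"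
  "x \<in> quot_vecs fs k \<Longrightarrow> pscale c x \<in> quot_vecs fs k"
proof -
  show "0 \<in> quot_vecs fs k" by (simp add: quot_vecs_def)
  show "x + y \<in> quot_vecs fs k" if "x \<in> quot_vecs fs k" "y \<in> quot_vecs fs k"
    unfolding quot_vecs_def
  proof (intro CollectI allI)
    fix i
    show "if k \<le> i \<and> i < length fs then (x + y) i \<in> polys (degree (fs ! i)) else (x + y) i = 0"
      using that by (auto simp: quot_vecs_def polys_add dest!: spec[of _ i])
  qed
  show "pscale c x \<in> quot_vecs fs k" if "x \<in> quot_vecs fs k"
    unfolding quot_vecs_def
  proof (intro CollectI allI)
    fix i
    show "if k \<le> i \<and> i < length fs then pscale c x i \<in> polys (degree (fs ! i)) else pscale c x i = 0"
      using that by (auto simp: quot_vecs_def pscale_def polys_def dest!: spec[of _ i])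
  qed
qed

lemma quot_act_apply:
  fixes fs :: "'a::{field,finite} poly list"
  assumes w: "w \<in> quot_vecs fs 0" and i: "i < length fs"
  shows "op_act pscale (quot_shift fs) p w i = (p * w i) mod fs ! i"
proof -
  interpret o: lin_op pscale "quot_shift fs" by (rule lin_op_quot_shift)
  have wi: "w i mod fs ! i = w i"
    using w i by (auto simp: quot_vecs_def intro!: polys_mod_eq dest!: spec[of _ i])
  show ?thesis
  proof (induction p)
    case (pCons a p)
    have "o.act (pCons a p) w i = Polynomial.smult a (w i) + ([:0, 1:] * (p * w i mod fs ! i)) mod fs ! i"
      using i by (simp add: o.act_pCons pscale_def quot_shift_def pCons.IH)
    also have "([:0, 1:] * (p * w i mod fs ! i)) mod fs ! i = ([:0, 1:] * (p * w i)) mod fs ! i"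
      by (rule mod_mult_right_eq)
    also have "Polynomial.smult a (w i) = Polynomial.smult a (w i) mod fs ! i" by (simp add: mod_smult_left wi)
    also have "Polynomial.smult a (w i) mod fs ! i + ([:0, 1:] * (p * w i)) mod fs ! i
        = (Polynomial.smult a (w i) + [:0, 1:] * (p * w i)) mod fs ! i" by (rule poly_mod_add_left[symmetric])
    also have "Polynomial.smult a (w i) + [:0, 1:] * (p * w i) = pCons a p * w i" by simp
    finally show ?case .
  qed (simp add: o.act_0)
qed

text \<open>Downward induction on \<open>k\<close>: component \<open>k\<close> is cyclic, generated
  by the residue of 1, and the later components form its complement.\<close>

lemma quot_vecs_decomp:
  fixes fs :: "'a::{field,finite} poly list"
  assumes monic: "\<forall>f\<in>set fs. lead_coeff f = 1" and k: "k \<le> length fs"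
  shows "poly_module.decomp (op_act pscale (quot_shift fs)) (quot_vecs fs k) (drop k fs)"
proof -
  interpret o: lin_op pscale "quot_shift fs" by (rule lin_op_quot_shift)
  interpret m: poly_module "op_act pscale (quot_shift fs)" by (rule o.poly_module_act)
  have out: "w i = 0" if "w \<in> quot_vecs fs k" "i < k \<or> i \<ge> length fs" for w i k
    using that by (auto simp: quot_vecs_def split: if_splits dest!: spec[of _ i])
  have inn: "w i \<in> polys (degree (fs ! i))" if "w \<in> quot_vecs fs k" "k \<le> i" "i < length fs" for w i k
    using that by (auto simp: quot_vecs_def split: if_splits dest!: spec[of _ i])
  have mono: "w \<in> quot_vecs fs 0" if w: "w \<in> quot_vecs fs k" for w k
    unfolding quot_vecs_def
  proof (intro CollectI allI)
    fix i
    show "if 0 \<le> i \<and> i < length fs then w i \<in> polys (degree (fs ! i)) else w i = 0"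
      using out[OF w, of i] inn[OF w, of i] by (cases "i < k") simp_all
  qed
  show ?thesis using k
  proof (induction k rule: inc_induct)
    case base
    have "quot_vecs fs (length fs) = {0}" by (auto simp: quot_vecs_def fun_eq_iff)
    thus ?case by (simp add: m.decomp_Nil)
  next
    case (step k)
    let ?f = "fs ! k"
    have f: "lead_coeff ?f = 1" using monic step.hyps by simp
    hence f0: "?f \<noteq> 0" by auto
    \<comment> \<open>The residue \<open>1 mod ?f\<close> is 0 when \<open>?f = 1\<close>, as the
      zero module requires.\<close>
    define e where "e = (\<lambda>i. if i = k then 1 mod ?f else 0)"
    have e: "e \<in> quot_vecs fs 0"
      using mod_in_polys[OF f0, of 1] step.hyps by (simp add: quot_vecs_def e_def)
    have act_e: "o.act p e = (\<lambda>i. if i = k then p mod ?f else 0)" for p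
    proof
      fix i
      have cl: "o.act p e \<in> quot_vecs fs 0"
      proof (rule o.act_closed[OF quot_vecs_closed])
        fix x assume "x \<in> quot_vecs fs 0"
        show "quot_shift fs x \<in> quot_vecs fs 0"
          unfolding quot_vecs_def
        proof (intro CollectI allI)
          fix i
          have "fs ! i \<noteq> 0" if "i < length fs" using monic nth_mem[OF that] by fastforce
          thus "if 0 \<le> i \<and> i < length fs then quot_shift fs x i \<in> polys (degree (fs ! i)) else quot_shift fs x i = 0"
            by (simp add: quot_shift_def mod_in_polys)
        qed
      qed (simp_all add: e)
      show "o.act p e i = (if i = k then p mod ?f else 0)"
      proof (cases "i < length fs")
        case True
        have "p * (1 mod ?f) mod ?f = p * 1 mod ?f" by (rule mod_mult_right_eq)
        thus ?thesis using quot_act_apply[OF e True, of p] by (simp add: e_def)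
      next
        case False
        thus ?thesis using out[OF cl, of i] step.hyps by simp
      qed
    qed
    have sub: "m.subspace (quot_vecs fs (Suc k))"
    proof (rule m.subspaceI)
      show "o.act c x \<in> quot_vecs fs (Suc k)" if x: "x \<in> quot_vecs fs (Suc k)" for c x
      proof (rule o.act_closed[OF quot_vecs_closed _ x])
        fix y assume y: "y \<in> quot_vecs fs (Suc k)"
        show "quot_shift fs y \<in> quot_vecs fs (Suc k)"
          unfolding quot_vecs_def
        proof (intro CollectI allI)
          fix i
          have "fs ! i \<noteq> 0" if "i < length fs" using monic nth_mem[OF that] by fastforce
          thus "if Suc k \<le> i \<and> i < length fs then quot_shift fs y i \<in> polys (degree (fs ! i)) else quot_shift fs y i = 0"
            using out[OF y, of i] by (simp add: quot_shift_def mod_in_polys)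
        qed
      qed
    qed (simp_all add: quot_vecs_closed)
    have bij: "bij_betw (\<lambda>(p, w). o.act p e + w) (polys (degree ?f) \<times> quot_vecs fs (Suc k)) (quot_vecs fs k)"
    proof (rule bij_betw_byWitness[where f' = "\<lambda>w. (w k, w(k := 0))"])
      have val: "(o.act p e + w) i = (if i = k then p else w i)"
        if "p \<in> polys (degree ?f)" "w \<in> quot_vecs fs (Suc k)" for p w i
        using that out[of w "Suc k" k] by (simp add: act_e polys_mod_eq)
      show "\<forall>x\<in>polys (degree ?f) \<times> quot_vecs fs (Suc k).
          (\<lambda>w. (w k, w(k := 0))) ((\<lambda>(p, w). o.act p e + w) x) = x"
      proof
        fix x :: "'a poly \<times> (nat \<Rightarrow> 'a poly)"
        assume "x \<in> polys (degree ?f) \<times> quot_vecs fs (Suc k)"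
        then obtain p w where x: "x = (p, w)" "p \<in> polys (degree ?f)" "w \<in> quot_vecs fs (Suc k)" by (cases x) simp
        have "(o.act p e + w)(k := 0) = w"
          using val[OF x(2,3)] out[OF x(3), of k] by (intro ext) (simp del: plus_fun_apply)
        thus "(\<lambda>w. (w k, w(k := 0))) ((\<lambda>(p, w). o.act p e + w) x) = x"
          using val[OF x(2,3), of k] x(1) by (simp del: plus_fun_apply)
      qed
      show "\<forall>w\<in>quot_vecs fs k. (\<lambda>(p, w). o.act p e + w) (w k, w(k := 0)) = w"
      proof
        fix w assume w: "w \<in> quot_vecs fs k"
        have wk: "w k mod ?f = w k" using inn[OF w, of k] step.hyps by (simp add: polys_mod_eq)
        have "o.act (w k) e + w(k := 0) = w" by (rule ext) (simp add: act_e wk)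
        thus "(\<lambda>(p, w). o.act p e + w) (w k, w(k := 0)) = w" by simp
      qed
      show "(\<lambda>(p, w). o.act p e + w) ` (polys (degree ?f) \<times> quot_vecs fs (Suc k)) \<subseteq> quot_vecs fs k"
      proof (rule image_subsetI)
        fix x :: "'a poly \<times> (nat \<Rightarrow> 'a poly)"
        assume "x \<in> polys (degree ?f) \<times> quot_vecs fs (Suc k)"
        then obtain p w where x: "x = (p, w)" "p \<in> polys (degree ?f)" "w \<in> quot_vecs fs (Suc k)" by (cases x) simp
        have "o.act p e + w \<in> quot_vecs fs k"
          unfolding quot_vecs_def
        proof (intro CollectI allI)
          fix i
          show "if k \<le> i \<and> i < length fs then (o.act p e + w) i \<in> polys (degree (fs ! i)) else (o.act p e + w) i = 0"
            unfolding val[OF x(2,3)] using x(2) step.hyps out[OF x(3), of i] inn[OF x(3), of i]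
            by (cases "i = k"; cases "i < k"; cases "i < length fs") simp_all
        qed
        thus "(\<lambda>(p, w). o.act p e + w) x \<in> quot_vecs fs k" by (simp add: x(1))
      qed
      show "(\<lambda>w. (w k, w(k := 0))) ` quot_vecs fs k \<subseteq> polys (degree ?f) \<times> quot_vecs fs (Suc k)"
      proof (rule image_subsetI)
        fix w assume w: "w \<in> quot_vecs fs k"
        have "w(k := 0) \<in> quot_vecs fs (Suc k)"
          unfolding quot_vecs_def
        proof (intro CollectI allI)
          fix i
          show "if Suc k \<le> i \<and> i < length fs then (w(k := 0)) i \<in> polys (degree (fs ! i)) else (w(k := 0)) i = 0"
            using out[OF w, of i] inn[OF w, of i]
            by (cases "i = k"; cases "i < k"; cases "i < length fs") simp_all
        qed
        thus "(w k, w(k := 0)) \<in> polys (degree ?f) \<times> quot_vecs fs (Suc k)"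
          using inn[OF w, of k] step.hyps by simp
      qed
    qed
    have "o.act ?f e = 0" by (rule ext) (simp add: act_e)
    from m.decomp_Cons[OF step.IH sub f this bij]
    show ?case using step.hyps by (simp add: Cons_nth_drop_Suc)
  qed
qed

lemma chain_realized:
  fixes fs :: "'a::{field,finite} poly list"
  assumes "fs \<in> factor_chains r n"
  shows "\<exists>A\<in>carrier_mat n n. has_chain n A fs"
proof (rule decomp_imp_has_chain[OF lin_op_quot_shift[of fs]])
  have monic: "\<forall>f\<in>set fs. lead_coeff f = 1" using assms by (simp add: factor_chains_def)
  show "pscale c x \<in> quot_vecs fs 0" if "x \<in> quot_vecs fs 0" for c x
    using that by (rule quot_vecs_closed)
  show "quot_shift fs x \<in> quot_vecs fs 0" if "x \<in> quot_vecs fs 0" for x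
    unfolding quot_vecs_def
  proof (intro CollectI allI)
    fix i
    have "fs ! i \<noteq> 0" if "i < length fs" using monic nth_mem[OF that] by fastforce
    thus "if 0 \<le> i \<and> i < length fs then quot_shift fs x i \<in> polys (degree (fs ! i)) else quot_shift fs x i = 0"
      by (simp add: quot_shift_def mod_in_polys)
  qed
  show "poly_module.decomp (op_act pscale (quot_shift fs)) (quot_vecs fs 0) fs"
    using quot_vecs_decomp[OF monic, of 0] by simp
  show "sum_list (map degree fs) = n" using assms by (simp add: factor_chains_def)
qed

section \<open>Counting chains of monic polynomials\<close>

lemma factor_chains_0: "factor_chains 0 n = (if n = 0 then {[]} else {})"
  by (auto simp: factor_chains_def)

text \<open>The last member divides all others. Dividing it out leaves a chain of length
  \<open>r\<close> and lowers each of the \<open>r + 1\<close> degrees by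
  \<open>degree h\<close>.\<close>

lemma factor_chains_Suc_iff:
  fixes h :: "'a::field poly"
  shows "map ((*) h) gs @ [h] \<in> factor_chains (Suc r) n \<longleftrightarrow>
     lead_coeff h = 1 \<and> Suc r * degree h \<le> n \<and> gs \<in> factor_chains r (n - Suc r * degree h)"
proof (cases "lead_coeff h = 1")
  case True
  hence h0: "h \<noteq> 0" by auto
  have monic: "(\<forall>f\<in>set (map ((*) h) gs). lead_coeff f = 1) \<longleftrightarrow> (\<forall>f\<in>set gs. lead_coeff f = 1)"
    by (simp add: lead_coeff_mult True)
  have dvd: "sorted_wrt (\<lambda>f g. g dvd f) (map ((*) h) gs @ [h]) \<longleftrightarrow> sorted_wrt (\<lambda>f g. g dvd f) gs"
    by (simp add: sorted_wrt_append sorted_wrt_map h0)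
  have deg: "sum_list (map degree (map ((*) h) gs)) = length gs * degree h + sum_list (map degree gs)"
    if "\<forall>f\<in>set gs. lead_coeff f = 1" for gs :: "'a poly list"
    using that
  proof (induction gs)
    case (Cons f gs)
    have "f \<noteq> 0" using Cons.prems by auto
    thus ?case using Cons h0 by (simp add: degree_mult_eq)
  qed simp
  show ?thesis
  proof (cases "length gs = r \<and> (\<forall>f\<in>set gs. lead_coeff f = 1)")
    case True
    have "sum_list (map degree (map ((*) h) gs @ [h])) = Suc r * degree h + sum_list (map degree gs)"
      using deg True by simp
    thus ?thesis using \<open>lead_coeff h = 1\<close> True monic dvd unfolding factor_chains_def by auto
  next
    case False
    thus ?thesis using monic unfolding factor_chains_def by auto
  qed
qed (simp add: factor_chains_def)

lemma factor_chains_Suc_obtain: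
  fixes fs :: "'a::field poly list"
  assumes "fs \<in> factor_chains (Suc r) n"
  obtains h gs where "fs = map ((*) h) gs @ [h]"
proof -
  have "fs \<noteq> []" using assms by (auto simp: factor_chains_def)
  then obtain fs' h where fs: "fs = fs' @ [h]" by (cases fs rule: rev_cases) simp_all
  have "h dvd f" if "f \<in> set fs'" for f
    using assms that by (simp add: factor_chains_def fs sorted_wrt_append)
  hence "map (\<lambda>f. h * (f div h)) fs' = fs'" by (intro map_idI) simp
  hence "map ((*) h) (map (\<lambda>f. f div h) fs') = fs'" by (simp add: o_def)
  hence "fs = map ((*) h) (map (\<lambda>f. f div h) fs') @ [h]" using fs by simp
  thus ?thesis by (rule that)
qed

lemma bij_betw_chains_Suc:
  "bij_betw (\<lambda>(h, gs). map ((*) h) gs @ [h])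
     (SIGMA h:{h :: 'a::field poly. lead_coeff h = 1 \<and> Suc r * degree h \<le> n}. factor_chains r (n - Suc r * degree h))
     (factor_chains (Suc r) n)"
  unfolding bij_betw_def
proof
  show "inj_on (\<lambda>(h, gs). map ((*) h) gs @ [h])
     (SIGMA h:{h :: 'a poly. lead_coeff h = 1 \<and> Suc r * degree h \<le> n}. factor_chains r (n - Suc r * degree h))"
  proof (rule inj_onI, clarsimp)
    fix h :: "'a poly" and gs gs'
    assume h: "lead_coeff h = 1" and eq: "map ((*) h) gs = map ((*) h) gs'"
    have "h \<noteq> 0" using h by auto
    hence "inj ((*) h)" by (auto simp: inj_def)
    thus "gs = gs'" using eq by (simp add: inj_map_eq_map)
  qed
  show "(\<lambda>(h, gs). map ((*) h) gs @ [h]) `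
     (SIGMA h:{h :: 'a poly. lead_coeff h = 1 \<and> Suc r * degree h \<le> n}. factor_chains r (n - Suc r * degree h)) = factor_chains (Suc r) n"
  proof (intro equalityI subsetI)
    fix fs :: "'a poly list" assume fs: "fs \<in> factor_chains (Suc r) n"
    then obtain h gs where hg: "fs = map ((*) h) gs @ [h]" by (rule factor_chains_Suc_obtain)
    have "(h, gs) \<in> (SIGMA h:{h. lead_coeff h = 1 \<and> Suc r * degree h \<le> n}. factor_chains r (n - Suc r * degree h))"
      using fs unfolding hg factor_chains_Suc_iff by simp
    thus "fs \<in> (\<lambda>(h, gs). map ((*) h) gs @ [h]) `
       (SIGMA h:{h. lead_coeff h = 1 \<and> Suc r * degree h \<le> n}. factor_chains r (n - Suc r * degree h))"
      using hg by force
  next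
    fix fs :: "'a poly list"
    assume "fs \<in> (\<lambda>(h, gs). map ((*) h) gs @ [h]) `
       (SIGMA h:{h. lead_coeff h = 1 \<and> Suc r * degree h \<le> n}. factor_chains r (n - Suc r * degree h))"
    then obtain h gs where "fs = map ((*) h) gs @ [h]" "lead_coeff h = 1" "Suc r * degree h \<le> n"
      "gs \<in> factor_chains r (n - Suc r * degree h)" by auto
    thus "fs \<in> factor_chains (Suc r) n" by (simp only: factor_chains_Suc_iff)
  qed
qed

lemma finite_monic_le: "finite {h :: 'a::{field,finite} poly. lead_coeff h = 1 \<and> Suc r * degree h \<le> n}"
proof (rule finite_subset)
  show "{h :: 'a poly. lead_coeff h = 1 \<and> Suc r * degree h \<le> n} \<subseteq> polys (Suc n)"
    by (auto simp: polys_iff)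
qed simp

lemma finite_chains: "finite (factor_chains r n :: 'a::{field,finite} poly list set)"
proof (induction r arbitrary: n)
  case (Suc r)
  have "finite (SIGMA h:{h :: 'a poly. lead_coeff h = 1 \<and> Suc r * degree h \<le> n}.
      (factor_chains r (n - Suc r * degree h) :: 'a poly list set))"
    by (rule finite_SigmaI[OF finite_monic_le Suc.IH])
  from iffD1[OF bij_betw_finite[OF bij_betw_chains_Suc] this] show ?case .
qed (simp add: factor_chains_0)

text \<open>In terms of generating functions in \<open>n\<close>, a further entry multiplies by
  \<open>1 / (1 - q x^(r+1))\<close>.\<close>

lemma card_chains_Suc:
  "card (factor_chains (Suc r) n :: 'a::{field,finite} poly list set)
     = (\<Sum>d | Suc r * d \<le> n. CARD('a) ^ d * card (factor_chains r (n - Suc r * d) :: 'a poly list set))"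
proof -
  let ?H = "{h :: 'a poly. lead_coeff h = 1 \<and> Suc r * degree h \<le> n}"
  let ?c = "\<lambda>d. card (factor_chains r (n - Suc r * d) :: 'a poly list set)"
  have fin: "finite {d. Suc r * d \<le> n}" by (rule finite_subset[of _ "{..n}"]) auto
  have "card (factor_chains (Suc r) n :: 'a poly list set) = (\<Sum>h\<in>?H. ?c (degree h))"
    using bij_betw_same_card[OF bij_betw_chains_Suc[of r n, where 'a = 'a]]
    by (simp only: card_SigmaI[OF finite_monic_le ballI[OF finite_chains]])
  also have "\<dots> = (\<Sum>d\<in>{d. Suc r * d \<le> n}. \<Sum>h\<in>{h \<in> ?H. degree h = d}. ?c (degree h))"
    by (rule sum.group[symmetric, OF finite_monic_le fin]) auto
  also have "\<dots> = (\<Sum>d\<in>{d. Suc r * d \<le> n}. CARD('a) ^ d * ?c d)"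
  proof (rule sum.cong)
    fix d assume "d \<in> {d. Suc r * d \<le> n}"
    hence "{h \<in> ?H. degree h = d} = {h. lead_coeff h = 1 \<and> degree h = d}" by auto
    moreover have "(\<Sum>h\<in>{h :: 'a poly. lead_coeff h = 1 \<and> degree h = d}. ?c (degree h)) = CARD('a) ^ d * ?c d"
      using card_monic[of d, where 'a = 'a] by simp
    ultimately show "(\<Sum>h\<in>{h \<in> ?H. degree h = d}. ?c (degree h)) = CARD('a) ^ d * ?c d" by simp
  qed simp
  finally show ?thesis .
qed

section \<open>Orbit counting for conjugation\<close>

lemma null_mats_0: "null_mats n 0 = (inj_mats n n :: 'a::{field,finite} mat set)"
proof (intro equalityI subsetI)
  fix A :: "'a mat" assume A: "A \<in> null_mats n 0"
  hence Ac: "A \<in> carrier_mat n n" and "card (mat_kernel A) = 1" by (simp_all add: null_mats_def)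
  then obtain x where x: "mat_kernel A = {x}" by (auto simp: card_1_singleton_iff)
  have "A *\<^sub>v 0\<^sub>v n = 0\<^sub>v n" by (rule eq_vecI) (use Ac in simp_all)
  hence "0\<^sub>v n \<in> mat_kernel A" using mat_kernel_iff[OF Ac] by simp
  hence "mat_kernel A = {0\<^sub>v n}" using x by simp
  thus "A \<in> inj_mats n n" using Ac mat_kernel_iff[OF Ac] unfolding inj_mats_def by blast
next
  fix A :: "'a mat" assume A: "A \<in> inj_mats n n"
  note Ac = inj_matsD[OF A]
  have "A *\<^sub>v 0\<^sub>v n = 0\<^sub>v n" by (rule eq_vecI) (use Ac in simp_all)
  hence "mat_kernel A = {0\<^sub>v n}" using A mat_kernel_iff[OF Ac] unfolding inj_mats_def
    by (intro equalityI subsetI) simp_all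
  thus "A \<in> null_mats n 0" using Ac by (simp add: null_mats_def)
qed

text \<open>The elements carrying \<open>B0\<close> to \<open>B\<close> form a coset of the
  stabilizer of \<open>B\<close>, with representative \<open>g0\<close>.\<close>

lemma card_commuting_units:
  fixes B B0 g0 :: "'a::{field,finite} mat"
  assumes B: "B \<in> carrier_mat n n" "B0 \<in> carrier_mat n n" and g0: "g0 \<in> inj_mats n n" "g0 * B0 = B * g0"
  shows "card {A \<in> inj_mats n n. A * B = B * A} = card {g \<in> inj_mats n n. g * B0 = B * g}"
proof (rule bij_betw_same_card)
  obtain h where h: "h \<in> inj_mats n n" "g0 * h = 1\<^sub>m n" "h * g0 = 1\<^sub>m n" using inj_mats_inverse[OF g0(1)] .
  note c = carrier_matD[OF B(1)] carrier_matD[OF B(2)] carrier_matD[OF inj_matsD[OF g0(1)]]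
    carrier_matD[OF inj_matsD[OF h(1)]]
  have hB: "h * B = B0 * h"
  proof -
    have "h * B = h * (B * g0) * h" using c by (simp add: mult_assoc_dim h(2))
    also have "\<dots> = B0 * h" using c by (simp add: g0(2)[symmetric] mult_assoc_dim mult_cancel_dim[OF h(3)])
    finally show ?thesis .
  qed
  show "bij_betw (\<lambda>A. A * g0) {A \<in> inj_mats n n. A * B = B * A} {g \<in> inj_mats n n. g * B0 = B * g}"
  proof (rule bij_betw_byWitness[where f' = "\<lambda>g. g * h"])
    show "\<forall>A\<in>{A \<in> inj_mats n n. A * B = B * A}. A * g0 * h = A"
    proof
      fix A assume "A \<in> {A \<in> inj_mats n n. A * B = B * A}"
      hence "dim_row A = n" "dim_col A = n" using inj_matsD[of A n n] by simp_all
      thus "A * g0 * h = A" using c by (simp add: mult_assoc_dim h(2))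
    qed
    show "\<forall>g\<in>{g \<in> inj_mats n n. g * B0 = B * g}. g * h * g0 = g"
    proof
      fix g assume "g \<in> {g \<in> inj_mats n n. g * B0 = B * g}"
      hence "dim_row g = n" "dim_col g = n" using inj_matsD[of g n n] by simp_all
      thus "g * h * g0 = g" using c by (simp add: mult_assoc_dim h(3))
    qed
    show "(\<lambda>A. A * g0) ` {A \<in> inj_mats n n. A * B = B * A} \<subseteq> {g \<in> inj_mats n n. g * B0 = B * g}"
    proof (rule image_subsetI)
      fix A assume A: "A \<in> {A \<in> inj_mats n n. A * B = B * A}"
      hence d: "dim_row A = n" "dim_col A = n" using inj_matsD[of A n n] by simp_all
      have "A * g0 * B0 = A * B * g0" using c d by (simp add: mult_assoc_dim g0(2))
      also have "\<dots> = B * (A * g0)" using c d A by (simp add: mult_assoc_dim)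
      finally show "A * g0 \<in> {g \<in> inj_mats n n. g * B0 = B * g}" using inj_mats_mult[OF _ g0(1)] A by simp
    qed
    show "(\<lambda>g. g * h) ` {g \<in> inj_mats n n. g * B0 = B * g} \<subseteq> {A \<in> inj_mats n n. A * B = B * A}"
    proof (rule image_subsetI)
      fix g assume g: "g \<in> {g \<in> inj_mats n n. g * B0 = B * g}"
      hence d: "dim_row g = n" "dim_col g = n" using inj_matsD[of g n n] by simp_all
      have "g * h * B = g * B0 * h" using c d by (simp add: mult_assoc_dim hB)
      also have "\<dots> = B * (g * h)" using c d g by (simp add: mult_assoc_dim)
      finally show "g * h \<in> {A \<in> inj_mats n n. A * B = B * A}" using inj_mats_mult[OF _ h(1)] g by simp
    qed
  qed
qed

text \<open>Orbit-stabilizer: each stabilizer has the size of the set of all \<open>g\<close>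
  carrying a fixed \<open>B0\<close> to \<open>B\<close>, and these sets partition the group as
  \<open>B\<close> runs through the orbit.\<close>

lemma orbit_sum:
  fixes fs :: "'a::{field,finite} poly list"
  assumes fs: "fs \<in> factor_chains n n"
  shows "(\<Sum>B\<in>{B \<in> carrier_mat n n. has_chain n B fs}. card {A \<in> inj_mats n n. A * B = B * A})
           = card (inj_mats n n :: 'a mat set)"
proof -
  let ?O = "{B \<in> carrier_mat n n. has_chain n B fs}"
  obtain B0 where B0: "B0 \<in> carrier_mat n n" "has_chain n B0 fs" using chain_realized[OF fs] by blast
  let ?G = "\<lambda>B. {g \<in> inj_mats n n. g * B0 = B * g}"
  have finO: "finite ?O" by (rule finite_subset[of _ "carrier_mat n n"]) auto
  have "(\<Sum>B\<in>?O. card {A \<in> inj_mats n n. A * B = B * A}) = (\<Sum>B\<in>?O. card (?G B))"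
  proof (rule sum.cong)
    fix B assume B: "B \<in> ?O"
    then obtain g where "g \<in> inj_mats n n" "g * B0 = B * g"
      using has_chain_imp_similar[OF B0(2) _ B0(1), of B] by blast
    thus "card {A \<in> inj_mats n n. A * B = B * A} = card (?G B)" using B B0 by (intro card_commuting_units) simp_all
  qed simp
  also have "\<dots> = card (\<Union>B\<in>?O. ?G B)"
  proof (rule card_UN_disjoint[symmetric, OF finO])
    show "\<forall>B\<in>?O. \<forall>B'\<in>?O. B \<noteq> B' \<longrightarrow> ?G B \<inter> ?G B' = {}"
    proof (intro ballI impI, rule ccontr)
      fix B B' assume B: "B \<in> ?O" "B' \<in> ?O" "B \<noteq> B'" "?G B \<inter> ?G B' \<noteq> {}"
      have Bc: "B \<in> carrier_mat n n" "B' \<in> carrier_mat n n" using B(1,2) by simp_all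
      from B(4) obtain g where "g \<in> ?G B" "g \<in> ?G B'" by blast
      hence g: "g \<in> inj_mats n n" "B * g = B' * g" by simp_all
      obtain h where h: "h \<in> inj_mats n n" "g * h = 1\<^sub>m n" by (rule inj_mats_inverse[OF g(1)])
      have c: "dim_col B = n" "dim_col B' = n" "dim_row g = n" "dim_col g = n" "dim_row h = n" "dim_row B = n" "dim_row B' = n"
        using Bc inj_matsD[OF g(1)] inj_matsD[OF h(1)] by simp_all
      have "B * g * h = B' * g * h" using g(2) by simp
      thus False using c B(3) by (simp add: mult_assoc_dim h(2))
    qed
  qed simp
  also have "(\<Union>B\<in>?O. ?G B) = inj_mats n n"
  proof (intro equalityI subsetI)
    fix g :: "'a mat" assume g: "g \<in> inj_mats n n"
    obtain h where h: "h \<in> inj_mats n n" "h * g = 1\<^sub>m n" by (rule inj_mats_inverse[OF g])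
    note c = carrier_matD[OF B0(1)] carrier_matD[OF inj_matsD[OF g]] carrier_matD[OF inj_matsD[OF h(1)]]
    have eq: "g * B0 = g * B0 * h * g" using c by (simp add: mult_assoc_dim h(2))
    have mem: "g * B0 * h \<in> carrier_mat n n" using B0(1) inj_matsD[OF g] inj_matsD[OF h(1)] by simp
    have "has_chain n (g * B0 * h) fs" by (rule has_chain_similar[OF B0(2) g eq B0(1) mem])
    thus "g \<in> (\<Union>B\<in>?O. ?G B)" using mem eq g by (intro UN_I[of "g * B0 * h"]) simp_all
  qed blast
  finally show ?thesis .
qed

lemma card_filter_eq_sum: "finite S \<Longrightarrow> card {x \<in> S. P x} = (\<Sum>x\<in>S. if P x then 1 else 0)"
  by (simp only: card_eq_sum sum.inter_filter)

text \<open>Orbit counting: \<open>GL\<^sub>n\<close> acts on \<open>n \<times> n\<close> matrices by conjugation, and the orbits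
  correspond to the chains of invariant factors.\<close>

lemma cent_sum_0:
  "cent_sum TYPE('a::{field,finite}) n 0
     = card (inj_mats n n :: 'a mat set) * card (factor_chains n n :: 'a poly list set)"
proof -
  let ?M = "carrier_mat n n :: 'a mat set" and ?G = "inj_mats n n :: 'a mat set"
  let ?C = "factor_chains n n :: 'a poly list set"
  let ?O = "\<lambda>fs. {B \<in> ?M. has_chain n B fs}"
  have "cent_sum TYPE('a) n 0 = (\<Sum>A\<in>?G. card {B \<in> ?M. A * B = B * A})"
    unfolding cent_sum_def null_mats_0 cent_def ..
  also have "\<dots> = (\<Sum>A\<in>?G. \<Sum>B\<in>?M. if A * B = B * A then 1 else 0)"
    by (rule sum.cong[OF refl card_filter_eq_sum[OF finite_carrier_mat]])
  also have "\<dots> = (\<Sum>B\<in>?M. \<Sum>A\<in>?G. if A * B = B * A then 1 else 0)" by (rule sum.swap)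
  also have "\<dots> = (\<Sum>B\<in>?M. card {A \<in> ?G. A * B = B * A})"
    by (rule sum.cong[OF refl card_filter_eq_sum[OF finite_inj_mats, symmetric]])
  also have "\<dots> = (\<Sum>B\<in>(\<Union>fs\<in>?C. ?O fs). card {A \<in> ?G. A * B = B * A})"
  proof (rule sum.cong[OF equalityI refl]; rule subsetI)
    fix B assume B: "B \<in> ?M"
    obtain fs where "fs \<in> ?C" "has_chain n B fs" using has_chain_exists[of n B] by blast
    thus "B \<in> (\<Union>fs\<in>?C. ?O fs)" using B by (intro UN_I[of fs]) simp_all
  qed simp
  also have "\<dots>
      = (\<Sum>fs\<in>?C. \<Sum>B\<in>?O fs. card {A \<in> ?G. A * B = B * A})"
  proof (rule sum.UNION_disjoint[OF finite_chains])
    show "\<forall>fs\<in>?C. finite (?O fs)" by simp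
    show "\<forall>fs\<in>?C. \<forall>gs\<in>?C. fs \<noteq> gs \<longrightarrow> ?O fs \<inter> ?O gs = {}"
    proof (intro ballI impI equals0I)
      fix fs gs B assume *: "fs \<in> ?C" "gs \<in> ?C" "fs \<noteq> gs" "B \<in> ?O fs \<inter> ?O gs"
      thus False using has_chain_unique[of n B fs gs] by simp
    qed
  qed
  also have "\<dots> = (\<Sum>fs\<in>?C. card ?G)" by (rule sum.cong[OF refl orbit_sum])
  finally show ?thesis by simp
qed

section \<open>Limits of the recursions\<close>

text \<open>The distance \<open>e\<close> to the fixed point \<open>Y / (1 - c)\<close> satisfies
  \<open>e n <= d n + c * e (n - s)\<close> with \<open>d\<close> tending to 0. It is bounded, and
  after \<open>k\<close> steps only \<open>c^k\<close> times the bound and a small remainder are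
  left.\<close>

lemma contraction_limit:
  fixes x y :: "nat \<Rightarrow> real"
  assumes c: "0 \<le> c" "c < 1" and s: "s > 0" and y: "y \<longlonglongrightarrow> Y"
    and x: "\<And>n. n \<ge> s \<Longrightarrow> x n = y n + c * x (n - s)"
  shows "x \<longlonglongrightarrow> Y / (1 - c)"
proof -
  define e where "e n = \<bar>x n - Y / (1 - c)\<bar>" for n
  define d where "d n = \<bar>y n - Y\<bar>" for n
  have step: "e n \<le> d n + c * e (n - s)" if "n \<ge> s" for n
  proof -
    have "x n - Y / (1 - c) = (y n - Y) + c * (x (n - s) - Y / (1 - c))"
      using x[OF that] c by (simp add: field_simps)
    hence "e n \<le> \<bar>y n - Y\<bar> + \<bar>c * (x (n - s) - Y / (1 - c))\<bar>"
      unfolding e_def by (metis abs_triangle_ineq)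
    thus ?thesis using c by (simp add: e_def d_def abs_mult)
  qed
  have d0: "d \<longlonglongrightarrow> 0" unfolding d_def using y by (simp add: tendsto_rabs_zero_iff LIM_zero_iff)
  hence "Bseq d" by (intro convergent_imp_Bseq convergentI)
  then obtain D where "D > 0" "\<And>n. norm (d n) \<le> D" by (auto simp: Bseq_def)
  hence D: "D > 0" "\<And>n. d n \<le> D" by (simp_all add: d_def)
  \<comment> \<open>The maximum covers the first \<open>s\<close> values, to which the recursion
    does not apply; the summand \<open>D / (1 - c)\<close> is what makes
    \<open>D + c * M <= M\<close>.\<close>
  define M where "M = Max (e ` {..<s}) + D / (1 - c)"
  have M1: "e n \<le> M" if "n < s" for n
  proof -
    have "e n \<le> Max (e ` {..<s})" using that by (intro Max_ge) auto
    moreover have "D / (1 - c) \<ge> 0" using D(1) c by simp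
    ultimately show ?thesis by (simp add: M_def)
  qed
  have M2: "D + c * M \<le> M"
  proof -
    have "e 0 \<le> Max (e ` {..<s})" using s by (intro Max_ge) auto
    hence "0 \<le> Max (e ` {..<s})" unfolding e_def by linarith
    hence "0 \<le> (1 - c) * Max (e ` {..<s})" using c by simp
    moreover have "(1 - c) * M = (1 - c) * Max (e ` {..<s}) + D" using c by (simp add: M_def distrib_left)
    ultimately have "D \<le> (1 - c) * M" by linarith
    thus ?thesis by (simp add: algebra_simps)
  qed
  have eM: "e n \<le> M" for n
  proof (induction n rule: less_induct)
    case (less n)
    show ?case
    proof (cases "n < s")
      case False
      hence "e n \<le> d n + c * e (n - s)" using step by simp
      also have "\<dots> \<le> D + c * M"
        using False s c D(2) less.IH[of "n - s"] by (intro add_mono mult_left_mono) simp_all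
      finally show ?thesis using M2 by simp
    qed (rule M1)
  qed
  have "e \<longlonglongrightarrow> 0"
  proof (rule LIMSEQ_I)
    fix r :: real assume r: "r > 0"
    define h where "h = r / 2"
    have h: "h > 0" using r by (simp add: h_def)
    \<comment> \<open>With \<open>d\<close> below \<open>h * (1 - c)\<close>, the errors accumulated
      along the geometric iteration never exceed \<open>h\<close>.\<close>
    have "h * (1 - c) > 0" using h c by simp
    then obtain N where N: "\<And>n. n \<ge> N \<Longrightarrow> d n < h * (1 - c)"
      using LIMSEQ_D[OF d0, of "h * (1 - c)"] by (auto simp: d_def)
    have est: "e n \<le> c ^ k * M + h" if "n \<ge> N + k * s" for n k
      using that
    proof (induction k arbitrary: n)
      case 0
      thus ?case using eM[of n] h by simp
    next
      case (Suc k)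
      have n: "n \<ge> s" "n - s \<ge> N + k * s" using Suc.prems by simp_all
      have "e n \<le> d n + c * e (n - s)" by (rule step[OF n(1)])
      also have "\<dots> \<le> h * (1 - c) + c * (c ^ k * M + h)"
        using N[of n] Suc.IH[OF n(2)] c Suc.prems by (intro add_mono mult_left_mono) simp_all
      also have "\<dots> = c ^ Suc k * M + h" by (simp add: algebra_simps)
      finally show ?case .
    qed
    have "(\<lambda>k. c ^ k * M) \<longlonglongrightarrow> 0 * M" using c by (intro tendsto_mult LIMSEQ_power_zero tendsto_const) simp_all
    then obtain k where k: "\<bar>c ^ k * M\<bar> < h" using LIMSEQ_D[of "\<lambda>k. c ^ k * M" 0 h] h by fastforce
    show "\<exists>n0. \<forall>n\<ge>n0. norm (e n - 0) < r"
    proof (intro exI[of _ "N + k * s"] allI impI)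
      fix n assume "n \<ge> N + k * s"
      from est[OF this] have "e n < r" using k by (simp add: h_def)
      thus "norm (e n - 0) < r" by (simp add: e_def)
    qed
  qed
  thus ?thesis unfolding e_def by (simp add: tendsto_rabs_zero_iff LIM_zero_iff)
qed

section \<open>Finite and infinite products of \<open>1 - t ^ i\<close>\<close>

locale q_series =
  fixes t :: real
  assumes t: "0 < t" "t < 1"
begin

definition qp :: "nat \<Rightarrow> real" where
  "qp m = (\<Prod>i<m. 1 - t ^ Suc i)"

lemma t_Suc: "0 < t ^ Suc i" "t ^ Suc i < 1"
  using t power_Suc_less_one[of t i] by simp_all

lemma qp_0 [simp]: "qp 0 = 1" and qp_Suc: "qp (Suc m) = qp m * (1 - t ^ Suc m)"
  by (simp_all add: qp_def)

lemma qp_pos: "qp m > 0"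
  by (induction m) (use t_Suc in \<open>simp_all add: qp_Suc del: power_Suc\<close>)

lemma decseq_qp: "decseq qp"
proof (rule decseq_SucI)
  show "qp (Suc n) \<le> qp n" for n
    using mult_left_mono[of "1 - t ^ Suc n" 1 "qp n"] qp_pos[of n] t_Suc(1)[of n] by (simp add: qp_Suc)
qed

lemma convergent_prod_qp: "convergent_prod (\<lambda>i. 1 - t ^ Suc i)"
proof (rule abs_convergent_prod_imp_convergent_prod)
  have "summable (\<lambda>i. t ^ Suc i)" using t by (simp only: summable_Suc_iff summable_geometric_iff) simp
  hence "summable (\<lambda>i. norm (1 - t ^ Suc i - 1))" by (simp add: abs_mult t(1) less_imp_le power_abs)
  thus "abs_convergent_prod (\<lambda>i. 1 - t ^ Suc i)" by (simp only: abs_convergent_prod_conv_summable)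
qed

definition qp_inf :: real where
  "qp_inf = (\<Prod>i. 1 - t ^ Suc i)"

lemma qp_tendsto: "qp \<longlonglongrightarrow> qp_inf"
proof -
  have "(\<lambda>n. qp (Suc n)) \<longlonglongrightarrow> qp_inf"
    using convergent_prod_LIMSEQ[OF convergent_prod_qp] by (simp add: qp_def qp_inf_def lessThan_Suc_atMost)
  thus ?thesis by (rule LIMSEQ_imp_Suc)
qed

lemma qp_inf_le: "qp_inf \<le> qp m"
  using decseq_ge[OF decseq_qp qp_tendsto] .

lemma qp_inf_pos: "qp_inf > 0"
proof -
  have "qp_inf \<noteq> 0" unfolding qp_inf_def
    by (rule prodinf_nonzero[OF convergent_prod_qp]) (use t_Suc(2) in \<open>simp add: less_imp_neq[symmetric] del: power_Suc\<close>)
  moreover have "qp_inf \<ge> 0" by (rule LIMSEQ_le_const[OF qp_tendsto]) (use qp_pos in \<open>auto intro: less_imp_le\<close>)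
  ultimately show ?thesis by simp
qed

lemma inverse_qp_le: "1 / qp m \<le> 1 / qp_inf"
  using qp_inf_le qp_inf_pos by (intro divide_left_mono) (simp_all add: qp_pos)

lemma inverse_qp_Suc: "1 / qp (Suc m) = 1 / qp m + t ^ Suc m * (1 / qp (Suc m))"
  using qp_pos[of m] t_Suc(2)[of m] by (simp add: qp_Suc field_simps del: power_Suc)

text \<open>For fixed \<open>r > 0\<close> the recursion in \<open>n\<close> is a contraction with
  factor \<open>t^r\<close>; for \<open>r = 0\<close> this factor is 1, so \<open>a 1\<close> is
  computed directly. This gives the limit \<open>1 / qp r\<close> for \<open>a (Suc r)\<close>.
  Since \<open>a r n\<close> increases with \<open>r\<close>, the diagonal eventually lies above
  each such row and always below \<open>1 / qp_inf\<close>.\<close>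

lemma chain_density_limit:
  fixes a :: "nat \<Rightarrow> nat \<Rightarrow> real"
  assumes a0: "\<And>n. a 0 n = (if n = 0 then 1 else 0)"
    and a_Suc: "\<And>r n. a (Suc r) n = a r n + (if Suc r \<le> n then t ^ r * a (Suc r) (n - Suc r) else 0)"
  shows "\<And>n. a n n \<le> 1 / qp_inf" "(\<lambda>n. a n n) \<longlonglongrightarrow> 1 / qp_inf" "\<And>n r. a r n \<ge> 0"
proof -
  have nonneg: "a r n \<ge> 0" for r n
  proof (induction r arbitrary: n)
    case (Suc r)
    show ?case
    proof (induction n rule: less_induct)
      case (less n)
      show ?case using Suc.IH[of n] less.IH[of "n - Suc r"] t by (subst a_Suc) simp
    qed
  qed (simp add: a0)
  have a1: "a 1 n = 1" for n
  proof (induction n)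
    case (Suc n)
    thus ?case using a_Suc[of 0 "Suc n"] by (simp add: a0)
  qed (simp add: a_Suc a0)
  have le: "a (Suc r) n \<le> 1 / qp r" for r n
  proof (induction r arbitrary: n)
    case 0
    thus ?case using a1 by simp
  next
    case (Suc r)
    show ?case
    proof (induction n rule: less_induct)
      case (less n)
      have "a (Suc (Suc r)) n \<le> 1 / qp r + t ^ Suc r * (1 / qp (Suc r))"
      proof (cases "Suc (Suc r) \<le> n")
        case True
        have "t ^ Suc r * a (Suc (Suc r)) (n - Suc (Suc r)) \<le> t ^ Suc r * (1 / qp (Suc r))"
          using less.IH[of "n - Suc (Suc r)"] True t by (intro mult_left_mono) simp_all
        thus ?thesis using Suc.IH[of n] True by (subst a_Suc) simp
      next
        case False
        have "t ^ Suc r * (1 / qp (Suc r)) \<ge> 0" using t qp_pos[of "Suc r"] by simp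
        thus ?thesis using Suc.IH[of n] False by (subst a_Suc) (simp del: power_Suc)
      qed
      thus ?case using inverse_qp_Suc[of r] by simp
    qed
  qed
  have lim: "(\<lambda>n. a (Suc r) n) \<longlonglongrightarrow> 1 / qp r" for r
  proof (induction r)
    case 0
    thus ?case using a1 by simp
  next
    case (Suc r)
    have "(\<lambda>n. a (Suc (Suc r)) n) \<longlonglongrightarrow> (1 / qp r) / (1 - t ^ Suc r)"
    proof (rule contraction_limit[OF _ t_Suc(2) _ Suc.IH])
      show "a (Suc (Suc r)) n = a (Suc r) n + t ^ Suc r * a (Suc (Suc r)) (n - Suc (Suc r))"
        if "n \<ge> Suc (Suc r)" for n using that by (subst a_Suc) simp
    qed (use t in simp_all)
    thus ?case by (simp add: qp_Suc)
  qed
  have mono: "a r n \<le> a (Suc r) n" for r n using nonneg t by (subst a_Suc) simp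
  have mono': "r \<le> r' \<Longrightarrow> a r n \<le> a r' n" for r r' n
    by (induction r' rule: dec_induct) (auto intro: order_trans mono)
  show ub: "a n n \<le> 1 / qp_inf" for n
    using mono[of n n] le[of n n] inverse_qp_le[of n] by linarith
  show "(\<lambda>n. a n n) \<longlonglongrightarrow> 1 / qp_inf"
  proof (rule order_tendstoI)
    fix b assume b: "b < 1 / qp_inf"
    have "(\<lambda>r. 1 / qp r) \<longlonglongrightarrow> 1 / qp_inf" using qp_tendsto qp_inf_pos by (intro tendsto_intros) simp_all
    from order_tendstoD(1)[OF this b] obtain r where "b < 1 / qp r" by (auto simp: eventually_sequentially)
    from order_tendstoD(1)[OF lim this] have "eventually (\<lambda>n. b < a (Suc r) n) sequentially" .
    moreover have "eventually (\<lambda>n. Suc r \<le> n) sequentially" by (rule eventually_ge_at_top)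
    ultimately show "eventually (\<lambda>n. b < a n n) sequentially"
      by eventually_elim (use mono' in \<open>blast intro: less_le_trans\<close>)
  next
    fix b assume "1 / qp_inf < b"
    thus "eventually (\<lambda>n. a n n < b) sequentially" using ub by (intro always_eventually allI) (rule le_less_trans)
  qed
  show "a r n \<ge> 0" for r n by (rule nonneg)
qed

text \<open>The solution of \<open>sig m = t\<^sup>m * (\<Sum>j\<le>m. sig j / qp (m - j))\<close> with \<open>sig 0 = 1\<close>: the term
  \<open>j = m\<close> has been moved to the left.\<close>

fun sig :: "nat \<Rightarrow> real" where
  "sig m = (if m = 0 then 1 else t ^ m / (1 - t ^ m) * (\<Sum>j<m. sig j / qp (m - j)))"

declare sig.simps [simp del]

lemma sig_0 [simp]: "sig 0 = 1" by (simp add: sig.simps)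

lemma sig_nonneg: "sig m \<ge> 0"
proof (induction m rule: less_induct)
  case (less m)
  show ?case
  proof (cases m)
    case (Suc k)
    have "(\<Sum>j<m. sig j / qp (m - j)) \<ge> 0" using less.IH qp_pos by (intro sum_nonneg) (simp add: less_imp_le)
    thus ?thesis using t_Suc[of k] Suc by (subst sig.simps) (simp del: power_Suc)
  qed simp
qed

lemma sig_eq:
  assumes m: "m > 0"
  shows "sig m = t ^ m * (\<Sum>j\<le>m. sig j / qp (m - j))"
proof -
  obtain k where k: "m = Suc k" using gr0_implies_Suc[OF m] by blast
  have "sig m * (1 - t ^ m) = t ^ m * (\<Sum>j<m. sig j / qp (m - j))"
    using t_Suc(2)[of k] by (subst sig.simps) (simp add: k del: power_Suc)
  thus ?thesis by (simp add: lessThan_Suc_atMost[symmetric] algebra_simps)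
qed

text \<open>One step multiplies the partial sums by at most \<open>1 + C * t ^ Suc m\<close>, and
  the product of these factors is bounded because the powers of \<open>t\<close> are
  summable.\<close>

lemma summable_sig: "summable sig"
proof -
  \<comment> \<open>The factor \<open>1 / qp_inf\<close> bounds all \<open>1 / qp\<close>, and
    \<open>1 / (1 - t)\<close> bounds all \<open>1 / (1 - t ^ Suc m)\<close>.\<close>
  define C where "C = 1 / (qp_inf * (1 - t))"
  have C: "C > 0" using qp_inf_pos t by (simp add: C_def)
  have step: "sig (Suc m) \<le> C * t ^ Suc m * (\<Sum>j\<le>m. sig j)" for m
  proof -
    have "(\<Sum>j<Suc m. sig j / qp (Suc m - j)) \<le> (\<Sum>j<Suc m. sig j * (1 / qp_inf))"
    proof (rule sum_mono)
      fix j
      show "sig j / qp (Suc m - j) \<le> sig j * (1 / qp_inf)"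
        using mult_left_mono[OF inverse_qp_le[of "Suc m - j"] sig_nonneg[of j]] by simp
    qed
    hence 1: "(\<Sum>j<Suc m. sig j / qp (Suc m - j)) \<le> (\<Sum>j\<le>m. sig j) / qp_inf"
      by (simp only: sum_distrib_right[symmetric] lessThan_Suc_atMost) simp
    have "t ^ Suc m \<le> t" using t power_le_one[of t m] by (simp add: mult_le_cancel_left1)
    hence "t ^ Suc m / (1 - t ^ Suc m) \<le> t ^ Suc m / (1 - t)"
      using t t_Suc[of m] by (intro divide_left_mono) simp_all
    moreover have "sig (Suc m) = t ^ Suc m / (1 - t ^ Suc m) * (\<Sum>j<Suc m. sig j / qp (Suc m - j))"
      by (subst sig.simps) simp
    moreover have "(\<Sum>j<Suc m. sig j / qp (Suc m - j)) \<ge> 0"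
      using sig_nonneg qp_pos by (intro sum_nonneg) (simp add: less_imp_le)
    moreover have "t ^ Suc m / (1 - t) \<ge> 0" using t by simp
    ultimately have "sig (Suc m) \<le> t ^ Suc m / (1 - t) * ((\<Sum>j\<le>m. sig j) / qp_inf)"
      using 1 by (simp only: mult_mono)
    thus ?thesis by (simp add: C_def field_simps)
  qed
  have bound: "(\<Sum>j\<le>m. sig j) \<le> exp (C * (\<Sum>i<m. t ^ Suc i))" for m
  proof (induction m)
    case (Suc m)
    have "(\<Sum>j\<le>Suc m. sig j) \<le> (\<Sum>j\<le>m. sig j) * (1 + C * t ^ Suc m)"
      using step[of m] by (simp add: algebra_simps)
    also have "\<dots> \<le> exp (C * (\<Sum>i<m. t ^ Suc i)) * exp (C * t ^ Suc m)"
      using Suc.IH C t by (intro mult_mono exp_ge_add_one_self) (simp_all add: add_nonneg_nonneg)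
    also have "\<dots> = exp (C * (\<Sum>i<Suc m. t ^ Suc i))" by (simp add: exp_add[symmetric] distrib_left del: power_Suc)
    finally show ?case .
  qed simp
  have geo: "(\<Sum>i<m. t ^ Suc i) \<le> 1 / (1 - t)" for m
  proof -
    have "(\<Sum>i<m. t ^ Suc i) \<le> (\<Sum>i<m. t ^ i)" using t by (intro sum_mono power_decreasing) simp_all
    also have "\<dots> \<le> (\<Sum>i. t ^ i)" using t by (intro sum_le_suminf summable_geometric) simp_all
    also have "\<dots> = 1 / (1 - t)" using t by (intro suminf_geometric) simp
    finally show ?thesis .
  qed
  show ?thesis
  proof (rule bounded_imp_summable[of _ "exp (C * (1 / (1 - t)))"])
    fix m
    have "(\<Sum>j\<le>m. sig j) \<le> exp (C * (\<Sum>i<m. t ^ Suc i))" by (rule bound)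
    also have "\<dots> \<le> exp (C * (1 / (1 - t)))" using mult_left_mono[OF geo[of m], of C] C by simp
    finally show "(\<Sum>j\<le>m. sig j) \<le> exp (C * (1 / (1 - t)))" .
  qed (rule sig_nonneg)
qed

text \<open>Both the bound and the limit of \<open>r n m\<close> are \<open>P * sig m\<close>: as
  \<open>sig\<close> solves the same recursion exactly, the bound passes from \<open>k\<close> to
  \<open>k + m\<close>, and the limits follow by induction on \<open>m\<close>. Summability of
  \<open>sig\<close> then permits interchanging limit and sum.\<close>

lemma density_sum_limit:
  fixes r :: "nat \<Rightarrow> nat \<Rightarrow> real"
  assumes nonneg: "\<And>n. r n 0 \<ge> 0" and le: "\<And>n. r n 0 \<le> P" and lim: "(\<lambda>n. r n 0) \<longlonglongrightarrow> P"
    and zero: "\<And>n m. m > n \<Longrightarrow> r n m = 0"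
    and rec: "\<And>k m. m > 0 \<Longrightarrow> r (k + m) m = t ^ m * (\<Sum>j\<le>m. r k j / qp (m - j))"
  shows "(\<lambda>n. \<Sum>m\<le>n. r n m) \<longlonglongrightarrow> P * (\<Sum>m. sig m)"
proof -
  have bounds: "0 \<le> r n m \<and> r n m \<le> P * sig m" for n m
  proof (induction n arbitrary: m rule: less_induct)
    case (less n)
    have P: "P \<ge> 0" using nonneg[of 0] le[of 0] by linarith
    consider "m = 0" | "m > n" | "0 < m" "m \<le> n" by linarith
    thus ?case
    proof cases
      case 3
      define k where "k = n - m"
      have n: "n = k + m" "k < n" using 3 by (simp_all add: k_def)
      have IH: "0 \<le> r k j" "r k j \<le> P * sig j" for j using less.IH[OF n(2)] by blast+
      have "(\<Sum>j\<le>m. r k j / qp (m - j)) \<le> (\<Sum>j\<le>m. P * (sig j / qp (m - j)))"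
      proof (rule sum_mono)
        fix j
        show "r k j / qp (m - j) \<le> P * (sig j / qp (m - j))"
          using divide_right_mono[OF IH(2)[of j], of "qp (m - j)"] qp_pos[of "m - j"] by simp
      qed
      hence "t ^ m * (\<Sum>j\<le>m. r k j / qp (m - j)) \<le> t ^ m * (P * (\<Sum>j\<le>m. sig j / qp (m - j)))"
        using t by (intro mult_left_mono) (simp_all add: sum_distrib_left)
      hence "r n m \<le> P * sig m"
        unfolding n(1) rec[OF 3(1)] sig_eq[OF 3(1)] by (simp only: mult.left_commute[of P])
      moreover have "0 \<le> r n m"
        unfolding n(1) rec[OF 3(1)] using IH(1) qp_pos t
        by (intro mult_nonneg_nonneg sum_nonneg divide_nonneg_nonneg) (simp_all add: less_imp_le)
      ultimately show ?thesis by simp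
    qed (use nonneg le zero P sig_nonneg in simp_all)
  qed
  have lim_m: "(\<lambda>n. r n m) \<longlonglongrightarrow> P * sig m" for m
  proof (induction m rule: less_induct)
    case (less m)
    show ?case
    proof (cases "m = 0")
      case False
      hence m: "m > 0" by simp
      then obtain k where k: "m = Suc k" using gr0_implies_Suc by blast
      have "(\<lambda>n. r (n - m) j) \<longlonglongrightarrow> P * sig j" if "j < m" for j
        by (rule LIMSEQ_offset[where k = m]) (simp add: less.IH[OF that])
      hence y: "(\<lambda>n. t ^ m * (\<Sum>j<m. r (n - m) j / qp (m - j))) \<longlonglongrightarrow>
               t ^ m * (\<Sum>j<m. P * sig j / qp (m - j))"
        using qp_pos by (intro tendsto_intros) (simp_all add: less_imp_neq[symmetric])
      have "(\<lambda>n. r n m) \<longlonglongrightarrow> t ^ m * (\<Sum>j<m. P * sig j / qp (m - j)) / (1 - t ^ m)"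
      \<comment> \<open>The terms with \<open>j < m\<close> converge by induction; the term
        \<open>j = m\<close> has coefficient \<open>t ^ m / qp 0 = t ^ m\<close> and serves as the
        contraction term.\<close>
      proof (rule contraction_limit[OF _ _ m y])
        show "r n m = t ^ m * (\<Sum>j<m. r (n - m) j / qp (m - j)) + t ^ m * r (n - m) m" if "n \<ge> m" for n
          using rec[OF m, of "n - m"] that by (simp add: lessThan_Suc_atMost[symmetric] distrib_left)
      qed (use t t_Suc[of k] k in simp_all)
      also have "t ^ m * (\<Sum>j<m. P * sig j / qp (m - j)) / (1 - t ^ m) = P * sig m"
      proof -
        have "(\<Sum>j<m. P * sig j / qp (m - j)) = P * (\<Sum>j<m. sig j / qp (m - j))" by (simp add: sum_distrib_left)
        moreover have "sig m = t ^ m / (1 - t ^ m) * (\<Sum>j<m. sig j / qp (m - j))"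
          using m by (subst sig.simps) simp
        ultimately show ?thesis by simp
      qed
      finally show ?thesis .
    qed (use lim in simp)
  qed
  have "((\<lambda>n. \<Sum>m. r n m) \<longlonglongrightarrow> (\<Sum>m. P * sig m))"
  proof (rule tannerys_theorem[THEN conjunct2, THEN conjunct2])
    show "eventually (\<lambda>(k, n). norm (r n k) \<le> P * sig k) (at_top \<times>\<^sub>F sequentially)"
      using bounds by (intro always_eventually allI) (simp add: split_def)
    show "summable (\<lambda>m. P * sig m)" by (rule summable_mult[OF summable_sig])
  qed (simp_all add: lim_m)
  moreover have "(\<Sum>m. r n m) = (\<Sum>m\<le>n. r n m)" for n
    by (rule suminf_finite) (use zero in simp_all)
  ultimately show ?thesis by (simp add: suminf_mult[OF summable_sig])
qed

section \<open>The product formula\<close>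

definition sig_gf :: "real \<Rightarrow> real" where
  "sig_gf z = (\<Sum>m. sig m * z ^ m)"

definition euler_gf :: "real \<Rightarrow> real" where
  "euler_gf z = (\<Sum>k. z ^ k / qp k)"

lemma summable_euler_gf: "0 \<le> z \<Longrightarrow> z < 1 \<Longrightarrow> summable (\<lambda>k. z ^ k / qp k)"
proof (rule summable_comparison_test')
  assume z: "0 \<le> z" "z < 1"
  show "summable (\<lambda>k. (1 / qp_inf) * z ^ k)" using z by (intro summable_mult summable_geometric) simp
  show "norm (z ^ k / qp k) \<le> (1 / qp_inf) * z ^ k" for k
    using mult_right_mono[OF inverse_qp_le[of k], of "z ^ k"] z qp_pos[of k] by (simp add: field_simps)
qed

lemma summable_sig_gf: "0 \<le> z \<Longrightarrow> z \<le> 1 \<Longrightarrow> summable (\<lambda>m. sig m * z ^ m)"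
proof (rule summable_comparison_test'[OF summable_sig])
  assume z: "0 \<le> z" "z \<le> 1"
  show "norm (sig m * z ^ m) \<le> sig m" for m
    using mult_left_mono[OF power_le_one[OF z, of m] sig_nonneg[of m]] z sig_nonneg[of m] by (simp add: abs_mult)
qed

text \<open>\<open>E(z) - E(tz) = z E(z)\<close> since \<open>(1 - t\<^sup>k) / qp k = 1 / qp (k - 1)\<close>.\<close>

lemma euler_gf_step:
  assumes z: "0 \<le> z" "z < 1"
  shows "euler_gf (t * z) = euler_gf z * (1 - z)"
proof -
  have tz: "0 \<le> t * z" "t * z < 1"
  proof -
    have "t * z \<le> t * 1" using z t by (intro mult_left_mono) simp_all
    thus "t * z < 1" using t by linarith
  qed (use z t in simp)
  have "euler_gf z - euler_gf (t * z) = (\<Sum>k. z ^ k / qp k - (t * z) ^ k / qp k)"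
    unfolding euler_gf_def by (rule suminf_diff[OF summable_euler_gf[OF z] summable_euler_gf[OF tz]])
  also have "\<dots> = (\<Sum>k. z ^ Suc k / qp (Suc k) - (t * z) ^ Suc k / qp (Suc k))"
    using suminf_split_head[OF summable_diff[OF summable_euler_gf[OF z] summable_euler_gf[OF tz]]] by simp
  also have "\<dots> = (\<Sum>k. z * (z ^ k / qp k))"
  proof (rule suminf_cong)
    fix k
    have "z ^ Suc k / qp (Suc k) - (t * z) ^ Suc k / qp (Suc k) = z ^ Suc k * (1 - t ^ Suc k) / qp (Suc k)"
      by (simp add: power_mult_distrib diff_divide_distrib right_diff_distrib)
    also have "\<dots> = z * (z ^ k / qp k)" using qp_pos[of k] t_Suc(2)[of k] by (simp add: qp_Suc del: power_Suc)
    finally show "z ^ Suc k / qp (Suc k) - (t * z) ^ Suc k / qp (Suc k) = z * (z ^ k / qp k)" .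
  qed
  also have "\<dots> = z * euler_gf z" unfolding euler_gf_def by (rule suminf_mult[OF summable_euler_gf[OF z]])
  finally show ?thesis by (simp add: algebra_simps)
qed

lemma euler_gf_bounds:
  assumes z: "0 \<le> z" "z < 1"
  shows "1 \<le> euler_gf z" "euler_gf z \<le> 1 + z / (qp_inf * (1 - z))"
proof -
  have head: "euler_gf z = 1 + (\<Sum>k. z ^ Suc k / qp (Suc k))"
    using suminf_split_head[OF summable_euler_gf[OF z]] by (simp add: euler_gf_def)
  have sum: "summable (\<lambda>k. z ^ Suc k / qp (Suc k))"
    using summable_euler_gf[OF z] by (simp only: summable_Suc_iff[of "\<lambda>k. z ^ k / qp k"])
  have "0 \<le> (\<Sum>k. z ^ Suc k / qp (Suc k))"
    using z qp_pos by (intro suminf_nonneg[OF sum]) (simp add: less_imp_le)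
  thus "1 \<le> euler_gf z" using head by simp
  have "(\<Sum>k. z ^ Suc k / qp (Suc k)) \<le> (\<Sum>k. (z / qp_inf) * z ^ k)"
  proof (rule suminf_le[OF _ sum])
    show "z ^ Suc k / qp (Suc k) \<le> (z / qp_inf) * z ^ k" for k
      using mult_left_mono[OF inverse_qp_le[of "Suc k"], of "z ^ Suc k"] z by (simp add: mult_ac)
    show "summable (\<lambda>k. (z / qp_inf) * z ^ k)" using z by (intro summable_mult summable_geometric) simp
  qed
  also have "\<dots> = (z / qp_inf) * (1 / (1 - z))"
    using z by (subst suminf_mult) (simp_all add: suminf_geometric)
  finally show "euler_gf z \<le> 1 + z / (qp_inf * (1 - z))" using head by simp
qed

text \<open>Iterating \<open>euler_gf_step\<close> from \<open>t\<close> gives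
  \<open>E(t^(n+1)) = E(t) * qp n\<close>. The left side tends to 1, which determines
  \<open>E(t)\<close> as \<open>1 / qp_inf\<close>.\<close>

lemma euler_gf_power: "euler_gf (t ^ Suc i) = qp i / qp_inf"
proof -
  have step: "euler_gf (t ^ Suc n) = euler_gf t * qp n" for n
  proof (induction n)
    case (Suc n)
    have "euler_gf (t ^ Suc (Suc n)) = euler_gf (t ^ Suc n) * (1 - t ^ Suc n)"
      using euler_gf_step[of "t ^ Suc n"] t_Suc[of n] by simp
    thus ?case using Suc by (simp add: qp_Suc)
  qed simp
  have "(\<lambda>n. t ^ Suc n) \<longlonglongrightarrow> 0" using t by (intro LIMSEQ_Suc LIMSEQ_power_zero) simp
  hence "(\<lambda>n. 1 + t ^ Suc n / (qp_inf * (1 - t ^ Suc n))) \<longlonglongrightarrow> 1 + 0 / (qp_inf * (1 - 0))"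
    using qp_inf_pos by (intro tendsto_intros) simp_all
  hence up: "(\<lambda>n. 1 + t ^ Suc n / (qp_inf * (1 - t ^ Suc n))) \<longlonglongrightarrow> 1" by simp
  have lim1: "(\<lambda>n. euler_gf (t ^ Suc n)) \<longlonglongrightarrow> 1"
  proof (rule tendsto_sandwich[OF _ _ tendsto_const up])
    show "eventually (\<lambda>n. 1 \<le> euler_gf (t ^ Suc n)) sequentially"
      by (intro always_eventually allI euler_gf_bounds(1)[OF less_imp_le[OF t_Suc(1)] t_Suc(2)])
    show "eventually (\<lambda>n. euler_gf (t ^ Suc n) \<le> 1 + t ^ Suc n / (qp_inf * (1 - t ^ Suc n))) sequentially"
      by (intro always_eventually allI euler_gf_bounds(2)[OF less_imp_le[OF t_Suc(1)] t_Suc(2)])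
  qed
  have "(\<lambda>n. euler_gf (t ^ Suc n)) \<longlonglongrightarrow> euler_gf t * qp_inf"
    unfolding step by (intro tendsto_mult tendsto_const qp_tendsto)
  from LIMSEQ_unique[OF this lim1] have "euler_gf t * qp_inf = 1" .
  hence "euler_gf t = 1 / qp_inf" using qp_inf_pos by (simp add: nonzero_eq_divide_eq)
  thus ?thesis using step[of i] by simp
qed

lemma sig_gf_step:
  assumes z: "0 \<le> z" "z \<le> 1"
  shows "sig_gf z = sig_gf (t * z) * euler_gf (t * z)"
proof -
  have tz: "0 \<le> t * z" "t * z < 1"
  proof -
    have "t * z \<le> t * 1" using z t by (intro mult_left_mono) simp_all
    thus "t * z < 1" using t by linarith
  qed (use z t in simp)
  have "sig m * z ^ m = (\<Sum>j\<le>m. (sig j * (t * z) ^ j) * ((t * z) ^ (m - j) / qp (m - j)))" for m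
  proof (cases "m = 0")
    case False
    have "(\<Sum>j\<le>m. (sig j * (t * z) ^ j) * ((t * z) ^ (m - j) / qp (m - j)))
        = (\<Sum>j\<le>m. (t * z) ^ m * (sig j / qp (m - j)))"
    proof (rule sum.cong)
      fix j assume "j \<in> {..m}"
      hence "(t * z) ^ m = (t * z) ^ j * (t * z) ^ (m - j)" by (simp add: power_add[symmetric])
      thus "(sig j * (t * z) ^ j) * ((t * z) ^ (m - j) / qp (m - j)) = (t * z) ^ m * (sig j / qp (m - j))" by simp
    qed simp
    also have "\<dots> = sig m * z ^ m"
      using sig_eq[of m] False by (simp only: sum_distrib_left[symmetric] power_mult_distrib) simp
    finally show ?thesis ..
  qed simp
  hence "sig_gf z = (\<Sum>m. \<Sum>j\<le>m. (sig j * (t * z) ^ j) * ((t * z) ^ (m - j) / qp (m - j)))"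
    by (simp add: sig_gf_def)
  also have "\<dots> = (\<Sum>m. sig m * (t * z) ^ m) * (\<Sum>m. (t * z) ^ m / qp m)"
  proof (rule Cauchy_product[symmetric])
    show "summable (\<lambda>m. norm (sig m * (t * z) ^ m))"
      using summable_sig_gf[of "t * z"] tz sig_nonneg by (simp add: abs_mult)
    show "summable (\<lambda>m. norm ((t * z) ^ m / qp m))"
      using summable_euler_gf[OF tz] tz qp_pos by (simp add: less_imp_le)
  qed
  finally show ?thesis by (simp add: sig_gf_def euler_gf_def)
qed

text \<open>These bounds provide the continuity of \<open>sig_gf\<close> at 0 needed to end the
  iteration.\<close>

lemma sig_gf_bounds:
  assumes z: "0 \<le> z" "z \<le> 1"
  shows "1 \<le> sig_gf z" "sig_gf z \<le> 1 + z * (sig_gf 1 - 1)"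
proof -
  have sz: "summable (\<lambda>m. sig m * z ^ m)" by (rule summable_sig_gf[OF z])
  have head: "sig_gf z = 1 + (\<Sum>m. sig (Suc m) * z ^ Suc m)"
    using suminf_split_head[OF sz] by (simp add: sig_gf_def)
  have sz': "summable (\<lambda>m. sig (Suc m) * z ^ Suc m)"
    using sz by (simp only: summable_Suc_iff[of "\<lambda>m. sig m * z ^ m"])
  have s1: "summable (\<lambda>m. sig (Suc m))" using summable_sig by (simp only: summable_Suc_iff)
  have head1: "sig_gf 1 = 1 + (\<Sum>m. sig (Suc m))"
    using suminf_split_head[OF summable_sig] by (simp add: sig_gf_def)
  have "0 \<le> (\<Sum>m. sig (Suc m) * z ^ Suc m)"
    using z sig_nonneg by (intro suminf_nonneg[OF sz'] mult_nonneg_nonneg zero_le_power)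
  thus "1 \<le> sig_gf z" using head by simp
  have "(\<Sum>m. sig (Suc m) * z ^ Suc m) \<le> (\<Sum>m. z * sig (Suc m))"
  proof (rule suminf_le[OF _ sz' summable_mult[OF s1]])
    fix m
    have "z ^ Suc m \<le> z" using mult_left_mono[OF power_le_one[OF z, of m] z(1)] by simp
    from mult_left_mono[OF this sig_nonneg[of "Suc m"]]
    show "sig (Suc m) * z ^ Suc m \<le> z * sig (Suc m)" by (simp only: mult.commute)
  qed
  also have "\<dots> = z * (\<Sum>m. sig (Suc m))" by (rule suminf_mult[OF s1])
  finally show "sig_gf z \<le> 1 + z * (sig_gf 1 - 1)" using head head1 by simp
qed

section \<open>From the functional equation to the product\<close>

lemma sig_gf_1_eq: "sig_gf 1 = (\<Prod>i<K. qp i / qp_inf) * sig_gf (t ^ K)"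
proof (induction K)
  case (Suc K)
  have "sig_gf (t ^ K) = sig_gf (t ^ Suc K) * euler_gf (t ^ Suc K)"
    using sig_gf_step[of "t ^ K"] t by (simp add: power_le_one)
  thus ?case using Suc euler_gf_power[of K] by simp
qed simp

text \<open>The factor \<open>1 - t ^ Suc l\<close> occurs in \<open>qp i\<close> for
  \<open>l < i < K\<close>, that is, \<open>K - Suc l\<close> times. Completing this to
  \<open>K\<close> occurrences yields \<open>qp K ^ K\<close> and leaves the partial product of the
  theorem.\<close>

lemma prod_qp: "(\<Prod>i<K. qp i) = qp K ^ K * (\<Prod>l<K. inverse ((1 - t ^ Suc l) ^ Suc l))"
proof (induction K)
  case (Suc K)
  let ?b = "1 - t ^ Suc K" and ?P = "\<Prod>l<K. inverse ((1 - t ^ Suc l) ^ Suc l)"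
  have cancel: "(x * b) ^ n * inverse (b ^ n) = x ^ n" if "b \<noteq> 0" for x b :: real and n
    using that by (simp add: power_mult_distrib)
  have b: "?b \<noteq> 0" using t_Suc(2)[of K] by (simp del: power_Suc)
  have "(\<Prod>i<Suc K. qp i) = qp K ^ Suc K * ?P" using Suc by simp
  also have "\<dots> = qp (Suc K) ^ Suc K * inverse (?b ^ Suc K) * ?P"
    unfolding qp_Suc cancel[OF b] ..
  finally show ?case by (simp only: prod.lessThan_Suc mult_ac)
qed simp

text \<open>The partial product equals \<open>sig_gf 1 * u K / sig_gf (t ^ K)\<close>. Here
  \<open>u K\<close> is a \<open>K\<close>-th power, but its base differs from 1 only by a multiple
  of \<open>t ^ K\<close>, and \<open>K * t ^ K\<close> tends to 0.\<close>

lemma partial_products_tendsto: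
  "(\<lambda>K. \<Prod>l<K. inverse ((1 - t ^ Suc l) ^ Suc l)) \<longlonglongrightarrow> sig_gf 1"
proof -
  define u where "u K = (qp_inf / qp K) ^ K" for K
  have u1: "u K \<le> 1" for K
    unfolding u_def using qp_inf_le[of K] qp_inf_pos qp_pos[of K] by (intro power_le_one) simp_all
  define C where "C = 1 / (qp_inf * (1 - t))"
  have C: "C > 0" using qp_inf_pos t by (simp add: C_def)
  have u2: "1 - real K * (C * t ^ Suc K) \<le> u K" if small: "C * t ^ Suc K \<le> 1" for K
  proof -
    let ?x = "C * t ^ Suc K"
    have x: "?x \<ge> 0" using C t by simp
    have "t ^ Suc K \<le> t" using mult_left_mono[of "t ^ K" 1 t] t by (simp add: power_le_one)
    hence "t ^ Suc K / (qp_inf * (1 - t ^ Suc K)) \<le> t ^ Suc K / (qp_inf * (1 - t))"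
      using t t_Suc[of K] qp_inf_pos by (intro divide_left_mono mult_left_mono) simp_all
    \<comment> \<open>The ratio is \<open>euler_gf (t ^ Suc K)\<close>, so the upper bound for
      Euler's series applies.\<close>
    hence "qp K / qp_inf \<le> 1 + ?x"
      using euler_gf_bounds(2)[of "t ^ Suc K"] t_Suc[of K] unfolding euler_gf_power
      by (simp add: C_def del: power_Suc)
    moreover have "qp K / qp_inf > 0" using qp_pos[of K] qp_inf_pos by simp
    ultimately have "1 / (1 + ?x) \<le> 1 / (qp K / qp_inf)" using x by (intro divide_left_mono mult_pos_pos) simp_all
    moreover have "1 - ?x \<le> 1 / (1 + ?x)"
    proof -
      have "(1 - ?x) * (1 + ?x) = 1 - ?x * ?x" by (simp add: algebra_simps)
      hence "(1 - ?x) * (1 + ?x) \<le> 1" using mult_nonneg_nonneg[OF x x] by linarith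
      thus ?thesis using x by (simp add: pos_le_divide_eq)
    qed
    ultimately have "1 - ?x \<le> qp_inf / qp K" by simp
    hence "(1 - ?x) ^ K \<le> u K" unfolding u_def using small by (intro power_mono) simp_all
    moreover have "1 + real K * (- ?x) \<le> (1 + (- ?x)) ^ K" by (rule Bernoulli_inequality) (use small in simp)
    ultimately show ?thesis by simp
  qed
  have "(\<lambda>K. real K * t ^ K) \<longlonglongrightarrow> 0"
    by (rule powser_times_n_limit_0) (use t in simp)
  hence "(\<lambda>K. 1 - (C * t) * (real K * t ^ K)) \<longlonglongrightarrow> 1 - (C * t) * 0" by (intro tendsto_intros)
  hence low: "(\<lambda>K. 1 - real K * (C * t ^ Suc K)) \<longlonglongrightarrow> 1" by (simp add: mult_ac)
  have "(\<lambda>K. C * t ^ Suc K) \<longlonglongrightarrow> C * 0" using t by (intro tendsto_mult tendsto_const LIMSEQ_Suc LIMSEQ_power_zero) simp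
  hence "(\<lambda>K. C * t ^ Suc K) \<longlonglongrightarrow> 0" by simp
  hence "eventually (\<lambda>K. C * t ^ Suc K < 1) sequentially" by (rule order_tendstoD(2)) simp
  hence "eventually (\<lambda>K. 1 - real K * (C * t ^ Suc K) \<le> u K) sequentially"
    by eventually_elim (rule u2, simp)
  hence u_lim: "u \<longlonglongrightarrow> 1"
    by (rule tendsto_sandwich[OF _ _ low tendsto_const]) (simp add: u1)
  have pw: "0 \<le> t ^ K" "t ^ K \<le> 1" for K using t by (simp_all add: power_le_one)
  have t0: "(\<lambda>K. t ^ K) \<longlonglongrightarrow> 0" using t by (intro LIMSEQ_power_zero) simp
  have "(\<lambda>K. 1 + t ^ K * (sig_gf 1 - 1)) \<longlonglongrightarrow> 1 + 0 * (sig_gf 1 - 1)"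
    by (rule tendsto_add[OF tendsto_const tendsto_mult[OF t0 tendsto_const]])
  hence up: "(\<lambda>K. 1 + t ^ K * (sig_gf 1 - 1)) \<longlonglongrightarrow> 1" by simp
  have s_lim: "(\<lambda>K. sig_gf (t ^ K)) \<longlonglongrightarrow> 1"
  proof (rule tendsto_sandwich[OF _ _ tendsto_const up])
    show "eventually (\<lambda>K. 1 \<le> sig_gf (t ^ K)) sequentially"
      by (intro always_eventually allI sig_gf_bounds(1)[OF pw])
    show "eventually (\<lambda>K. sig_gf (t ^ K) \<le> 1 + t ^ K * (sig_gf 1 - 1)) sequentially"
      by (intro always_eventually allI sig_gf_bounds(2)[OF pw])
  qed
  have "(\<Prod>l<K. inverse ((1 - t ^ Suc l) ^ Suc l)) = sig_gf 1 * u K / sig_gf (t ^ K)" for K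
  proof -
    have "sig_gf 1 = qp K ^ K * (\<Prod>l<K. inverse ((1 - t ^ Suc l) ^ Suc l)) / qp_inf ^ K * sig_gf (t ^ K)"
      using sig_gf_1_eq[of K] by (simp add: prod_dividef prod_qp)
    moreover have "sig_gf (t ^ K) > 0" using sig_gf_bounds(1)[OF pw, of K] by simp
    ultimately show ?thesis using qp_pos[of K] qp_inf_pos by (simp add: u_def power_divide)
  qed
  moreover have "(\<lambda>K. sig_gf 1 * u K / sig_gf (t ^ K)) \<longlonglongrightarrow> sig_gf 1 * 1 / 1"
    by (intro tendsto_intros u_lim s_lim) simp
  ultimately show ?thesis by simp
qed

lemma suminf_sig: "(\<Sum>m. sig m) = sig_gf 1"
  by (simp add: sig_gf_def)

end

section \<open>Density of commuting pairs\<close>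

text \<open>Separating \<open>d = 0\<close> from \<open>d = Suc e\<close> turns the convolution into
  a two-term recursion; for generating functions this is multiplication by
  \<open>1 - q x^(r+1)\<close>.\<close>

lemma card_chains_Suc':
  "card (factor_chains (Suc r) n :: 'a::{field,finite} poly list set)
     = card (factor_chains r n :: 'a poly list set) +
       (if Suc r \<le> n then CARD('a) * card (factor_chains (Suc r) (n - Suc r) :: 'a poly list set) else 0)"
proof -
  let ?c = "\<lambda>d. CARD('a) ^ d * card (factor_chains r (n - Suc r * d) :: 'a poly list set)"
  show ?thesis
  proof (cases "Suc r \<le> n")
    case True
    let ?X = "{d. Suc r * d \<le> n - Suc r}"
    have eq: "{d. Suc r * d \<le> n} = insert 0 (Suc ` ?X)"
    proof (intro equalityI subsetI)
      fix d assume d: "d \<in> {d. Suc r * d \<le> n}"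
      show "d \<in> insert 0 (Suc ` ?X)"
      proof (cases d)
        case (Suc e)
        have "Suc r * e \<le> n - Suc r" using d Suc by simp
        thus ?thesis using Suc by simp
      qed simp
    next
      fix d assume "d \<in> insert 0 (Suc ` ?X)"
      then consider "d = 0" | e where "d = Suc e" "Suc r * e \<le> n - Suc r" by blast
      thus "d \<in> {d. Suc r * d \<le> n}"
      proof cases
        case 2
        have "Suc r * d = Suc r * e + Suc r" unfolding 2(1) by simp
        thus ?thesis using 2(2) True by simp
      qed simp
    qed
    have "finite ?X"
    proof (rule finite_subset)
      show "?X \<subseteq> {..n}" by (rule subsetI) simp
    qed simp
    hence fin: "finite (Suc ` ?X)" by (rule finite_imageI)
    have "0 \<notin> Suc ` ?X" by simp
    from sum.insert[OF fin this, of ?c]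
    have "(\<Sum>d | Suc r * d \<le> n. ?c d) = ?c 0 + (\<Sum>d\<in>Suc ` ?X. ?c d)" unfolding eq .
    also have "(\<Sum>d\<in>Suc ` ?X. ?c d) = (\<Sum>d\<in>?X. ?c (Suc d))"
      by (rule sum.reindex[OF inj_on_subset[OF inj_Suc subset_UNIV], unfolded o_def])
    also have "\<dots> = CARD('a) * card (factor_chains (Suc r) (n - Suc r) :: 'a poly list set)"
      unfolding card_chains_Suc sum_distrib_left
    proof (rule sum.cong)
      fix d
      have "n - Suc r * Suc d = n - Suc r - Suc r * d" by simp
      thus "?c (Suc d) = CARD('a) * (CARD('a) ^ d * card (factor_chains r (n - Suc r - Suc r * d) :: 'a poly list set))"
        by (simp only: power_Suc mult.assoc)
    qed simp
    finally show ?thesis using True by (simp add: card_chains_Suc)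
  next
    case False
    have "{d. Suc r * d \<le> n} = {0}"
    proof (intro equalityI subsetI)
      fix d assume d: "d \<in> {d. Suc r * d \<le> n}"
      show "d \<in> {0}"
      proof (cases d)
        case (Suc e)
        hence "Suc r \<le> Suc r * d" by simp
        thus ?thesis using d False by simp
      qed simp
    qed simp
    thus ?thesis using False by (simp add: card_chains_Suc)
  qed
qed

lemma cent_sum_eq_0: "n < m \<Longrightarrow> cent_sum TYPE('a::{field,finite}) n m = 0"
proof -
  assume "n < m"
  have "null_mats n m = ({} :: 'a mat set)"
  proof (rule equals0I)
    fix A :: "'a mat" assume A: "A \<in> null_mats n m"
    hence "A \<in> carrier_mat n n" by (simp add: null_mats_def)
    then obtain m' where "m' \<le> n" "A \<in> null_mats n m'" using carrier_mat_eq_UN_null_mats by blast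
    thus False using null_mats_disjoint[OF A] \<open>n < m\<close> by fastforce
  qed
  thus ?thesis by (simp add: cent_sum_def)
qed

context q_series
begin

lemma real_card_inj_mats:
  assumes t_def: "t = 1 / real CARD('a::{field,finite})" and k: "k \<le> n"
  shows "real (card (inj_mats n k :: 'a mat set)) = real CARD('a) ^ (n * k) * (qp n / qp (n - k))"
proof -
  let ?q = "real CARD('a)"
  have q: "?q > 0" by simp
  have "real (\<Prod>i<k. CARD('a) ^ n - CARD('a) ^ i) = (\<Prod>i<k. ?q ^ n * (1 - t ^ (n - i)))"
    unfolding of_nat_prod
  proof (rule prod.cong)
    fix i assume i: "i \<in> {..<k}"
    have "CARD('a) ^ i \<le> CARD('a) ^ n" using i k by (intro power_increasing) simp_all
    hence "real (CARD('a) ^ n - CARD('a) ^ i) = ?q ^ n - ?q ^ i" by (simp add: of_nat_diff)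
    also have "?q ^ i = ?q ^ n * t ^ (n - i)"
      using i k q by (simp add: t_def power_one_over power_diff)
    finally show "real (CARD('a) ^ n - CARD('a) ^ i) = ?q ^ n * (1 - t ^ (n - i))" by (simp add: right_diff_distrib)
  qed simp
  also have "\<dots> = ?q ^ (n * k) * (\<Prod>i<k. 1 - t ^ (n - i))"
    by (simp add: prod.distrib power_mult)
  also have "(\<Prod>i<k. 1 - t ^ (n - i)) = qp n / qp (n - k)" using k
  proof (induction k)
    case (Suc k)
    have "n - k = Suc (n - Suc k)" using Suc.prems by simp
    hence "qp (n - k) = qp (n - Suc k) * (1 - t ^ (n - k))" by (simp only: qp_Suc)
    hence "1 - t ^ (n - k) = qp (n - k) / qp (n - Suc k)" using qp_pos[of "n - Suc k"] by simp
    moreover have "(\<Prod>i<k. 1 - t ^ (n - i)) = qp n / qp (n - k)" using Suc by simp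
    ultimately show ?case using qp_pos[of "n - k"] by simp
  qed (use qp_pos[of n] in simp)
  finally show ?thesis by (simp only: card_inj_mats)
qed

text \<open>The normalizing factor is \<open>q^n |GL_n|\<close>. With it the products
  \<open>qp\<close> cancel in \<open>cent_sum_recursion\<close> except for
  \<open>1 / qp (m - j)\<close>, which stems from the number of injective \<open>m\<close> by
  \<open>j\<close> matrices.\<close>

lemma cent_density_rec:
  assumes t_def: "t = 1 / real CARD('a::{field,finite})"
  defines "r \<equiv> \<lambda>n m. real (cent_sum TYPE('a) n m) / (real CARD('a) ^ (n * n + n) * qp n)"
  shows "r (k + m) m = t ^ m * (\<Sum>j\<le>m. r k j / qp (m - j))"
proof -
  let ?q = "real CARD('a)" and ?n = "k + m"
  have q: "?q > 0" by simp
  note inj = real_card_inj_mats[OF t_def]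
  have cs: "real (cent_sum TYPE('a) n j) = r n j * (?q ^ (n * n + n) * qp n)" for n j
    using qp_pos[of n] q by (simp add: r_def)
  have r0: "r n j = 0" if "n < j" for n j using that by (simp add: r_def cent_sum_eq_0)
  let ?S = "\<Sum>j\<le>m. r k j / qp (m - j)"
  have summand: "real (card (inj_mats m j :: 'a mat set)) * ?q ^ (m * (k - j)) * real (cent_sum TYPE('a) k j)
      = ?q ^ (m * k + k * k + k) * qp m * qp k * (if j \<le> m then r k j / qp (m - j) else 0)" if j: "j \<le> k" for j
  proof (cases "j \<le> m")
    case True
    have "m * k = m * j + m * (k - j)" using j by (simp add: distrib_left[symmetric])
    thus ?thesis using True by (simp add: inj[OF True] cs power_add mult_ac)
  next
    case False
    hence "inj_mats m j = ({} :: 'a mat set)" using inj_mats_le[of _ m j, where 'a = 'a] by fastforce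
    thus ?thesis using False by simp
  qed
  have "(\<Sum>j\<le>k. real (card (inj_mats m j :: 'a mat set)) * ?q ^ (m * (k - j)) * real (cent_sum TYPE('a) k j))
      = ?q ^ (m * k + k * k + k) * qp m * qp k * (\<Sum>j\<le>k. if j \<le> m then r k j / qp (m - j) else 0)"
    unfolding sum_distrib_left by (rule sum.cong) (simp_all add: summand)
  \<comment> \<open>The range changes from \<open>j <= k\<close> to \<open>j <= m\<close>: terms
    with \<open>j > m\<close> are already 0, as there are no injective \<open>m\<close> by
    \<open>j\<close> matrices, and terms with \<open>j > k\<close> vanish because the nullity cannot
    exceed the size.\<close>
  also have "(\<Sum>j\<le>k. if j \<le> m then r k j / qp (m - j) else 0) = ?S"
  proof -
    have "(\<Sum>j\<le>k. if j \<le> m then r k j / qp (m - j) else 0) = (\<Sum>j\<in>{..k} \<inter> {..m}. r k j / qp (m - j))"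
      by (subst sum.inter_restrict) simp_all
    also have "\<dots> = ?S"
    proof (rule sum.mono_neutral_left)
      show "\<forall>j\<in>{..m} - {..k} \<inter> {..m}. r k j / qp (m - j) = 0"
      proof
        fix j assume "j \<in> {..m} - {..k} \<inter> {..m}"
        hence "k < j" by (cases "j \<le> k") simp_all
        thus "r k j / qp (m - j) = 0" by (simp only: r0 div_0)
      qed
    qed simp_all
    finally show ?thesis .
  qed
  finally have sum: "(\<Sum>j\<le>k. real (card (inj_mats m j :: 'a mat set)) * ?q ^ (m * (k - j)) * real (cent_sum TYPE('a) k j))
      = ?q ^ (m * k + k * k + k) * qp m * qp k * ?S" .
  have "real (card (inj_mats k k :: 'a mat set)) * real (cent_sum TYPE('a) ?n m)
      = ?q ^ (m * m) * real (card (inj_mats ?n k :: 'a mat set)) *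
        (\<Sum>j\<le>k. real (card (inj_mats m j :: 'a mat set)) * ?q ^ (m * (k - j)) * real (cent_sum TYPE('a) k j))"
    using arg_cong[OF cent_sum_recursion[of k m, where 'a = 'a], of real] by simp
  hence "?q ^ (k * k) * qp k * (r ?n m * (?q ^ (?n * ?n + ?n) * qp ?n))
      = ?q ^ (m * m) * (?q ^ (?n * k) * (qp ?n / qp m)) * (?q ^ (m * k + k * k + k) * qp m * qp k * ?S)"
    unfolding sum unfolding cs inj[OF order_refl] inj[OF le_add1] by simp
  also have "\<dots> = ?q ^ (k * k) * qp k * (?q ^ (m * m + ?n * k + m * k + k) * qp ?n * ?S)"
    using qp_pos[of m] by (simp add: power_add mult_ac)
  finally have "r ?n m * ?q ^ (?n * ?n + ?n) = ?q ^ (m * m + ?n * k + m * k + k) * ?S"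
    using qp_pos[of k] qp_pos[of ?n] q by simp
  \<comment> \<open>The surplus \<open>m\<close> in this exponent is the origin of the factor
    \<open>t ^ m\<close>.\<close>
  moreover have "?n * ?n + ?n = (m * m + ?n * k + m * k + k) + m" by (simp add: algebra_simps)
  ultimately have "?q ^ (m * m + ?n * k + m * k + k) * (r ?n m * ?q ^ m) = ?q ^ (m * m + ?n * k + m * k + k) * ?S"
    by (simp only: power_add mult_ac)
  hence "r ?n m * ?q ^ m = ?S" using q by simp
  thus ?thesis using q by (simp add: t_def power_one_over field_simps)
qed

text \<open>The sum of the \<open>r n m\<close> is the density divided by \<open>qp n\<close>;
  multiplying back contributes \<open>qp_inf\<close> in the limit, which cancels the limit
  \<open>1 / qp_inf\<close> of the initial values.\<close>

lemma commuting_density_limit: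
  assumes t_def: "t = 1 / real CARD('a::{field,finite})"
  shows "(\<lambda>n. real (num_commuting_pairs TYPE('a) n) / real CARD('a) ^ (n\<^sup>2 + n)) \<longlonglongrightarrow> sig_gf 1"
proof -
  let ?q = "real CARD('a)"
  have q: "?q > 0" by simp
  define r where "r n m = real (cent_sum TYPE('a) n m) / (?q ^ (n * n + n) * qp n)" for n m
  define a where "a k n = real (card (factor_chains k n :: 'a poly list set)) * t ^ n" for k n
  have ra: "r n 0 = a n n" for n
  proof -
    have "real (cent_sum TYPE('a) n 0) = ?q ^ (n * n) * qp n * real (card (factor_chains n n :: 'a poly list set))"
      using real_card_inj_mats[OF t_def order_refl, of n] by (simp add: cent_sum_0)
    thus ?thesis using q qp_pos[of n] by (simp add: r_def a_def t_def power_add power_one_over)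
  qed
  have a0: "a 0 n = (if n = 0 then 1 else 0)" for n by (simp add: a_def factor_chains_0)
  have a_Suc: "a (Suc k) n = a k n + (if Suc k \<le> n then t ^ k * a (Suc k) (n - Suc k) else 0)" for k n
  proof (cases "Suc k \<le> n")
    case True
    have "t ^ n = t ^ (Suc k + (n - Suc k))" using True by simp
    also have "\<dots> = t * (t ^ k * t ^ (n - Suc k))" by (simp only: power_add power_Suc mult.assoc)
    finally have "?q * t ^ n = (?q * t) * (t ^ k * t ^ (n - Suc k))" by (simp only: mult.assoc)
    moreover have "?q * t = 1" by (simp add: t_def)
    \<comment> \<open>The factor \<open>q\<close> for one more degree of the last polynomial absorbs
      one of the \<open>k + 1\<close> powers of \<open>t\<close>, so that the coefficient is
      \<open>t ^ k\<close>.\<close>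
    ultimately have qt: "?q * t ^ n = t ^ k * t ^ (n - Suc k)" by simp
    have "a (Suc k) n = a k n + (?q * t ^ n) * real (card (factor_chains (Suc k) (n - Suc k) :: 'a poly list set))"
      using True by (simp add: a_def card_chains_Suc'[of k n] algebra_simps)
    thus ?thesis using True unfolding qt by (simp add: a_def mult_ac)
  qed (simp add: a_def card_chains_Suc'[of k n])
  note lim = chain_density_limit[of a, OF a0 a_Suc]
  have "(\<lambda>n. \<Sum>m\<le>n. r n m) \<longlonglongrightarrow> 1 / qp_inf * (\<Sum>m. sig m)"
  proof (rule density_sum_limit)
    show "r n 0 \<ge> 0" "r n 0 \<le> 1 / qp_inf" for n unfolding ra by (rule lim(3), rule lim(1))
    show "(\<lambda>n. r n 0) \<longlonglongrightarrow> 1 / qp_inf" unfolding ra by (rule lim(2))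
    show "r n m = 0" if "n < m" for n m using that by (simp add: r_def cent_sum_eq_0)
    show "r (k + m) m = t ^ m * (\<Sum>j\<le>m. r k j / qp (m - j))" for k m
      unfolding r_def by (rule cent_density_rec[OF t_def])
  qed
  hence "(\<lambda>n. qp n * (\<Sum>m\<le>n. r n m)) \<longlonglongrightarrow> qp_inf * (1 / qp_inf * sig_gf 1)"
    unfolding suminf_sig by (intro tendsto_mult qp_tendsto)
  moreover have "qp n * (\<Sum>m\<le>n. r n m) = real (num_commuting_pairs TYPE('a) n) / ?q ^ (n\<^sup>2 + n)" for n
  proof -
    have "qp n * (\<Sum>m\<le>n. r n m) = (\<Sum>m\<le>n. real (cent_sum TYPE('a) n m) / ?q ^ (n * n + n))"
      unfolding sum_distrib_left using qp_pos[of n] by (intro sum.cong) (simp_all add: r_def)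
    thus ?thesis by (simp add: num_commuting_pairs_eq_sum sum_divide_distrib power2_eq_square)
  qed
  ultimately show ?thesis using qp_inf_pos by simp
qed

end

theorem theorem2p6:
  fixes q :: nat
  assumes "primepow q"
    and "CARD('a :: {field, finite}) = q"
  defines "f \<equiv> (\<lambda>j::nat. (1 - 1 / real q ^ Suc j) powi (- int (Suc j)))"
  shows "convergent_prod f \<and>
    (\<lambda>n. real (num_commuting_pairs TYPE('a) n) / real q ^ (n\<^sup>2 + n)) \<longlonglongrightarrow> (\<Prod>j. f j)"
proof -
  define t where "t = 1 / real q"
  have q: "q > 1" using CARD_field_gt_1[where 'a = 'a] assms(2) by simp
  interpret q_series t by unfold_locales (use q in \<open>simp_all add: t_def\<close>)
  have f: "f j = inverse ((1 - t ^ Suc j) ^ Suc j)" for j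
    unfolding f_def t_def power_one_over power_int_minus power_int_of_nat ..
  have nz: "f j \<noteq> 0" for j
    unfolding f using t_Suc(2)[of j] by (simp del: power_Suc)
  have "(\<lambda>n. \<Prod>j<n. f j) \<longlonglongrightarrow> sig_gf 1" unfolding f by (rule partial_products_tendsto)
  hence lim: "(\<lambda>n. \<Prod>j\<le>n. f j) \<longlonglongrightarrow> sig_gf 1"
    unfolding lessThan_Suc_atMost[symmetric] by (rule LIMSEQ_Suc)
  \<comment> \<open>\<open>convergent_prod\<close> demands a nonzero limit of the partial
    products.\<close>
  moreover have "sig_gf 1 \<noteq> 0" using sig_gf_bounds(1)[of 1] by simp
  ultimately have conv: "convergent_prod f" using convergent_prod_iff_nz_lim[of f, OF nz] by blast
  have "(\<Prod>j. f j) = sig_gf 1" by (rule LIMSEQ_unique[OF convergent_prod_LIMSEQ[OF conv] lim])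
  moreover have "(\<lambda>n. real (num_commuting_pairs TYPE('a) n) / real q ^ (n\<^sup>2 + n)) \<longlonglongrightarrow> sig_gf 1"
    using commuting_density_limit[where 'a = 'a] assms(2) by (simp add: t_def)
  ultimately show ?thesis using conv by simp
qed

end
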